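(* Let $S_3$ be the permutation group of three elements and let $S=\{s,t\}$ with $s=(1\,2)$, $t=(2\,3)$. The quantum group of orientation preserving isometries $\mathrm{QISO}^+(S_3,S)$ for this generating set built of transpositions is isomorphic to $C^*(S_3)\oplus C^*(S_3)$ as a $C^*$-algebra. Its action on $C^*(S_3)$ is given by the formula $$\alpha(\lambda_s)=\lambda_s\otimes A+\lambda_t\otimes B,\qquad \alpha(\lambda_t)=\lambda_s\otimes C+\lambda_t\otimes D,$$ where $A,B,C,D$ are respectively identified with $\lambda_s\oplus0,\ 0\oplus\lambda_t,\ 0\oplus\lambda_s,\ \lambda_t\oplus0\in C^*(S_3)\oplus C^*(S_3)$. The coproduct of $\mathrm{QISO}^+(S_3,S)$ can be read out from the condition that $$\begin{pmatrix} A & B \\ C & D \end{pmatrix}$$ is the fundamental corepresentation.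
   Context: Let $\Gamma$ be a discrete group with a finite symmetric generating set $S$ and associated word-length function $l$. $C^*_r(\Gamma)$ is generated by the left regular representation unitaries $\lambda_\gamma$ on $\ell^2(\Gamma)$ (for $\Gamma$ finite or abelian $C^*_r(\Gamma)=C^*(\Gamma)$), and $\tau$ is the canonical trace, $\tau(\lambda_\gamma)=\delta_{\gamma,e}$. All $C^*$-tensor products are minimal; $\otimes_{\mathrm{alg}}$ is algebraic. A matrix $u=(u_{ij})$ over a compact quantum group $(\mathsf Q,\Delta)$ is a (finite-dimensional) corepresentation if $\Delta(u_{ij})=\sum_k u_{ik}\otimes u_{kj}$; it is fundamental if it is unitary and its entries generate $\mathsf Q$ as a $C^*$-algebra. An action of $(\mathsf Q,\Delta)$ on a unital $C^*$-algebra $\mathsf A$ is a unital $^*$-homomorphism $\alpha:\mathsf A\to\mathsf A\otimes\mathsf Q$ that satisfies the coaction identity with respect to $\Delta$ and for which $\mathrm{Lin}\,\alpha(\mathsf A)(1\otimes\mathsf Q)$ is dense in $\mathsf A\otimes\mathsf Q$. Convention: the order of the two $\mathsf Q$-legs in the coaction identity is the one matching the displayed matrix, namely $(\alpha\otimes\mathrm{id})\alpha=(\mathrm{id}\otimes\sigma\Delta)\alpha$, with $\sigma$ the flip on $\mathsf Q\otimes\mathsf Q$. (With the other common order, $(\alpha\otimes\mathrm{id})\alpha=(\mathrm{id}\otimes\Delta)\alpha$, the coproduct is replaced by its opposite.) $\mathrm{QISO}^+(\Gamma,S)$, the quantum group of orientation preserving isometries of the spectral triple $(\mathbb{C}[\Gamma],\ell^2(\Gamma),D_\Gamma)$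 with $D_\Gamma\delta_\gamma=l(\gamma)\delta_\gamma$, is (characterized, up to isomorphism, as) the universal (initial) object in the category of pairs $(\mathsf Q,\alpha)$, where $\mathsf Q$ is a compact quantum group and $\alpha$ is an action of $\mathsf Q$ on $C^*_r(\Gamma)$ such that $(\tau\otimes\mathrm{id})\alpha(a)=\tau(a)1_{\mathsf Q}$ for all $a$, and $\alpha(\lambda_\gamma)\in\mathrm{Lin}\{\lambda_{\gamma'}:l(\gamma')=l(\gamma)\}\otimes_{\mathrm{alg}}\mathsf Q$ for all $\gamma\in\Gamma$ (i.e. $\alpha$ commutes with the map $\lambda_\gamma\mapsto l(\gamma)\lambda_\gamma$ on $\mathbb{C}[\Gamma]$). Morphisms $(\mathsf Q,\alpha)\to(\mathsf Q',\alpha')$ are compact quantum group morphisms $\Phi:\mathsf Q\to\mathsf Q'$ with $(\mathrm{id}\otimes\Phi)\alpha=\alpha'$. *)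

theory Defs
  imports "HOL-Analysis.Analysis" "HOL-Algebra.Sym_Groups" "HOL-Library.Function_Algebras"
begin

section \<open>Bounded operators on square-summable sequences\<close>

text \<open>
  A bounded operator \<open>a\<close> on the Hilbert space of square-summable functions on the type \<open>'x\<close> is
  represented by its matrix \<open>a x y = \<langle>\<delta>\<^sub>x, a \<delta>\<^sub>y\<rangle>\<close>.  Every Hilbert space is of this form up to
  unitary equivalence, and the Hilbert space tensor product (direct sum) of the spaces over \<open>'x\<close>
  and \<open>'y\<close> is the space over \<open>'x \<times> 'y\<close> (over \<open>'x + 'y\<close>).  Addition, subtraction and zero of
  matrices are the pointwise ones.
\<close>

type_synonym 'x matop = "'x \<Rightarrow> 'x \<Rightarrow> complex"

text \<open>The form \<open>\<langle>\<xi>, a \<eta>\<rangle>\<close> is bounded by \<open>c \<parallel>\<xi>\<parallel> \<parallel>\<eta>\<parallel>\<close> on finitely supported vectors; such \<open>a\<close> are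
  exactly the matrices of operators of norm at most \<open>c\<close>.\<close>

definition op_bounded_by :: "real \<Rightarrow> 'x matop \<Rightarrow> bool" where
  "op_bounded_by c a \<longleftrightarrow> 0 \<le> c \<and>
     (\<forall>F \<xi> \<eta>. finite F \<longrightarrow>
        cmod (\<Sum>x\<in>F. \<Sum>y\<in>F. cnj (\<xi> x) * a x y * \<eta> y)
          \<le> c * sqrt (\<Sum>x\<in>F. (cmod (\<xi> x))\<^sup>2) * sqrt (\<Sum>y\<in>F. (cmod (\<eta> y))\<^sup>2))"

definition bounded_op :: "'x matop \<Rightarrow> bool" where
  "bounded_op a \<longleftrightarrow> (\<exists>c. op_bounded_by c a)"

definition op_norm :: "'x matop \<Rightarrow> real" where
  "op_norm a = Inf {c. op_bounded_by c a}"

definition op_scale :: "complex \<Rightarrow> 'x matop \<Rightarrow> 'x matop" (infixr "*\<^sub>o" 75) where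
  "c *\<^sub>o a = (\<lambda>x y. c * a x y)"

text \<open>For bounded operators the sum below converges absolutely.\<close>

definition op_mult :: "'x matop \<Rightarrow> 'x matop \<Rightarrow> 'x matop" (infixl "\<odot>" 70) where
  "a \<odot> b = (\<lambda>x z. \<Sum>\<^sub>\<infinity>y. a x y * b y z)"

definition op_adj :: "'x matop \<Rightarrow> 'x matop" where
  "op_adj a = (\<lambda>x y. cnj (a y x))"

definition op_tensor :: "'x matop \<Rightarrow> 'y matop \<Rightarrow> ('x \<times> 'y) matop" (infixl "\<otimes>\<^sub>o" 72) where
  "a \<otimes>\<^sub>o b = (\<lambda>p q. a (fst p) (fst q) * b (snd p) (snd q))"

fun op_dsum :: "'x matop \<Rightarrow> 'y matop \<Rightarrow> ('x + 'y) matop" (infixl "\<oplus>\<^sub>o" 65) where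
  "(a \<oplus>\<^sub>o b) (Inl x) (Inl x') = a x x'"
| "(a \<oplus>\<^sub>o b) (Inr y) (Inr y') = b y y'"
| "(a \<oplus>\<^sub>o b) (Inl x) (Inr y) = 0"
| "(a \<oplus>\<^sub>o b) (Inr y) (Inl x) = 0"

definition op_flip :: "('x \<times> 'y) matop \<Rightarrow> ('y \<times> 'x) matop" where
  "op_flip u = (\<lambda>p q. u (prod.swap p) (prod.swap q))"

definition op_assoc :: "('x \<times> ('y \<times> 'z)) matop \<Rightarrow> (('x \<times> 'y) \<times> 'z) matop" where
  "op_assoc u = (\<lambda>((x, y), z) ((x', y'), z'). u (x, (y, z)) (x', (y', z')))"

definition lin_span :: "'x matop set \<Rightarrow> 'x matop set" where
  "lin_span X = {\<Sum>a\<in>F. c a *\<^sub>o a | F c. finite F \<and> F \<subseteq> X}"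

definition op_closure :: "'x matop set \<Rightarrow> 'x matop set" where
  "op_closure X = {a. bounded_op a \<and> (\<forall>e>0. \<exists>b\<in>X. bounded_op b \<and> op_norm (a - b) < e)}"


section \<open>C*-algebras and their minimal tensor products\<close>

text \<open>
  C*-algebras are norm-closed *-subalgebras of the bounded operators; by the Gelfand--Naimark
  theorem this covers all of them as \<open>'x\<close> varies.  The unit of a unital C*-algebra need not be
  the identity operator.
\<close>

definition cstar_algebra :: "'x matop set \<Rightarrow> bool" where
  "cstar_algebra A \<longleftrightarrow>
     (\<forall>a\<in>A. bounded_op a) \<and> 0 \<in> A \<and>
     (\<forall>a\<in>A. \<forall>b\<in>A. a + b \<in> A \<and> a \<odot> b \<in> A) \<and>
     (\<forall>a\<in>A. op_adj a \<in> A \<and> (\<forall>c. c *\<^sub>o a \<in> A)) \<and>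
     op_closure A \<subseteq> A"

definition is_unit :: "'x matop set \<Rightarrow> 'x matop \<Rightarrow> bool" where
  "is_unit A e \<longleftrightarrow> e \<in> A \<and> (\<forall>a\<in>A. e \<odot> a = a \<and> a \<odot> e = a)"

definition unit_of :: "'x matop set \<Rightarrow> 'x matop" where
  "unit_of A = (THE e. is_unit A e)"

definition unital_cstar_algebra :: "'x matop set \<Rightarrow> bool" where
  "unital_cstar_algebra A \<longleftrightarrow> cstar_algebra A \<and> (\<exists>e. is_unit A e)"

definition cstar_generated :: "'x matop set \<Rightarrow> 'x matop set" where
  "cstar_generated X = \<Inter>{B. cstar_algebra B \<and> X \<subseteq> B}"

definition cstar_dsum :: "'x matop set \<Rightarrow> 'y matop set \<Rightarrow> ('x + 'y) matop set" where
  "cstar_dsum A B = {a \<oplus>\<^sub>o b | a b. a \<in> A \<and> b \<in> B}"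

definition alg_tensor :: "'x matop set \<Rightarrow> 'y matop set \<Rightarrow> ('x \<times> 'y) matop set" where
  "alg_tensor A B = lin_span {a \<otimes>\<^sub>o b | a b. a \<in> A \<and> b \<in> B}"

text \<open>The minimal tensor product is the spatial one.\<close>

definition min_tensor :: "'x matop set \<Rightarrow> 'y matop set \<Rightarrow> ('x \<times> 'y) matop set" where
  "min_tensor A B = op_closure (alg_tensor A B)"

definition linear_on_ops :: "'x matop set \<Rightarrow> ('x matop \<Rightarrow> 'y matop) \<Rightarrow> bool" where
  "linear_on_ops A f \<longleftrightarrow>
     (\<forall>a\<in>A. \<forall>b\<in>A. f (a + b) = f a + f b) \<and> (\<forall>a\<in>A. \<forall>c. f (c *\<^sub>o a) = c *\<^sub>o f a)"

definition unital_star_hom ::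
    "'x matop set \<Rightarrow> 'y matop set \<Rightarrow> ('x matop \<Rightarrow> 'y matop) \<Rightarrow> bool" where
  "unital_star_hom A B f \<longleftrightarrow>
     (\<forall>a\<in>A. f a \<in> B) \<and> linear_on_ops A f \<and>
     (\<forall>a\<in>A. \<forall>b\<in>A. f (a \<odot> b) = f a \<odot> f b) \<and>
     (\<forall>a\<in>A. f (op_adj a) = op_adj (f a)) \<and>
     f (unit_of A) = unit_of B"

text \<open>\<open>tensor_map A B f g T\<close> says that \<open>T\<close> is, on the minimal tensor product of \<open>A\<close> and \<open>B\<close>, the
  map \<open>f \<otimes> g\<close>, i.e. the continuous linear extension of \<open>a \<otimes> b \<mapsto> f a \<otimes> g b\<close>.  Its values
  there are determined by \<open>f\<close> and \<open>g\<close>, and for *-homomorphisms \<open>f\<close> and \<open>g\<close> it always exists.\<close>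

definition tensor_map ::
    "'x matop set \<Rightarrow> 'y matop set \<Rightarrow> ('x matop \<Rightarrow> 'u matop) \<Rightarrow> ('y matop \<Rightarrow> 'v matop)
      \<Rightarrow> (('x \<times> 'y) matop \<Rightarrow> ('u \<times> 'v) matop) \<Rightarrow> bool" where
  "tensor_map A B f g T \<longleftrightarrow>
     linear_on_ops (min_tensor A B) T \<and>
     (\<exists>K. \<forall>u\<in>min_tensor A B. bounded_op (T u) \<and> op_norm (T u) \<le> K * op_norm u) \<and>
     (\<forall>a\<in>A. \<forall>b\<in>B. T (a \<otimes>\<^sub>o b) = f a \<otimes>\<^sub>o g b)"


section \<open>Compact quantum groups, corepresentations and actions\<close>

definition compact_quantum_group ::
    "'x matop set \<Rightarrow> ('x matop \<Rightarrow> ('x \<times> 'x) matop) \<Rightarrow> bool" where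
  "compact_quantum_group Q \<Delta> \<longleftrightarrow>
     unital_cstar_algebra Q \<and>
     unital_star_hom Q (min_tensor Q Q) \<Delta> \<and>
     (\<exists>T1 T2. tensor_map Q Q \<Delta> id T1 \<and> tensor_map Q Q id \<Delta> T2 \<and>
        (\<forall>a\<in>Q. T1 (\<Delta> a) = op_assoc (T2 (\<Delta> a)))) \<and>
     op_closure (lin_span {\<Delta> a \<odot> (unit_of Q \<otimes>\<^sub>o b) | a b. a \<in> Q \<and> b \<in> Q}) = min_tensor Q Q \<and>
     op_closure (lin_span {\<Delta> a \<odot> (b \<otimes>\<^sub>o unit_of Q) | a b. a \<in> Q \<and> b \<in> Q}) = min_tensor Q Q"

definition cqg_morphism ::
    "'x matop set \<Rightarrow> ('x matop \<Rightarrow> ('x \<times> 'x) matop) \<Rightarrow> 'y matop set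
      \<Rightarrow> ('y matop \<Rightarrow> ('y \<times> 'y) matop) \<Rightarrow> ('x matop \<Rightarrow> 'y matop) \<Rightarrow> bool" where
  "cqg_morphism Q \<Delta> Q' \<Delta>' \<Phi> \<longleftrightarrow>
     unital_star_hom Q Q' \<Phi> \<and>
     (\<exists>T. tensor_map Q Q \<Phi> \<Phi> T \<and> (\<forall>a\<in>Q. T (\<Delta> a) = \<Delta>' (\<Phi> a)))"

text \<open>Matrices of size \<open>n\<close> over \<open>Q\<close> are functions on the indices \<open>0, \<dots>, n - 1\<close>.\<close>

definition corepresentation ::
    "nat \<Rightarrow> 'x matop set \<Rightarrow> ('x matop \<Rightarrow> ('x \<times> 'x) matop) \<Rightarrow> (nat \<Rightarrow> nat \<Rightarrow> 'x matop) \<Rightarrow> bool" where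
  "corepresentation n Q \<Delta> u \<longleftrightarrow>
     (\<forall>i<n. \<forall>j<n. u i j \<in> Q \<and> \<Delta> (u i j) = (\<Sum>k<n. u i k \<otimes>\<^sub>o u k j))"

definition unitary_matrix :: "nat \<Rightarrow> 'x matop set \<Rightarrow> (nat \<Rightarrow> nat \<Rightarrow> 'x matop) \<Rightarrow> bool" where
  "unitary_matrix n Q u \<longleftrightarrow>
     (\<forall>i<n. \<forall>j<n.
        (\<Sum>k<n. u i k \<odot> op_adj (u j k)) = (if i = j then unit_of Q else 0) \<and>
        (\<Sum>k<n. op_adj (u k i) \<odot> u k j) = (if i = j then unit_of Q else 0))"

definition fundamental_corepresentation ::
    "nat \<Rightarrow> 'x matop set \<Rightarrow> ('x matop \<Rightarrow> ('x \<times> 'x) matop) \<Rightarrow> (nat \<Rightarrow> nat \<Rightarrow> 'x matop) \<Rightarrow> bool" where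
  "fundamental_corepresentation n Q \<Delta> u \<longleftrightarrow>
     corepresentation n Q \<Delta> u \<and> unitary_matrix n Q u \<and>
     cstar_generated {u i j | i j. i < n \<and> j < n} = Q"

text \<open>The coaction identity is \<open>(\<alpha> \<otimes> id) \<alpha> = (id \<otimes> \<sigma>\<Delta>) \<alpha>\<close> with \<open>\<sigma>\<close> the flip.\<close>

definition cqg_action ::
    "'a matop set \<Rightarrow> 'x matop set \<Rightarrow> ('x matop \<Rightarrow> ('x \<times> 'x) matop)
      \<Rightarrow> ('a matop \<Rightarrow> ('a \<times> 'x) matop) \<Rightarrow> bool" where
  "cqg_action A Q \<Delta> \<alpha> \<longleftrightarrow>
     unital_star_hom A (min_tensor A Q) \<alpha> \<and>
     (\<exists>T1 T2. tensor_map A Q \<alpha> id T1 \<and> tensor_map A Q id (\<lambda>q. op_flip (\<Delta> q)) T2 \<and>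
        (\<forall>a\<in>A. T1 (\<alpha> a) = op_assoc (T2 (\<alpha> a)))) \<and>
     op_closure (lin_span {\<alpha> a \<odot> (unit_of A \<otimes>\<^sub>o q) | a q. a \<in> A \<and> q \<in> Q}) = min_tensor A Q"


section \<open>Reduced group C*-algebras and their quantum isometry groups\<close>

text \<open>Vectors \<open>\<delta>\<^sub>x\<close> with \<open>x\<close> outside the carrier are annihilated, so that these operators live on
  the square-summable functions on the carrier.\<close>

definition lreg :: "('g, 'm) monoid_scheme \<Rightarrow> 'g \<Rightarrow> 'g matop" where
  "lreg G \<gamma> = (\<lambda>x y. if x \<in> carrier G \<and> y \<in> carrier G \<and> x = \<gamma> \<otimes>\<^bsub>G\<^esub> y then 1 else 0)"

definition Cred :: "('g, 'm) monoid_scheme \<Rightarrow> 'g matop set" where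
  "Cred G = cstar_generated (lreg G ` carrier G)"

text \<open>The canonical trace is the vector state of \<open>\<delta>\<^sub>e\<close>, and \<open>\<tau> \<otimes> id\<close> is the corresponding slice
  map.\<close>

definition gtrace :: "('g, 'm) monoid_scheme \<Rightarrow> 'g matop \<Rightarrow> complex" where
  "gtrace G a = a \<one>\<^bsub>G\<^esub> \<one>\<^bsub>G\<^esub>"

definition gtrace_slice :: "('g, 'm) monoid_scheme \<Rightarrow> ('g \<times> 'x) matop \<Rightarrow> 'x matop" where
  "gtrace_slice G u = (\<lambda>x y. u (\<one>\<^bsub>G\<^esub>, x) (\<one>\<^bsub>G\<^esub>, y))"

definition word_length :: "('g, 'm) monoid_scheme \<Rightarrow> 'g set \<Rightarrow> 'g \<Rightarrow> nat" where
  "word_length G S \<gamma> =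
     (LEAST n. \<exists>ws. set ws \<subseteq> S \<and> length ws = n \<and> foldr (\<lambda>x y. x \<otimes>\<^bsub>G\<^esub> y) ws \<one>\<^bsub>G\<^esub> = \<gamma>)"

definition orientation_preserving_action ::
    "('g, 'm) monoid_scheme \<Rightarrow> 'g set \<Rightarrow> 'x matop set \<Rightarrow> ('x matop \<Rightarrow> ('x \<times> 'x) matop)
      \<Rightarrow> ('g matop \<Rightarrow> ('g \<times> 'x) matop) \<Rightarrow> bool" where
  "orientation_preserving_action G S Q \<Delta> \<alpha> \<longleftrightarrow>
     compact_quantum_group Q \<Delta> \<and> cqg_action (Cred G) Q \<Delta> \<alpha> \<and>
     (\<forall>a\<in>Cred G. gtrace_slice G (\<alpha> a) = gtrace G a *\<^sub>o unit_of Q) \<and>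
     (\<forall>\<gamma>\<in>carrier G. \<alpha> (lreg G \<gamma>) \<in>
        alg_tensor
          (lin_span {lreg G \<gamma>' | \<gamma>'. \<gamma>' \<in> carrier G \<and> word_length G S \<gamma>' = word_length G S \<gamma>}) Q)"

definition orientation_preserving_morphism ::
    "('g, 'm) monoid_scheme
      \<Rightarrow> 'x matop set \<Rightarrow> ('x matop \<Rightarrow> ('x \<times> 'x) matop) \<Rightarrow> ('g matop \<Rightarrow> ('g \<times> 'x) matop)
      \<Rightarrow> 'y matop set \<Rightarrow> ('y matop \<Rightarrow> ('y \<times> 'y) matop) \<Rightarrow> ('g matop \<Rightarrow> ('g \<times> 'y) matop)
      \<Rightarrow> ('x matop \<Rightarrow> 'y matop) \<Rightarrow> bool" where
  "orientation_preserving_morphism G Q \<Delta> \<alpha> Q' \<Delta>' \<alpha>' \<Phi> \<longleftrightarrow>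
     cqg_morphism Q \<Delta> Q' \<Delta>' \<Phi> \<and>
     (\<exists>T. tensor_map (Cred G) Q id \<Phi> T \<and> (\<forall>a\<in>Cred G. T (\<alpha> a) = \<alpha>' a))"

text \<open>
  \<open>is_QISO TYPE('y) G S Q \<Delta> \<alpha>\<close>: the pair \<open>((Q, \<Delta>), \<alpha>)\<close> is initial with respect to all pairs whose
  C*-algebra acts on the square-summable functions on \<open>'y\<close>.  Formulas cannot quantify over types;
  initiality among all pairs is this property for arbitrary \<open>'y\<close>.  Maps are only considered on
  the C*-algebra on which they are defined.
\<close>

definition is_QISO ::
    "'y itself \<Rightarrow> ('g, 'm) monoid_scheme \<Rightarrow> 'g set
      \<Rightarrow> 'x matop set \<Rightarrow> ('x matop \<Rightarrow> ('x \<times> 'x) matop) \<Rightarrow> ('g matop \<Rightarrow> ('g \<times> 'x) matop) \<Rightarrow> bool" where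
  "is_QISO _ G S Q \<Delta> \<alpha> \<longleftrightarrow>
     orientation_preserving_action G S Q \<Delta> \<alpha> \<and>
     (\<forall>(Q' :: 'y matop set) \<Delta>' \<alpha>'. orientation_preserving_action G S Q' \<Delta>' \<alpha>' \<longrightarrow>
        (\<exists>\<Phi>. orientation_preserving_morphism G Q \<Delta> \<alpha> Q' \<Delta>' \<alpha>' \<Phi> \<and>
           (\<forall>\<Psi>. orientation_preserving_morphism G Q \<Delta> \<alpha> Q' \<Delta>' \<alpha>' \<Psi> \<longrightarrow> (\<forall>a\<in>Q. \<Psi> a = \<Phi> a))))"


section \<open>The symmetric group on three letters\<close>

abbreviation S3 :: "(nat \<Rightarrow> nat) monoid" where
  "S3 \<equiv> sym_group 3"

text \<open>As \<open>S3\<close> is finite, its full and reduced C*-algebras coincide.\<close>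

abbreviation CS3 :: "(nat \<Rightarrow> nat) matop set" where
  "CS3 \<equiv> Cred S3"

end

theory Submission
  imports Defs
begin

text \<open>
  The quantum group is an instance of a construction for any finite group \<open>G\<close> with an involutive
  automorphism \<open>\<theta>\<close>.  Let \<open>V g = \<lambda>\<^sub>g \<oplus> 0\<close> and \<open>Z g = 0 \<oplus> \<lambda>\<^sub>g\<close>, which form a basis of the direct sum of
  two copies of the group algebra.  The formulas
    \<open>\<alpha> (\<lambda>\<^sub>g) = \<lambda>\<^sub>g \<otimes> V g + \<lambda>\<^sub>\<theta>\<^sub>g \<otimes> Z (\<theta> g)\<close>,
    \<open>\<Delta> (V g) = V g \<otimes> V g + Z (\<theta> g) \<otimes> Z g\<close> and \<open>\<Delta> (Z g) = V (\<theta> g) \<otimes> Z g + Z g \<otimes> V g\<close>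
  define a compact quantum group and an action of it, which preserves the trace and, if \<open>\<theta>\<close>
  permutes the generators, the length (\<open>orientation_preserving_doubling\<close>); all axioms are checked on the
  basis.  For \<open>S\<^sub>3\<close> the automorphism is conjugation by \<open>(1 3)\<close>, which exchanges \<open>s\<close> and \<open>t\<close>, and then the
  coefficients of \<open>\<alpha>\<close> are \<open>A = V s\<close>, \<open>B = Z t\<close>, \<open>C = Z s\<close> and \<open>D = V t\<close>.

  Initiality rests on the fact that any other action \<open>\<beta>\<close> of \<open>Q\<close> has this form.  Preservation of the
  length gives \<open>\<beta> (\<lambda>\<^sub>s) = \<lambda>\<^sub>s \<otimes> A + \<lambda>\<^sub>t \<otimes> B\<close> and \<open>\<beta> (\<lambda>\<^sub>t) = \<lambda>\<^sub>s \<otimes> C + \<lambda>\<^sub>t \<otimes> D\<close> with coefficients in \<open>Q\<close>.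
  The relations \<open>s\<^sup>2 = t\<^sup>2 = 1\<close> and the vanishing of the trace on \<open>s t\<close> and \<open>t s\<close> imply that \<open>p = A\<^sup>2 = D\<^sup>2\<close>
  and \<open>q = B\<^sup>2 = C\<^sup>2\<close> are complementary projections (\<open>S3_splitting\<close>).  So on generators
  \<open>\<beta> (\<lambda>\<^sub>g) = \<lambda>\<^sub>g \<otimes> v + \<lambda>\<^sub>\<theta>\<^sub>g \<otimes> w\<close> with \<open>v\<close> under \<open>p\<close> and \<open>w\<close> under \<open>q\<close>.  This form is inherited by products,
  and \<open>v\<close> and \<open>w\<close> are determined by \<open>g\<close>: if \<open>\<theta> g = g\<close>, multiplication by \<open>p\<close> and \<open>q\<close> separates them
  (\<open>component_unique\<close>).  Hence they are representations of \<open>G\<close>; in particular the braid relation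
  \<open>A D A = D A D\<close> comes out of the braid relation in \<open>S\<^sub>3\<close>.  They define the *-homomorphism \<open>\<Phi>\<close> on the
  doubling, and the coaction identity for \<open>\<beta>\<close>, read off on generators, says that \<open>\<Phi>\<close> respects the
  coproducts (\<open>morphism_\<Phi>\<close>, \<open>morphism_unique\<close>).

  The algebra \<open>Q\<close> of the other action consists of operators on an arbitrary Hilbert space, so the
  products in it are infinite sums.  The first part therefore provides the *-algebra of bounded
  matrices, in particular associativity (\<open>op_mult_assoc\<close>) and the product of tensors
  (\<open>op_tensor_mult\<close>).  The second part deals with tensor products with a finite-dimensional factor,
  which are complete and in which elements have unique coefficients (\<open>min_tensor_E\<close>).
\<close>


section \<open>Bounded matrices\<close>

lemma L2_set_power2: "(L2_set f A)\<^sup>2 = (\<Sum>x\<in>A. (f x)\<^sup>2)"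
  unfolding L2_set_def by (simp add: sum_nonneg)

lemma op_bounded_byD:
  assumes "op_bounded_by c a" "finite F" "finite G"
  shows "cmod (\<Sum>x\<in>F. \<Sum>y\<in>G. \<xi> x * a x y * \<eta> y)
    \<le> c * L2_set (\<lambda>x. cmod (\<xi> x)) F * L2_set (\<lambda>y. cmod (\<eta> y)) G"
proof -
  define H where "H = F \<union> G"
  define \<xi>' where "\<xi>' x = (if x \<in> F then cnj (\<xi> x) else 0)" for x
  define \<eta>' where "\<eta>' x = (if x \<in> G then \<eta> x else 0)" for x
  have fH: "finite H" using assms by (simp add: H_def)
  have "cmod (\<Sum>x\<in>H. \<Sum>y\<in>H. cnj (\<xi>' x) * a x y * \<eta>' y)
      \<le> c * sqrt (\<Sum>x\<in>H. (cmod (\<xi>' x))\<^sup>2) * sqrt (\<Sum>y\<in>H. (cmod (\<eta>' y))\<^sup>2)"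
    using assms(1) fH unfolding op_bounded_by_def by blast
  moreover have "(\<Sum>x\<in>H. \<Sum>y\<in>H. cnj (\<xi>' x) * a x y * \<eta>' y) = (\<Sum>x\<in>F. \<Sum>y\<in>G. \<xi> x * a x y * \<eta> y)"
  proof -
    have "(\<Sum>y\<in>H. cnj (\<xi>' x) * a x y * \<eta>' y) = (\<Sum>y\<in>G. cnj (\<xi>' x) * a x y * \<eta> y)" for x
      by (rule sum.mono_neutral_cong_right) (auto simp: assms(2,3) H_def \<eta>'_def)
    then show ?thesis
      by (simp, intro sum.mono_neutral_cong_right) (auto simp: assms(2,3) H_def \<xi>'_def)
  qed
  moreover have "(\<Sum>x\<in>H. (cmod (\<xi>' x))\<^sup>2) = (\<Sum>x\<in>F. (cmod (\<xi> x))\<^sup>2)"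
    by (rule sum.mono_neutral_cong_right) (auto simp: assms(2,3) H_def \<xi>'_def)
  moreover have "(\<Sum>x\<in>H. (cmod (\<eta>' x))\<^sup>2) = (\<Sum>x\<in>G. (cmod (\<eta> x))\<^sup>2)"
    by (rule sum.mono_neutral_cong_right) (auto simp: assms(2,3) H_def \<eta>'_def)
  ultimately show ?thesis by (simp add: L2_set_def)
qed

lemma op_bounded_byI:
  assumes "0 \<le> c"
    and "\<And>F \<xi> \<eta>. finite F \<Longrightarrow> cmod (\<Sum>x\<in>F. \<Sum>y\<in>F. \<xi> x * a x y * \<eta> y)
      \<le> c * L2_set (\<lambda>x. cmod (\<xi> x)) F * L2_set (\<lambda>y. cmod (\<eta> y)) F"
  shows "op_bounded_by c a"
  unfolding op_bounded_by_def
proof (intro conjI allI impI)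
  fix F :: "'a set" and \<xi> \<eta> :: "'a \<Rightarrow> complex"
  assume "finite F"
  from assms(2)[OF this, of "\<lambda>x. cnj (\<xi> x)" \<eta>]
  show "cmod (\<Sum>x\<in>F. \<Sum>y\<in>F. cnj (\<xi> x) * a x y * \<eta> y)
      \<le> c * sqrt (\<Sum>x\<in>F. (cmod (\<xi> x))\<^sup>2) * sqrt (\<Sum>y\<in>F. (cmod (\<eta> y))\<^sup>2)"
    by (simp add: L2_set_def)
qed (fact assms(1))

lemma op_bounded_by_nonneg: "op_bounded_by c a \<Longrightarrow> 0 \<le> c"
  by (simp add: op_bounded_by_def)

lemma op_bounded_by_transpose:
  assumes "op_bounded_by c a"
  shows "op_bounded_by c (\<lambda>x y. a y x)"
proof (rule op_bounded_byI)
  fix F :: "'a set" and \<xi> \<eta> :: "'a \<Rightarrow> complex"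
  assume F: "finite F"
  have "(\<Sum>x\<in>F. \<Sum>y\<in>F. \<xi> x * a y x * \<eta> y) = (\<Sum>y\<in>F. \<Sum>x\<in>F. \<eta> y * a y x * \<xi> x)"
    by (subst sum.swap) (simp add: mult_ac)
  then show "cmod (\<Sum>x\<in>F. \<Sum>y\<in>F. \<xi> x * a y x * \<eta> y)
      \<le> c * L2_set (\<lambda>x. cmod (\<xi> x)) F * L2_set (\<lambda>y. cmod (\<eta> y)) F"
    using op_bounded_byD[OF assms F F, of \<eta> \<xi>] by (simp add: mult_ac)
qed (use assms op_bounded_by_nonneg in auto)

lemma op_bounded_by_adj:
  assumes "op_bounded_by c a"
  shows "op_bounded_by c (op_adj a)"
proof (rule op_bounded_byI)
  fix F :: "'a set" and \<xi> \<eta> :: "'a \<Rightarrow> complex"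
  assume F: "finite F"
  have "cmod (\<Sum>x\<in>F. \<Sum>y\<in>F. \<xi> x * op_adj a x y * \<eta> y)
      = cmod (cnj (\<Sum>x\<in>F. \<Sum>y\<in>F. cnj (\<xi> x) * a y x * cnj (\<eta> y)))"
    by (simp add: op_adj_def)
  also have "\<dots> = cmod (\<Sum>x\<in>F. \<Sum>y\<in>F. cnj (\<xi> x) * a y x * cnj (\<eta> y))"
    by (rule complex_mod_cnj)
  also have "\<dots> \<le> c * L2_set (\<lambda>x. cmod (\<xi> x)) F * L2_set (\<lambda>y. cmod (\<eta> y)) F"
    using op_bounded_byD[OF op_bounded_by_transpose[OF assms] F F, of "\<lambda>x. cnj (\<xi> x)" "\<lambda>x. cnj (\<eta> x)"]
    by simp
  finally show "cmod (\<Sum>x\<in>F. \<Sum>y\<in>F. \<xi> x * op_adj a x y * \<eta> y)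
      \<le> c * L2_set (\<lambda>x. cmod (\<xi> x)) F * L2_set (\<lambda>y. cmod (\<eta> y)) F" .
qed (use assms op_bounded_by_nonneg in auto)

text \<open>Testing the form against the vector \<open>a \<eta>\<close> itself turns the bound on the form into a bound on
  the operator.\<close>

lemma op_bounded_by_apply:
  assumes "op_bounded_by c a" "finite F" "finite G"
  shows "L2_set (\<lambda>x. cmod (\<Sum>y\<in>G. a x y * \<eta> y)) F \<le> c * L2_set (\<lambda>y. cmod (\<eta> y)) G"
proof -
  define \<zeta> where "\<zeta> x = (\<Sum>y\<in>G. a x y * \<eta> y)" for x
  define N where "N = L2_set (\<lambda>x. cmod (\<zeta> x)) F"
  have "complex_of_real (N\<^sup>2) = (\<Sum>x\<in>F. cnj (\<zeta> x) * \<zeta> x)"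
    unfolding N_def L2_set_power2 of_real_sum complex_norm_square by (simp add: mult.commute)
  also have "\<dots> = (\<Sum>x\<in>F. \<Sum>y\<in>G. cnj (\<zeta> x) * a x y * \<eta> y)"
    by (simp add: \<zeta>_def[of _] sum_distrib_left mult.assoc)
  finally have "N\<^sup>2 = cmod (\<Sum>x\<in>F. \<Sum>y\<in>G. cnj (\<zeta> x) * a x y * \<eta> y)"
    by (metis abs_of_nonneg norm_of_real zero_le_power2)
  also have "\<dots> \<le> c * N * L2_set (\<lambda>y. cmod (\<eta> y)) G"
    using op_bounded_byD[OF assms, of "\<lambda>x. cnj (\<zeta> x)" \<eta>] by (simp add: N_def)
  finally have "N * N \<le> N * (c * L2_set (\<lambda>y. cmod (\<eta> y)) G)"
    by (simp add: power2_eq_square mult_ac)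
  then have "N \<le> c * L2_set (\<lambda>y. cmod (\<eta> y)) G"
    using op_bounded_by_nonneg[OF assms(1)] L2_set_nonneg[of "\<lambda>y. cmod (\<eta> y)" G]
    by (cases "N = 0") (auto simp: N_def less_le mult_le_cancel_left)
  then show ?thesis by (simp add: N_def \<zeta>_def)
qed

lemma op_bounded_by_entry:
  assumes "op_bounded_by c a"
  shows "cmod (a x y) \<le> c"
  using op_bounded_byD[OF assms, of "{x}" "{y}" "\<lambda>_. 1" "\<lambda>_. 1"] by simp

lemma op_bounded_by_column:
  assumes "op_bounded_by c a" "finite F"
  shows "L2_set (\<lambda>x. cmod (a x y)) F \<le> c"
  using op_bounded_by_apply[OF assms, of "{y}" "\<lambda>_. 1"] by simp

lemma op_bounded_by_row:
  assumes "op_bounded_by c a" "finite F"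
  shows "L2_set (\<lambda>y. cmod (a x y)) F \<le> c"
  using op_bounded_by_column[OF op_bounded_by_transpose[OF assms(1)] assms(2), of x] .

lemma op_bounded_by_zero: "op_bounded_by 0 0"
  by (rule op_bounded_byI) auto

lemma op_bounded_by_add:
  assumes "op_bounded_by c a" "op_bounded_by d b"
  shows "op_bounded_by (c + d) (a + b)"
proof (rule op_bounded_byI)
  fix F :: "'a set" and \<xi> \<eta> :: "'a \<Rightarrow> complex"
  assume F: "finite F"
  have "(\<Sum>x\<in>F. \<Sum>y\<in>F. \<xi> x * (a + b) x y * \<eta> y)
      = (\<Sum>x\<in>F. \<Sum>y\<in>F. \<xi> x * a x y * \<eta> y) + (\<Sum>x\<in>F. \<Sum>y\<in>F. \<xi> x * b x y * \<eta> y)"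
    by (simp add: algebra_simps sum.distrib)
  then show "cmod (\<Sum>x\<in>F. \<Sum>y\<in>F. \<xi> x * (a + b) x y * \<eta> y)
      \<le> (c + d) * L2_set (\<lambda>x. cmod (\<xi> x)) F * L2_set (\<lambda>y. cmod (\<eta> y)) F"
    using op_bounded_byD[OF assms(1) F F, of \<xi> \<eta>] op_bounded_byD[OF assms(2) F F, of \<xi> \<eta>]
    by (auto simp: algebra_simps intro: order.trans[OF norm_triangle_ineq])
qed (use assms op_bounded_by_nonneg in \<open>auto intro: add_nonneg_nonneg\<close>)

lemma op_bounded_by_scale:
  assumes "op_bounded_by c a"
  shows "op_bounded_by (cmod k * c) (k *\<^sub>o a)"
proof (rule op_bounded_byI)
  fix F :: "'a set" and \<xi> \<eta> :: "'a \<Rightarrow> complex"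
  assume F: "finite F"
  have "(\<Sum>x\<in>F. \<Sum>y\<in>F. \<xi> x * (k *\<^sub>o a) x y * \<eta> y) = k * (\<Sum>x\<in>F. \<Sum>y\<in>F. \<xi> x * a x y * \<eta> y)"
    by (simp add: op_scale_def sum_distrib_left mult_ac)
  then show "cmod (\<Sum>x\<in>F. \<Sum>y\<in>F. \<xi> x * (k *\<^sub>o a) x y * \<eta> y)
      \<le> (cmod k * c) * L2_set (\<lambda>x. cmod (\<xi> x)) F * L2_set (\<lambda>y. cmod (\<eta> y)) F"
    using mult_left_mono[OF op_bounded_byD[OF assms F F, of \<xi> \<eta>], of "cmod k"]
    by (simp add: norm_mult mult_ac)
qed (use op_bounded_by_nonneg[OF assms] in simp)

lemma op_bounded_by_sum:
  assumes "\<And>i. i \<in> I \<Longrightarrow> op_bounded_by (c i) (a i)"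
  shows "op_bounded_by (\<Sum>i\<in>I. c i) (\<Sum>i\<in>I. a i)"
  using assms
  by (induction I rule: infinite_finite_induct) (auto simp: op_bounded_by_zero intro!: op_bounded_by_add)

lemma bounded_op_zero: "bounded_op 0"
  using op_bounded_by_zero bounded_op_def by blast

lemma bounded_op_add: "bounded_op a \<Longrightarrow> bounded_op b \<Longrightarrow> bounded_op (a + b)"
  using op_bounded_by_add bounded_op_def by blast

lemma bounded_op_scale: "bounded_op a \<Longrightarrow> bounded_op (k *\<^sub>o a)"
  using op_bounded_by_scale bounded_op_def by blast

lemma bounded_op_sum: "(\<And>i. i \<in> I \<Longrightarrow> bounded_op (a i)) \<Longrightarrow> bounded_op (\<Sum>i\<in>I. a i)"
  by (induction I rule: infinite_finite_induct) (auto simp: bounded_op_zero intro!: bounded_op_add)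

lemma bounded_op_diff:
  assumes "bounded_op a" "bounded_op b"
  shows "bounded_op (a - b)"
proof -
  have "a - b = a + (-1) *\<^sub>o b" by (auto simp: op_scale_def fun_eq_iff)
  then show ?thesis using bounded_op_add[OF assms(1) bounded_op_scale[OF assms(2)]] by metis
qed

lemma bounded_op_adj: "bounded_op a \<Longrightarrow> bounded_op (op_adj a)"
  using op_bounded_by_adj bounded_op_def by blast

lemma op_norm_le: "op_bounded_by c a \<Longrightarrow> op_norm a \<le> c"
  unfolding op_norm_def
  by (rule cInf_lower) (auto simp: bdd_below_def intro: op_bounded_by_nonneg)

text \<open>The infimum that defines the norm is attained, because each of the inequalities in
  \<open>op_bounded_by\<close> is a closed condition on the constant.\<close>

lemma op_norm_bound:
  assumes "bounded_op a"
  shows "op_bounded_by (op_norm a) a"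
proof -
  have ne: "{c. op_bounded_by c a} \<noteq> {}" using assms by (auto simp: bounded_op_def)
  show ?thesis
  proof (rule op_bounded_byI)
    show "0 \<le> op_norm a"
      unfolding op_norm_def by (rule cInf_greatest[OF ne]) (auto intro: op_bounded_by_nonneg)
  next
    fix F :: "'a set" and \<xi> \<eta> :: "'a \<Rightarrow> complex"
    assume F: "finite F"
    define t where "t = cmod (\<Sum>x\<in>F. \<Sum>y\<in>F. \<xi> x * a x y * \<eta> y)"
    define N where "N = L2_set (\<lambda>x. cmod (\<xi> x)) F * L2_set (\<lambda>y. cmod (\<eta> y)) F"
    have N: "0 \<le> N" by (simp add: N_def)
    have le: "t \<le> c * N" if "op_bounded_by c a" for c
      using op_bounded_byD[OF that F F, of \<xi> \<eta>] by (simp add: t_def N_def mult.assoc)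
    have "t \<le> op_norm a * N"
    proof (cases "N = 0")
      case True
      then show ?thesis using le ne by auto
    next
      case False
      then have pos: "N > 0" using N by simp
      have "t / N \<le> op_norm a"
        unfolding op_norm_def by (rule cInf_greatest[OF ne]) (use le pos in \<open>auto simp: pos_divide_le_eq\<close>)
      then show ?thesis using pos by (simp add: pos_divide_le_eq)
    qed
    then show "cmod (\<Sum>x\<in>F. \<Sum>y\<in>F. \<xi> x * a x y * \<eta> y)
      \<le> op_norm a * L2_set (\<lambda>x. cmod (\<xi> x)) F * L2_set (\<lambda>y. cmod (\<eta> y)) F"
      by (simp add: t_def N_def mult.assoc)
  qed
qed

lemma op_norm_nonneg: "bounded_op a \<Longrightarrow> 0 \<le> op_norm a"
  by (rule op_bounded_by_nonneg[OF op_norm_bound])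

lemma entry_le_op_norm: "bounded_op a \<Longrightarrow> cmod (a x y) \<le> op_norm a"
  by (rule op_bounded_by_entry[OF op_norm_bound])

lemma op_norm_zero: "op_norm 0 = 0"
  using op_norm_le[OF op_bounded_by_zero] op_norm_nonneg[OF bounded_op_zero] by (rule antisym)

lemma subset_op_closure:
  assumes "\<And>a. a \<in> X \<Longrightarrow> bounded_op a"
  shows "X \<subseteq> op_closure X"
proof
  fix a assume a: "a \<in> X"
  then show "a \<in> op_closure X"
    unfolding op_closure_def mem_Collect_eq
    using assms op_norm_zero by (metis diff_self)
qed


subsection \<open>Products of bounded matrices\<close>

text \<open>By the Cauchy--Schwarz inequality, as rows and columns of bounded matrices are
  square-summable.\<close>

lemma op_mult_abs_summable:
  assumes "bounded_op a" "bounded_op b"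
  shows "(\<lambda>y. cmod (a x y * b y z)) summable_on UNIV"
proof -
  obtain c d where c: "op_bounded_by c a" and d: "op_bounded_by d b"
    using assms by (auto simp: bounded_op_def)
  show ?thesis
  proof (rule nonneg_bdd_above_summable_on)
    show "bdd_above (sum (\<lambda>y. norm (a x y * b y z)) ` {F. F \<subseteq> UNIV \<and> finite F})"
    proof (rule bdd_aboveI2)
      fix F :: "'a set" assume "F \<in> {F. F \<subseteq> UNIV \<and> finite F}"
      then have F: "finite F" by simp
      have "(\<Sum>y\<in>F. norm (a x y * b y z)) \<le> L2_set (\<lambda>y. cmod (a x y)) F * L2_set (\<lambda>y. cmod (b y z)) F"
        using L2_set_mult_ineq[of "\<lambda>y. cmod (a x y)" "\<lambda>y. cmod (b y z)" F] by (simp add: norm_mult)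
      also have "\<dots> \<le> c * d"
        by (intro mult_mono op_bounded_by_row[OF c F] op_bounded_by_column[OF d F]
            op_bounded_by_nonneg[OF c] L2_set_nonneg)
      finally show "(\<Sum>y\<in>F. norm (a x y * b y z)) \<le> c * d" .
    qed
  qed auto
qed

lemma op_mult_has_sum:
  assumes "bounded_op a" "bounded_op b"
  shows "((\<lambda>y. a x y * b y z) has_sum (a \<odot> b) x z) UNIV"
  unfolding op_mult_def using Infinite_Sum.abs_summable_summable[OF op_mult_abs_summable[OF assms]] by simp

lemma op_mult_eqI:
  assumes "bounded_op a" "bounded_op b" "\<And>x z. ((\<lambda>y. a x y * b y z) has_sum e x z) UNIV"
  shows "a \<odot> b = e"
  using assms(3) by (auto simp: op_mult_def fun_eq_iff infsumI)

lemma op_mult_add_left: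
  assumes "bounded_op a" "bounded_op a'" "bounded_op b"
  shows "(a + a') \<odot> b = a \<odot> b + a' \<odot> b"
proof (rule op_mult_eqI)
  show "((\<lambda>y. (a + a') x y * b y z) has_sum (a \<odot> b + a' \<odot> b) x z) UNIV" for x z
    using has_sum_add[OF op_mult_has_sum[OF assms(1,3)] op_mult_has_sum[OF assms(2,3)]]
    by (simp add: distrib_right)
qed (use assms bounded_op_add in auto)

lemma op_mult_add_right:
  assumes "bounded_op a" "bounded_op b" "bounded_op b'"
  shows "a \<odot> (b + b') = a \<odot> b + a \<odot> b'"
proof (rule op_mult_eqI)
  show "((\<lambda>y. a x y * (b + b') y z) has_sum (a \<odot> b + a \<odot> b') x z) UNIV" for x z
    using has_sum_add[OF op_mult_has_sum[OF assms(1,2)] op_mult_has_sum[OF assms(1,3)]]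
    by (simp add: distrib_left)
qed (use assms bounded_op_add in auto)

lemma op_mult_zero_left [simp]: "0 \<odot> b = 0" and op_mult_zero_right [simp]: "a \<odot> 0 = 0"
  by (auto simp: op_mult_def fun_eq_iff)

lemma op_mult_scale_left: "(k *\<^sub>o a) \<odot> b = k *\<^sub>o (a \<odot> b)"
  by (simp add: op_mult_def op_scale_def mult.assoc infsum_cmult_right')

lemma op_mult_scale_right: "a \<odot> (k *\<^sub>o b) = k *\<^sub>o (a \<odot> b)"
  by (simp add: op_mult_def op_scale_def mult.left_commute infsum_cmult_right')

lemma op_mult_sum_left:
  assumes "\<And>i. i \<in> I \<Longrightarrow> bounded_op (a i)" "bounded_op b"
  shows "(\<Sum>i\<in>I. a i) \<odot> b = (\<Sum>i\<in>I. a i \<odot> b)"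
  using assms
  by (induction I rule: infinite_finite_induct) (auto simp: op_mult_add_left bounded_op_sum)

lemma op_mult_sum_right:
  assumes "\<And>i. i \<in> I \<Longrightarrow> bounded_op (b i)" "bounded_op a"
  shows "a \<odot> (\<Sum>i\<in>I. b i) = (\<Sum>i\<in>I. a \<odot> b i)"
  using assms
  by (induction I rule: infinite_finite_induct) (auto simp: op_mult_add_right bounded_op_sum)

lemma op_adj_mult: "op_adj (a \<odot> b) = op_adj b \<odot> op_adj a"
proof (intro ext)
  show "op_adj (a \<odot> b) x z = (op_adj b \<odot> op_adj a) x z" for x z
    using infsum_cnj[of "\<lambda>y. a z y * b y x" UNIV]
    by (simp add: op_adj_def op_mult_def mult.commute)
qed

lemma op_adj_add: "op_adj (a + b) = op_adj a + op_adj b"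
  and op_adj_scale: "op_adj (k *\<^sub>o a) = cnj k *\<^sub>o op_adj a"
  and op_adj_zero: "op_adj 0 = 0"
  by (auto simp: op_adj_def op_scale_def fun_eq_iff)

lemma sum_matop_apply: "(\<Sum>i\<in>I. a i) x y = (\<Sum>i\<in>I. a i x y)" for a :: "'i \<Rightarrow> 'x matop"
  by (induction I rule: infinite_finite_induct) simp_all

lemma op_adj_sum: "op_adj (\<Sum>i\<in>I. a i) = (\<Sum>i\<in>I. op_adj (a i))"
  by (intro ext) (simp add: op_adj_def sum_matop_apply)

lemma has_sum_sum_family:
  fixes f :: "'i \<Rightarrow> 'x \<Rightarrow> 'b::topological_comm_monoid_add"
  assumes "\<And>i. i \<in> I \<Longrightarrow> (f i has_sum s i) A"
  shows "((\<lambda>x. \<Sum>i\<in>I. f i x) has_sum (\<Sum>i\<in>I. s i)) A"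
  using assms by (induction I rule: infinite_finite_induct) (auto intro: has_sum_add)

text \<open>Summing over the outer indices first turns a finite part of the inner sum into the pairing of the
  row vector \<open>\<xi> a\<close> with the column vector \<open>b \<eta>\<close>, to which the Cauchy--Schwarz inequality applies.\<close>

lemma op_bounded_by_mult:
  assumes a: "op_bounded_by c a" and b: "op_bounded_by d b"
  shows "op_bounded_by (c * d) (a \<odot> b)"
proof (rule op_bounded_byI)
  show "0 \<le> c * d" by (intro mult_nonneg_nonneg op_bounded_by_nonneg[OF a] op_bounded_by_nonneg[OF b])
next
  fix F :: "'a set" and \<xi> \<eta> :: "'a \<Rightarrow> complex"
  assume F: "finite F"
  have bd: "bounded_op a" "bounded_op b" using assms by (auto simp: bounded_op_def)
  let ?N = "c * d * L2_set (\<lambda>x. cmod (\<xi> x)) F * L2_set (\<lambda>y. cmod (\<eta> y)) F"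
  define u where "u y = (\<Sum>x\<in>F. \<xi> x * a x y)" for y
  define v where "v y = (\<Sum>z\<in>F. b y z * \<eta> z)" for y
  have "((\<lambda>y. \<Sum>x\<in>F. \<Sum>z\<in>F. \<xi> x * (a x y * b y z) * \<eta> z)
      has_sum (\<Sum>x\<in>F. \<Sum>z\<in>F. \<xi> x * (a \<odot> b) x z * \<eta> z)) UNIV"
    by (intro has_sum_sum_family has_sum_cmult_left has_sum_cmult_right op_mult_has_sum bd)
  moreover have "(\<Sum>x\<in>F. \<Sum>z\<in>F. \<xi> x * (a x y * b y z) * \<eta> z) = u y * v y" for y
    unfolding u_def v_def sum_product by (simp add: mult_ac)
  ultimately have "((\<lambda>y. u y * v y) has_sum (\<Sum>x\<in>F. \<Sum>z\<in>F. \<xi> x * (a \<odot> b) x z * \<eta> z)) UNIV"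
    by simp
  then have lim: "((\<lambda>Y. cmod (\<Sum>y\<in>Y. u y * v y)) \<longlongrightarrow> cmod (\<Sum>x\<in>F. \<Sum>z\<in>F. \<xi> x * (a \<odot> b) x z * \<eta> z))
      (finite_subsets_at_top UNIV)"
    unfolding has_sum_def by (rule tendsto_norm)
  have "cmod (\<Sum>y\<in>Y. u y * v y) \<le> ?N" if Y: "finite Y" for Y
  proof -
    have "cmod (\<Sum>y\<in>Y. u y * v y) \<le> (\<Sum>y\<in>Y. \<bar>cmod (u y)\<bar> * \<bar>cmod (v y)\<bar>)"
      by (rule order.trans[OF norm_sum]) (simp add: norm_mult)
    also have "\<dots> \<le> L2_set (\<lambda>y. cmod (u y)) Y * L2_set (\<lambda>y. cmod (v y)) Y"
      by (rule L2_set_mult_ineq)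
    also have "\<dots> \<le> (c * L2_set (\<lambda>x. cmod (\<xi> x)) F) * (d * L2_set (\<lambda>y. cmod (\<eta> y)) F)"
      using op_bounded_by_apply[OF op_bounded_by_transpose[OF a] Y F, of \<xi>]
        op_bounded_by_apply[OF b Y F, of \<eta>] op_bounded_by_nonneg[OF a]
      by (intro mult_mono) (auto simp: u_def v_def mult.commute)
    finally show ?thesis by (simp add: mult_ac)
  qed
  then have "\<forall>\<^sub>F Y in finite_subsets_at_top UNIV. cmod (\<Sum>y\<in>Y. u y * v y) \<le> ?N"
    by (simp add: eventually_finite_subsets_at_top_weakI)
  from tendsto_upperbound[OF lim this]
  show "cmod (\<Sum>x\<in>F. \<Sum>z\<in>F. \<xi> x * (a \<odot> b) x z * \<eta> z) \<le> ?N"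
    by simp
qed

lemma bounded_op_mult: "bounded_op a \<Longrightarrow> bounded_op b \<Longrightarrow> bounded_op (a \<odot> b)"
  using op_bounded_by_mult unfolding bounded_op_def by blast

lemma has_sum_square_tail:
  fixes \<xi> :: "'x \<Rightarrow> complex"
  assumes "(\<lambda>y. (cmod (\<xi> y))\<^sup>2) summable_on UNIV" "0 < \<delta>"
  obtains Y0 where "finite Y0" "\<And>Y. finite Y \<Longrightarrow> Y \<inter> Y0 = {} \<Longrightarrow> L2_set (\<lambda>y. cmod (\<xi> y)) Y \<le> \<delta>"
proof -
  obtain s where s: "((\<lambda>y. (cmod (\<xi> y))\<^sup>2) has_sum s) UNIV"
    using assms(1) by (auto simp: summable_on_def)
  from has_sum_finite_approximation[OF s, of "\<delta>\<^sup>2"] assms(2)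
  obtain Y0 where Y0: "finite Y0" "dist (\<Sum>y\<in>Y0. (cmod (\<xi> y))\<^sup>2) s \<le> \<delta>\<^sup>2" by auto
  have "L2_set (\<lambda>y. cmod (\<xi> y)) Y \<le> \<delta>" if Y: "finite Y" "Y \<inter> Y0 = {}" for Y
  proof -
    have "(\<Sum>y\<in>Y \<union> Y0. (cmod (\<xi> y))\<^sup>2) \<le> s"
      by (rule finite_sum_le_has_sum[OF s]) (use Y Y0 in auto)
    then have "(\<Sum>y\<in>Y. (cmod (\<xi> y))\<^sup>2) \<le> s - (\<Sum>y\<in>Y0. (cmod (\<xi> y))\<^sup>2)"
      using sum.union_disjoint[OF Y(1) Y0(1) Y(2), of "\<lambda>y. (cmod (\<xi> y))\<^sup>2"] by simp
    also have "\<dots> \<le> \<delta>\<^sup>2" using Y0(2) by (simp add: dist_real_def abs_le_iff)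
    finally have "sqrt (\<Sum>y\<in>Y. (cmod (\<xi> y))\<^sup>2) \<le> \<delta>"
      using assms(2) by (intro real_le_lsqrt) auto
    then show ?thesis by (simp add: L2_set_def)
  qed
  with Y0(1) show thesis by (rule that)
qed

text \<open>The double series behind associativity need not converge absolutely.  However, the tail of the
  row of \<open>a\<close> is small in the square norm, so the partial sums over \<open>y\<close> converge uniformly with
  respect to the finite sets of \<open>z\<close>, and the two limits may be exchanged.\<close>

lemma op_mult_assoc:
  assumes "bounded_op a" "bounded_op b" "bounded_op c"
  shows "(a \<odot> b) \<odot> c = a \<odot> (b \<odot> c)"
proof (rule op_mult_eqI)
  show "bounded_op (a \<odot> b)" "bounded_op c" using assms bounded_op_mult by auto
next
  fix x w
  obtain d e where d: "op_bounded_by d b" and e: "op_bounded_by e c"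
    using assms by (auto simp: bounded_op_def)
  let ?F = "finite_subsets_at_top (UNIV :: 'a set)"
  define f where "f Y Z = (\<Sum>z\<in>Z. \<Sum>y\<in>Y. a x y * b y z * c z w)" for Y Z
  define h where "h Z = (\<Sum>z\<in>Z. (a \<odot> b) x z * c z w)" for Z
  have fh: "((\<lambda>Y. f Y Z) \<longlongrightarrow> h Z) ?F" for Z
  proof -
    have "((\<lambda>y. \<Sum>z\<in>Z. a x y * b y z * c z w) has_sum h Z) UNIV"
      unfolding h_def by (intro has_sum_sum_family has_sum_cmult_left op_mult_has_sum assms)
    moreover have "sum (\<lambda>y. \<Sum>z\<in>Z. a x y * b y z * c z w) = (\<lambda>Y. f Y Z)"
      unfolding f_def by (rule ext) (rule sum.swap)
    ultimately show ?thesis by (simp add: has_sum_def)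
  qed
  have row: "(\<lambda>y. (cmod (a x y))\<^sup>2) summable_on UNIV"
    using op_mult_abs_summable[OF assms(1) bounded_op_adj[OF assms(1)], of x x]
    by (simp add: op_adj_def norm_mult power2_eq_square)
  have "(h \<longlongrightarrow> (a \<odot> (b \<odot> c)) x w) ?F"
  proof (rule swap_uniform_limit')
    show "\<forall>\<^sub>F Y in ?F. (f Y \<longlongrightarrow> (\<Sum>y\<in>Y. a x y * (b \<odot> c) y w)) ?F"
    proof (intro always_eventually allI)
      fix Y :: "'a set"
      have "((\<lambda>z. \<Sum>y\<in>Y. a x y * (b y z * c z w)) has_sum (\<Sum>y\<in>Y. a x y * (b \<odot> c) y w)) UNIV"
        by (intro has_sum_sum_family has_sum_cmult_right op_mult_has_sum assms)
      then show "(f Y \<longlongrightarrow> (\<Sum>y\<in>Y. a x y * (b \<odot> c) y w)) ?F"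
        by (simp add: has_sum_def f_def [abs_def] mult.assoc)
    qed
    show "((\<lambda>Y. \<Sum>y\<in>Y. a x y * (b \<odot> c) y w) \<longlongrightarrow> (a \<odot> (b \<odot> c)) x w) ?F"
      using op_mult_has_sum[OF assms(1) bounded_op_mult[OF assms(2,3)]] by (simp add: has_sum_def)
    show "uniform_limit {Z. finite Z} f h ?F"
      unfolding uniform_limit_iff
    proof (intro allI impI)
      fix \<epsilon> :: real assume \<epsilon>: "0 < \<epsilon>"
      have de: "0 \<le> d * e" using op_bounded_by_nonneg[OF d] op_bounded_by_nonneg[OF e] by simp
      \<comment> \<open>The tail beyond \<open>Y0\<close> contributes at most \<open>d \<delta> e\<close>; the summand 1 keeps the denominator positive.\<close>
      define \<delta> where "\<delta> = \<epsilon> / (2 * (d * e + 1))"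
      have \<delta>: "0 < \<delta>" using \<epsilon> de by (simp add: \<delta>_def)
      have small: "d * \<delta> * e < \<epsilon>"
      proof -
        have "\<delta> * (d * e) < \<delta> * (2 * (d * e + 1))" using \<delta> de by (intro mult_strict_left_mono) auto
        also have "\<dots> = \<epsilon>" using de by (simp add: \<delta>_def)
        finally show ?thesis by (simp add: mult_ac)
      qed
      obtain Y0 where Y0: "finite Y0"
        "\<And>Y. finite Y \<Longrightarrow> Y \<inter> Y0 = {} \<Longrightarrow> L2_set (\<lambda>y. cmod (a x y)) Y \<le> \<delta>"
        using has_sum_square_tail[OF row \<delta>] by blast
      have close: "dist (f Y Z) (h Z) < \<epsilon>" if Y: "finite Y" "Y0 \<subseteq> Y" and Z: "finite Z" for Y Z
      proof -
        have "cmod (f Y' Z - f Y Z) \<le> d * \<delta> * e" if Y': "finite Y'" "Y \<subseteq> Y'" for Y'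
        proof -
          have "f Y' Z - f Y Z = (\<Sum>z\<in>Z. \<Sum>y\<in>Y' - Y. a x y * b y z * c z w)"
            unfolding f_def sum_subtractf[symmetric] using Y' by (simp add: sum_diff Y(1))
          also have "\<dots> = (\<Sum>y\<in>Y' - Y. \<Sum>z\<in>Z. a x y * b y z * c z w)"
            by (rule sum.swap)
          also have "cmod \<dots> \<le> d * L2_set (\<lambda>y. cmod (a x y)) (Y' - Y) * L2_set (\<lambda>z. cmod (c z w)) Z"
            by (rule op_bounded_byD[OF d _ Z]) (use Y'(1) in simp)
          also have "\<dots> \<le> d * \<delta> * e"
            using Y0(2)[of "Y' - Y"] Y Y' op_bounded_by_column[OF e Z] op_bounded_by_nonneg[OF d] \<delta>
            by (intro mult_mono mult_left_mono) auto
          finally show ?thesis .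
        qed
        then have "\<forall>\<^sub>F Y' in ?F. cmod (f Y' Z - f Y Z) \<le> d * \<delta> * e"
          unfolding eventually_finite_subsets_at_top using Y(1) by blast
        moreover have "((\<lambda>Y'. cmod (f Y' Z - f Y Z)) \<longlongrightarrow> cmod (h Z - f Y Z)) ?F"
          by (intro tendsto_intros fh)
        ultimately have "cmod (h Z - f Y Z) \<le> d * \<delta> * e"
          by (intro tendsto_upperbound) auto
        then show ?thesis using small by (simp add: dist_norm norm_minus_commute)
      qed
      show "\<forall>\<^sub>F Y in ?F. \<forall>Z\<in>{Z. finite Z}. dist (f Y Z) (h Z) < \<epsilon>"
        unfolding eventually_finite_subsets_at_top using Y0(1) close by auto
    qed
    show "\<forall>\<^sub>F Z in ?F. Z \<in> {Z. finite Z}"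
      by (simp add: eventually_finite_subsets_at_top_weakI)
  qed simp
  then show "((\<lambda>z. (a \<odot> b) x z * c z w) has_sum (a \<odot> (b \<odot> c)) x w) UNIV"
    by (simp add: has_sum_def h_def [abs_def])
qed


subsection \<open>Tensor products and direct sums of matrices\<close>

text \<open>This is the factorization \<open>a \<otimes> b = (a \<otimes> 1) (1 \<otimes> b)\<close>: the vector \<open>\<zeta>\<close> in the proof is
  \<open>(1 \<otimes> b) \<eta>\<close>, and each of the two factors acts fibre by fibre.\<close>

lemma op_bounded_by_tensor:
  assumes a: "op_bounded_by c a" and b: "op_bounded_by d b"
  shows "op_bounded_by (c * d) (a \<otimes>\<^sub>o b)"
proof (rule op_bounded_byI)
  show "0 \<le> c * d" by (intro mult_nonneg_nonneg op_bounded_by_nonneg[OF a] op_bounded_by_nonneg[OF b])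
next
  fix F :: "('a \<times> 'b) set" and \<xi>0 \<eta>0 :: "'a \<times> 'b \<Rightarrow> complex"
  assume F: "finite F"
  define X Y where "X = fst ` F" and "Y = snd ` F"
  have fin: "finite X" "finite Y" using F by (auto simp: X_def Y_def)
  have FXY: "F \<subseteq> X \<times> Y" by (force simp: X_def Y_def)
  \<comment> \<open>The finite set is enlarged to a rectangle, on which the double sums separate.\<close>
  define \<xi> \<eta> where "\<xi> p = (if p \<in> F then \<xi>0 p else 0)" and "\<eta> p = (if p \<in> F then \<eta>0 p else 0)" for p
  have L2: "L2_set (\<lambda>p. cmod (\<xi> p)) (X \<times> Y) = L2_set (\<lambda>p. cmod (\<xi>0 p)) F"
    "L2_set (\<lambda>p. cmod (\<eta> p)) (X \<times> Y) = L2_set (\<lambda>p. cmod (\<eta>0 p)) F"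
    unfolding L2_set_def using fin FXY
    by (auto intro!: arg_cong[where f=sqrt] sum.mono_neutral_cong_right simp: \<xi>_def \<eta>_def)
  define \<zeta> where "\<zeta> x y = (\<Sum>y'\<in>Y. b y y' * \<eta> (x, y'))" for x y
  have "(\<Sum>p\<in>F. \<Sum>q\<in>F. \<xi>0 p * (a \<otimes>\<^sub>o b) p q * \<eta>0 q)
      = (\<Sum>p\<in>X \<times> Y. \<Sum>q\<in>X \<times> Y. \<xi> p * (a \<otimes>\<^sub>o b) p q * \<eta> q)"
  proof -
    have "(\<Sum>q\<in>F. \<xi>0 p * (a \<otimes>\<^sub>o b) p q * \<eta>0 q) = (\<Sum>q\<in>X \<times> Y. \<xi>0 p * (a \<otimes>\<^sub>o b) p q * \<eta> q)" for p
      using fin FXY by (intro sum.mono_neutral_cong_left) (auto simp: \<eta>_def)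
    then show ?thesis
      using fin FXY by (simp, intro sum.mono_neutral_cong_left) (auto simp: \<xi>_def)
  qed
  also have "\<dots> = (\<Sum>x\<in>X. \<Sum>y\<in>Y. \<Sum>x'\<in>X. \<xi> (x, y) * a x x' * \<zeta> x' y)"
    by (simp add: sum.cartesian_product' \<zeta>_def op_tensor_def sum_distrib_left mult_ac)
  also have "\<dots> = (\<Sum>y\<in>Y. \<Sum>x\<in>X. \<Sum>x'\<in>X. \<xi> (x, y) * a x x' * \<zeta> x' y)"
    by (rule sum.swap)
  also have "cmod \<dots> \<le> (\<Sum>y\<in>Y. c * L2_set (\<lambda>x. cmod (\<xi> (x, y))) X * L2_set (\<lambda>x. cmod (\<zeta> x y)) X)"
    by (rule order.trans[OF norm_sum sum_mono]) (rule op_bounded_byD[OF a fin(1) fin(1)])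
  also have "\<dots> = c * (\<Sum>y\<in>Y. \<bar>L2_set (\<lambda>x. cmod (\<xi> (x, y))) X\<bar> * \<bar>L2_set (\<lambda>x. cmod (\<zeta> x y)) X\<bar>)"
    by (simp add: sum_distrib_left mult.assoc)
  also have "\<dots> \<le> c * (L2_set (\<lambda>y. L2_set (\<lambda>x. cmod (\<xi> (x, y))) X) Y
      * L2_set (\<lambda>y. L2_set (\<lambda>x. cmod (\<zeta> x y)) X) Y)"
    by (intro mult_left_mono L2_set_mult_ineq op_bounded_by_nonneg[OF a])
  also have "L2_set (\<lambda>y. L2_set (\<lambda>x. cmod (\<xi> (x, y))) X) Y = L2_set (\<lambda>p. cmod (\<xi> p)) (X \<times> Y)"
    unfolding L2_set_def[of _ Y] L2_set_power2
    by (subst sum.swap) (simp add: sum.cartesian_product L2_set_def)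
  also have "L2_set (\<lambda>y. L2_set (\<lambda>x. cmod (\<zeta> x y)) X) Y = L2_set (\<lambda>x. L2_set (\<lambda>y. cmod (\<zeta> x y)) Y) X"
    unfolding L2_set_def[of _ Y] L2_set_def[of _ X] real_sqrt_pow2_iff
    by (simp add: sum_nonneg sum.swap[of _ Y])
  finally have bound: "cmod (\<Sum>p\<in>F. \<Sum>q\<in>F. \<xi>0 p * (a \<otimes>\<^sub>o b) p q * \<eta>0 q)
      \<le> c * (L2_set (\<lambda>p. cmod (\<xi> p)) (X \<times> Y) * L2_set (\<lambda>x. L2_set (\<lambda>y. cmod (\<zeta> x y)) Y) X)" .
  have "L2_set (\<lambda>x. L2_set (\<lambda>y. cmod (\<zeta> x y)) Y) X
      \<le> L2_set (\<lambda>x. d * L2_set (\<lambda>y. cmod (\<eta> (x, y))) Y) X"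
    unfolding \<zeta>_def by (intro L2_set_mono op_bounded_by_apply[OF b fin(2) fin(2)] L2_set_nonneg)
  also have "\<dots> = d * L2_set (\<lambda>p. cmod (\<eta> p)) (X \<times> Y)"
    using op_bounded_by_nonneg[OF b]
    by (simp add: L2_set_right_distrib[symmetric])
      (simp add: L2_set_def[of _ X] L2_set_power2 sum.cartesian_product L2_set_def[of _ "X \<times> Y"])
  finally have "c * (L2_set (\<lambda>p. cmod (\<xi> p)) (X \<times> Y) * L2_set (\<lambda>x. L2_set (\<lambda>y. cmod (\<zeta> x y)) Y) X)
      \<le> c * (L2_set (\<lambda>p. cmod (\<xi> p)) (X \<times> Y) * (d * L2_set (\<lambda>p. cmod (\<eta> p)) (X \<times> Y)))"
    by (intro mult_left_mono op_bounded_by_nonneg[OF a] L2_set_nonneg)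
  with bound show "cmod (\<Sum>p\<in>F. \<Sum>q\<in>F. \<xi>0 p * (a \<otimes>\<^sub>o b) p q * \<eta>0 q)
      \<le> c * d * L2_set (\<lambda>x. cmod (\<xi>0 x)) F * L2_set (\<lambda>y. cmod (\<eta>0 y)) F"
    by (simp add: L2 mult_ac)
qed

lemma bounded_op_tensor: "bounded_op a \<Longrightarrow> bounded_op b \<Longrightarrow> bounded_op (a \<otimes>\<^sub>o b)"
  using op_bounded_by_tensor unfolding bounded_op_def by blast

lemma op_tensor_mult:
  assumes "bounded_op a" "bounded_op a'" "bounded_op b" "bounded_op b'"
  shows "(a \<otimes>\<^sub>o b) \<odot> (a' \<otimes>\<^sub>o b') = (a \<odot> a') \<otimes>\<^sub>o (b \<odot> b')"
proof (rule op_mult_eqI)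
  show "bounded_op (a \<otimes>\<^sub>o b)" "bounded_op (a' \<otimes>\<^sub>o b')" using assms bounded_op_tensor by auto
next
  fix p q :: "'a \<times> 'b"
  define f where "f x = a (fst p) x * a' x (fst q)" for x
  define g where "g y = b (snd p) y * b' y (snd q)" for y
  have f: "(f has_sum (a \<odot> a') (fst p) (fst q)) UNIV" and g: "(g has_sum (b \<odot> b') (snd p) (snd q)) UNIV"
    unfolding f_def[abs_def] g_def[abs_def]
    by (rule op_mult_has_sum[OF assms(1,2)], rule op_mult_has_sum[OF assms(3,4)])
  have nf: "(\<lambda>x. cmod (f x)) summable_on UNIV" and ng: "(\<lambda>y. cmod (g y)) summable_on UNIV"
    unfolding f_def g_def
    by (rule op_mult_abs_summable[OF assms(1,2)], rule op_mult_abs_summable[OF assms(3,4)])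
  have "((\<lambda>(x, y). f x * g y) has_sum ((a \<odot> a') (fst p) (fst q) * (b \<odot> b') (snd p) (snd q))) (UNIV \<times> UNIV)"
  proof (rule has_sum_SigmaI)
    show "((\<lambda>y. case (x, y) of (x, y) \<Rightarrow> f x * g y) has_sum f x * (b \<odot> b') (snd p) (snd q)) UNIV" for x
      using has_sum_cmult_right[OF g, of "f x"] by simp
    show "((\<lambda>x. f x * (b \<odot> b') (snd p) (snd q)) has_sum
        (a \<odot> a') (fst p) (fst q) * (b \<odot> b') (snd p) (snd q)) UNIV"
      by (rule has_sum_cmult_left[OF f])
    have "(\<lambda>z. cmod (case z of (x, y) \<Rightarrow> f x * g y)) summable_on (UNIV \<times> UNIV)"
      unfolding Infinite_Sum.abs_summable_on_Sigma_iff
      using nf ng by (auto simp: norm_mult infsum_cmult_right' infsum_nonneg intro!: summable_on_cmult_right summable_on_cmult_left)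
    then show "(\<lambda>(x, y). f x * g y) summable_on (UNIV \<times> UNIV)"
      by (rule Infinite_Sum.abs_summable_summable)
  qed
  then show "((\<lambda>r. (a \<otimes>\<^sub>o b) p r * (a' \<otimes>\<^sub>o b') r q) has_sum ((a \<odot> a') \<otimes>\<^sub>o (b \<odot> b')) p q) UNIV"
    by (simp add: op_tensor_def f_def g_def case_prod_unfold mult_ac)
qed

lemma op_tensor_add_left: "(a + a') \<otimes>\<^sub>o b = a \<otimes>\<^sub>o b + a' \<otimes>\<^sub>o b"
  and op_tensor_add_right: "a \<otimes>\<^sub>o (b + b') = a \<otimes>\<^sub>o b + a \<otimes>\<^sub>o b'"
  and op_tensor_scale_left: "(k *\<^sub>o a) \<otimes>\<^sub>o b = k *\<^sub>o (a \<otimes>\<^sub>o b)"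
  and op_tensor_scale_right: "a \<otimes>\<^sub>o (k *\<^sub>o b) = k *\<^sub>o (a \<otimes>\<^sub>o b)"
  and op_tensor_zero_left: "0 \<otimes>\<^sub>o b = 0"
  and op_tensor_zero_right: "a \<otimes>\<^sub>o 0 = 0"
  and op_tensor_adj: "op_adj (a \<otimes>\<^sub>o b) = op_adj a \<otimes>\<^sub>o op_adj b"
  by (simp_all add: op_tensor_def op_scale_def op_adj_def fun_eq_iff algebra_simps)

lemma op_tensor_sum_left: "(\<Sum>i\<in>I. a i) \<otimes>\<^sub>o b = (\<Sum>i\<in>I. a i \<otimes>\<^sub>o b)"
  by (intro ext) (simp add: op_tensor_def sum_matop_apply sum_distrib_right)

lemma op_tensor_sum_right: "a \<otimes>\<^sub>o (\<Sum>i\<in>I. b i) = (\<Sum>i\<in>I. a \<otimes>\<^sub>o b i)"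
  by (intro ext) (simp add: op_tensor_def sum_matop_apply sum_distrib_left)

lemma op_assoc_tensor: "op_assoc (a \<otimes>\<^sub>o (b \<otimes>\<^sub>o c)) = (a \<otimes>\<^sub>o b) \<otimes>\<^sub>o c"
  and op_assoc_add: "op_assoc (u + v) = op_assoc u + op_assoc v"
  and op_flip_tensor: "op_flip (a \<otimes>\<^sub>o b) = b \<otimes>\<^sub>o a"
  and op_flip_add: "op_flip (u' + v') = op_flip u' + op_flip v'"
  by (auto simp: op_assoc_def op_flip_def op_tensor_def fun_eq_iff)

lemma op_dsum_add: "(a \<oplus>\<^sub>o b) + (a' \<oplus>\<^sub>o b') = (a + a') \<oplus>\<^sub>o (b + b')"
  and op_dsum_scale: "k *\<^sub>o (a \<oplus>\<^sub>o b) = (k *\<^sub>o a) \<oplus>\<^sub>o (k *\<^sub>o b)"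
  and op_dsum_adj: "op_adj (a \<oplus>\<^sub>o b) = op_adj a \<oplus>\<^sub>o op_adj b"
  and op_dsum_zero: "(0 \<oplus>\<^sub>o 0) = (0 :: ('a + 'b) matop)"
  for a a' :: "'a matop" and b b' :: "'b matop"
proof -
  have sum_cases: "u = v" if "\<And>x y. u (Inl x) (Inl y) = v (Inl x) (Inl y)" "\<And>x y. u (Inl x) (Inr y) = v (Inl x) (Inr y)"
    "\<And>x y. u (Inr x) (Inl y) = v (Inr x) (Inl y)" "\<And>x y. u (Inr x) (Inr y) = v (Inr x) (Inr y)"
    for u v :: "('a + 'b) matop"
  proof (intro ext)
    show "u p q = v p q" for p q using that by (cases p; cases q) auto
  qed
  show "(a \<oplus>\<^sub>o b) + (a' \<oplus>\<^sub>o b') = (a + a') \<oplus>\<^sub>o (b + b')" "k *\<^sub>o (a \<oplus>\<^sub>o b) = (k *\<^sub>o a) \<oplus>\<^sub>o (k *\<^sub>o b)"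
    "op_adj (a \<oplus>\<^sub>o b) = op_adj a \<oplus>\<^sub>o op_adj b" "(0 \<oplus>\<^sub>o 0) = (0 :: ('a + 'b) matop)"
    by (rule sum_cases; simp add: op_scale_def op_adj_def)+
qed

lemma op_dsum_mult: "(a \<oplus>\<^sub>o b) \<odot> (a' \<oplus>\<^sub>o b') = (a \<odot> a') \<oplus>\<^sub>o (b \<odot> b')"
proof (intro ext)
  have left: "infsum f UNIV = infsum (\<lambda>x. f (Inl x)) UNIV" if "\<And>y. f (Inr y) = 0" for f :: "'a + 'b \<Rightarrow> complex"
  proof -
    have "infsum f UNIV = infsum f (range Inl)"
      using that by (intro infsum_cong_neutral) (auto, metis obj_sumE rangeI)
    then show ?thesis by (simp add: infsum_reindex o_def)
  qed
  have right: "infsum f UNIV = infsum (\<lambda>x. f (Inr x)) UNIV" if "\<And>y. f (Inl y) = 0" for f :: "'a + 'b \<Rightarrow> complex"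
  proof -
    have "infsum f UNIV = infsum f (range Inr)"
      using that by (intro infsum_cong_neutral) (auto, metis obj_sumE rangeI)
    then show ?thesis by (simp add: infsum_reindex o_def)
  qed
  show "((a \<oplus>\<^sub>o b) \<odot> (a' \<oplus>\<^sub>o b')) p q = ((a \<odot> a') \<oplus>\<^sub>o (b \<odot> b')) p q" for p q
    by (cases p; cases q) (simp_all add: op_mult_def left right)
qed

lemma bounded_op_finite_support:
  assumes "finite X" "\<And>x y. a x y \<noteq> 0 \<Longrightarrow> x \<in> X \<and> y \<in> X"
  shows "bounded_op a"
proof -
  define c where "c = (\<Sum>x\<in>X. \<Sum>y\<in>X. cmod (a x y))"
  have "op_bounded_by c a"
  proof (rule op_bounded_byI)
    show "0 \<le> c" by (simp add: c_def sum_nonneg)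
  next
    fix F :: "'a set" and \<xi> \<eta> :: "'a \<Rightarrow> complex"
    assume F: "finite F"
    let ?N = "L2_set (\<lambda>x. cmod (\<xi> x)) F * L2_set (\<lambda>y. cmod (\<eta> y)) F"
    have "cmod (\<Sum>x\<in>F. \<Sum>y\<in>F. \<xi> x * a x y * \<eta> y) \<le> (\<Sum>x\<in>F. \<Sum>y\<in>F. cmod (\<xi> x * a x y * \<eta> y))"
      by (rule order.trans[OF norm_sum sum_mono]) (rule norm_sum)
    also have "\<dots> \<le> (\<Sum>x\<in>F. \<Sum>y\<in>F. cmod (a x y) * ?N)"
    proof (intro sum_mono)
      fix x y assume "x \<in> F" "y \<in> F"
      then have "cmod (\<xi> x) * cmod (\<eta> y) \<le> ?N"
        using member_le_L2_set[OF F, of _ "\<lambda>x. cmod (\<xi> x)"] member_le_L2_set[OF F, of _ "\<lambda>x. cmod (\<eta> x)"]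
        by (intro mult_mono) auto
      from mult_left_mono[OF this, of "cmod (a x y)"]
      show "cmod (\<xi> x * a x y * \<eta> y) \<le> cmod (a x y) * ?N" by (simp add: norm_mult mult_ac)
    qed
    also have "\<dots> = (\<Sum>(x, y)\<in>F \<times> F. cmod (a x y)) * ?N"
      unfolding sum_distrib_right sum.cartesian_product by (simp add: case_prod_unfold)
    also have "\<dots> \<le> c * ?N"
    proof (rule mult_right_mono)
      have "(\<Sum>(x, y)\<in>F \<times> F. cmod (a x y)) = (\<Sum>(x, y)\<in>(F \<times> F) \<inter> (X \<times> X). cmod (a x y))"
        using F assms(2) by (intro sum.mono_neutral_right) auto
      also have "\<dots> \<le> (\<Sum>(x, y)\<in>X \<times> X. cmod (a x y))"
        using assms(1) by (intro sum_mono2) auto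
      finally show "(\<Sum>(x, y)\<in>F \<times> F. cmod (a x y)) \<le> c"
        by (simp add: c_def sum.cartesian_product)
    qed simp
    finally show "cmod (\<Sum>x\<in>F. \<Sum>y\<in>F. \<xi> x * a x y * \<eta> y)
      \<le> c * L2_set (\<lambda>x. cmod (\<xi> x)) F * L2_set (\<lambda>y. cmod (\<eta> y)) F" by (simp add: mult.assoc)
  qed
  then show ?thesis by (auto simp: bounded_op_def)
qed

section \<open>Finite-dimensional spaces of matrices\<close>

interpretation matop: vector_space "op_scale :: complex \<Rightarrow> 'x matop \<Rightarrow> 'x matop"
  by unfold_locales (simp_all add: op_scale_def fun_eq_iff algebra_simps)

lemma lin_span_eq_span: "lin_span X = matop.span X"
  unfolding lin_span_def matop.span_explicit by blast

lemma subspace_lin_span: "matop.subspace (lin_span X)"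
  by (simp add: lin_span_eq_span)

lemma lin_span_superset: "X \<subseteq> lin_span X"
  unfolding lin_span_eq_span by (rule matop.span_superset)

lemma lin_span_least: "X \<subseteq> A \<Longrightarrow> matop.subspace A \<Longrightarrow> lin_span X \<subseteq> A"
  unfolding lin_span_eq_span by (rule matop.span_minimal)

lemma lin_span_eqI: "X \<subseteq> lin_span Y \<Longrightarrow> Y \<subseteq> lin_span X \<Longrightarrow> lin_span X = lin_span Y"
  by (intro equalityI lin_span_least subspace_lin_span)

lemma subspace_cstar: "cstar_algebra A \<Longrightarrow> matop.subspace A"
  by (simp add: cstar_algebra_def matop.subspace_def)

lemma cstar_algebra_bounded: "cstar_algebra A \<Longrightarrow> a \<in> A \<Longrightarrow> bounded_op a"
  and cstar_algebra_mult: "cstar_algebra A \<Longrightarrow> a \<in> A \<Longrightarrow> b \<in> A \<Longrightarrow> a \<odot> b \<in> A"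
  and cstar_algebra_adj: "cstar_algebra A \<Longrightarrow> a \<in> A \<Longrightarrow> op_adj a \<in> A"
  by (simp_all add: cstar_algebra_def)

lemma unit_of_eqI: "is_unit A e \<Longrightarrow> unit_of A = e"
  unfolding unit_of_def is_unit_def by (rule the_equality) (blast, metis)

lemma is_unit_unit_of: "unital_cstar_algebra A \<Longrightarrow> is_unit A (unit_of A)"
  using unit_of_eqI unfolding unital_cstar_algebra_def by blast

lemma linear_on_ops_zero:
  assumes "linear_on_ops A f" "matop.subspace A"
  shows "f 0 = 0"
proof -
  have "f (0 *\<^sub>o 0) = 0 *\<^sub>o f 0"
    using assms matop.subspace_0 unfolding linear_on_ops_def by blast
  then show ?thesis by simp
qed

lemma linear_on_ops_sum:
  assumes "linear_on_ops A f" "matop.subspace A" "\<And>i. i \<in> I \<Longrightarrow> a i \<in> A"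
  shows "f (\<Sum>i\<in>I. c i *\<^sub>o a i) = (\<Sum>i\<in>I. c i *\<^sub>o f (a i))"
  using assms(3)
proof (induction I rule: infinite_finite_induct)
  case (insert i I)
  then have "c i *\<^sub>o a i \<in> A" "(\<Sum>i\<in>I. c i *\<^sub>o a i) \<in> A"
    using assms(2) by (auto intro!: matop.subspace_scale matop.subspace_sum)
  then have "f (c i *\<^sub>o a i + (\<Sum>i\<in>I. c i *\<^sub>o a i)) = c i *\<^sub>o f (a i) + f (\<Sum>i\<in>I. c i *\<^sub>o a i)"
    using insert.prems[of i] assms(1) by (simp only: linear_on_ops_def insertI1)
  moreover have "f (\<Sum>i\<in>I. c i *\<^sub>o a i) = (\<Sum>i\<in>I. c i *\<^sub>o f (a i))"
    by (intro insert.IH insert.prems insertI2)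
  ultimately show ?case by (simp only: sum.insert[OF insert.hyps])
qed (simp_all add: linear_on_ops_zero[OF assms(1,2)])

text \<open>A finite family of matrices together with one matrix position for each member, at which that
  member has entry 1 and all others have entry 0.  The group algebra, its doubling and their tensor
  products have such bases, and the entries at these positions are the coordinates of an element.\<close>

locale coordinate_basis =
  fixes I :: "'i set" and b :: "'i \<Rightarrow> 'x matop" and pos :: "'i \<Rightarrow> 'x \<times> 'x"
  assumes fin: "finite I"
    and bounded_basis: "i \<in> I \<Longrightarrow> bounded_op (b i)"
    and dual: "i \<in> I \<Longrightarrow> j \<in> I \<Longrightarrow> b j (fst (pos i)) (snd (pos i)) = (if i = j then 1 else 0)"
begin

definition coord :: "'i \<Rightarrow> 'x matop \<Rightarrow> complex" where
  "coord i a = a (fst (pos i)) (snd (pos i))"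

definition E :: "'x matop set" where
  "E = lin_span (b ` I)"

lemma subspace_E: "matop.subspace E"
  by (simp add: E_def subspace_lin_span)

lemma basis_mem: "i \<in> I \<Longrightarrow> b i \<in> E"
  unfolding E_def by (intro subsetD[OF lin_span_superset] imageI)

lemma combination_mem: "(\<Sum>i\<in>I. c i *\<^sub>o b i) \<in> E"
  by (intro matop.subspace_sum matop.subspace_scale subspace_E basis_mem)

lemma coord_add: "coord i (a + a') = coord i a + coord i a'"
  and coord_scale: "coord i (k *\<^sub>o a) = k * coord i a"
  by (simp_all add: coord_def op_scale_def)

lemma coord_basis: "i \<in> I \<Longrightarrow> j \<in> I \<Longrightarrow> coord i (b j) = (if i = j then 1 else 0)"
  by (simp add: coord_def dual)

lemma expansion: "a \<in> E \<Longrightarrow> a = (\<Sum>i\<in>I. coord i a *\<^sub>o b i)"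
  unfolding E_def lin_span_eq_span
proof (induction rule: matop.span_induct_alt)
  case base
  then show ?case by (simp add: coord_def)
next
  case (step c x y)
  then obtain j where j: "j \<in> I" "x = b j" by auto
  have "(\<Sum>i\<in>I. coord i (c *\<^sub>o x + y) *\<^sub>o b i)
      = (\<Sum>i\<in>I. (c * coord i x) *\<^sub>o b i) + (\<Sum>i\<in>I. coord i y *\<^sub>o b i)"
    by (simp add: coord_add coord_scale matop.scale_left_distrib sum.distrib)
  also have "(\<Sum>i\<in>I. (c * coord i x) *\<^sub>o b i) = (\<Sum>i\<in>I. if i = j then c *\<^sub>o b i else 0)"
    using j by (intro sum.cong) (auto simp: coord_basis)
  also have "\<dots> = c *\<^sub>o x" using j fin by simp
  finally show ?case using step by simp
qed

lemma bounded_E: "a \<in> E \<Longrightarrow> bounded_op a"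
  by (subst expansion) (auto intro!: bounded_op_sum bounded_op_scale bounded_basis)

text \<open>Entries depend continuously on the operator, so the expansion in coordinates survives limits:
  finite-dimensional spaces are closed.\<close>

lemma closure_E: "op_closure E = E"
proof
  show "E \<subseteq> op_closure E" by (rule subset_op_closure) (rule bounded_E)
  show "op_closure E \<subseteq> E"
  proof
    fix a assume a: "a \<in> op_closure E"
    have "a x y = (\<Sum>i\<in>I. coord i a *\<^sub>o b i) x y" for x y
    proof -
      define M where "M = 1 + (\<Sum>i\<in>I. cmod (b i x y))"
      have M_eq: "\<delta> + (\<Sum>i\<in>I. \<delta> * cmod (b i x y)) = \<delta> * M" for \<delta>
        by (simp add: M_def distrib_left sum_distrib_left)
      have M: "M > 0" unfolding M_def by (simp add: add_pos_nonneg sum_nonneg)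
      have "cmod (a x y - (\<Sum>i\<in>I. coord i a * b i x y)) \<le> \<epsilon>" if \<epsilon>: "\<epsilon> > 0" for \<epsilon>
      proof -
        from \<epsilon> M have "\<epsilon> / M > 0" by simp
        with a obtain c where c: "c \<in> E" "bounded_op a" "bounded_op c" "op_norm (a - c) < \<epsilon> / M"
          unfolding op_closure_def by auto
        have near: "cmod (a u v - c u v) \<le> \<epsilon> / M" for u v
          using entry_le_op_norm[OF bounded_op_diff[OF c(2,3)], of u v] c(4) by simp
        have "c x y = (\<Sum>i\<in>I. coord i c * b i x y)"
          using arg_cong[OF expansion[OF c(1)], of "\<lambda>u. u x y"] by (simp add: sum_matop_apply op_scale_def)
        then have "a x y - (\<Sum>i\<in>I. coord i a * b i x y)
            = (a x y - c x y) - (\<Sum>i\<in>I. (coord i a - coord i c) * b i x y)"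
          by (simp add: left_diff_distrib sum_subtractf)
        also have "cmod \<dots> \<le> cmod (a x y - c x y) + (\<Sum>i\<in>I. cmod ((coord i a - coord i c) * b i x y))"
          by (rule order.trans[OF norm_triangle_ineq4]) (intro add_left_mono norm_sum)
        also have "\<dots> \<le> \<epsilon> / M + (\<Sum>i\<in>I. \<epsilon> / M * cmod (b i x y))"
          unfolding norm_mult coord_def by (intro add_mono sum_mono mult_right_mono near norm_ge_zero)
        also have "\<dots> = \<epsilon> / M * M" by (rule M_eq)
        finally show ?thesis using M by simp
      qed
      then have "cmod (a x y - (\<Sum>i\<in>I. coord i a * b i x y)) \<le> 0"
        by (rule field_le_epsilon) simp
      then show ?thesis by (simp add: sum_matop_apply op_scale_def)
    qed
    then have "a = (\<Sum>i\<in>I. coord i a *\<^sub>o b i)" by (intro ext)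
    then show "a \<in> E" using combination_mem by metis
  qed
qed

text \<open>Defined through the coordinates, the extension of a map from the basis is linear on all matrices,
  not only on the span.\<close>

definition ext :: "('i \<Rightarrow> 'y matop) \<Rightarrow> 'x matop \<Rightarrow> 'y matop" where
  "ext f a = (\<Sum>i\<in>I. coord i a *\<^sub>o f i)"

lemma ext_basis: "j \<in> I \<Longrightarrow> ext f (b j) = f j"
proof -
  assume j: "j \<in> I"
  have "ext f (b j) = (\<Sum>i\<in>I. if i = j then f i else 0)"
    unfolding ext_def using j by (intro sum.cong) (auto simp: coord_basis)
  then show ?thesis using j fin by simp
qed

lemma ext_add: "ext f (a + a') = ext f a + ext f a'"
  and ext_scale: "ext f (k *\<^sub>o a) = k *\<^sub>o ext f a"
  by (simp_all add: ext_def coord_add coord_scale matop.scale_left_distrib sum.distrib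
      matop.scale_sum_right)

lemma ext_zero: "ext f 0 = 0"
  by (simp add: ext_def coord_def)

lemma linear_ext: "linear_on_ops A (ext f)"
  by (simp add: linear_on_ops_def ext_add ext_scale)

lemma ext_mem:
  assumes "matop.subspace B" "\<And>i. i \<in> I \<Longrightarrow> f i \<in> B"
  shows "ext f a \<in> B"
  unfolding ext_def using assms by (intro matop.subspace_sum matop.subspace_scale)

lemma ext_bounded:
  assumes "\<And>i. i \<in> I \<Longrightarrow> bounded_op (f i)"
  shows "\<exists>K. \<forall>a. bounded_op a \<longrightarrow> bounded_op (ext f a) \<and> op_norm (ext f a) \<le> K * op_norm a"
proof (intro exI allI impI conjI)
  fix a :: "'x matop" assume a: "bounded_op a"
  have "op_bounded_by (\<Sum>i\<in>I. cmod (coord i a) * op_norm (f i)) (ext f a)"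
    unfolding ext_def by (intro op_bounded_by_sum op_bounded_by_scale op_norm_bound assms)
  then show "bounded_op (ext f a)" by (auto simp: bounded_op_def)
  have "op_norm (ext f a) \<le> (\<Sum>i\<in>I. cmod (coord i a) * op_norm (f i))"
    by (rule op_norm_le) fact
  also have "\<dots> \<le> (\<Sum>i\<in>I. op_norm a * op_norm (f i))"
    unfolding coord_def
    by (intro sum_mono mult_right_mono entry_le_op_norm a op_norm_nonneg assms)
  finally show "op_norm (ext f a) \<le> (\<Sum>i\<in>I. op_norm (f i)) * op_norm a"
    unfolding sum_distrib_right by (simp add: mult.commute)
qed

lemma linear_expansion:
  assumes "linear_on_ops E f" "a \<in> E"
  shows "f a = (\<Sum>i\<in>I. coord i a *\<^sub>o f (b i))"
  using linear_on_ops_sum[OF assms(1) subspace_E, of I b "\<lambda>i. coord i a"] basis_mem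
    expansion[OF assms(2)] by simp

lemma linear_eqI:
  assumes "linear_on_ops E f" "linear_on_ops E g" "\<And>i. i \<in> I \<Longrightarrow> f (b i) = g (b i)" "a \<in> E"
  shows "f a = g a"
  using assms by (simp add: linear_expansion)

lemma bilinear_mem:
  assumes "a \<in> E" "a' \<in> E" "matop.subspace B" "\<And>i j. i \<in> I \<Longrightarrow> j \<in> I \<Longrightarrow> b i \<odot> b j \<in> B"
  shows "a \<odot> a' \<in> B"
proof -
  have "a \<odot> a' = (\<Sum>i\<in>I. coord i a *\<^sub>o b i) \<odot> (\<Sum>j\<in>I. coord j a' *\<^sub>o b j)"
    using expansion[OF assms(1)] expansion[OF assms(2)] by simp
  also have "\<dots> = (\<Sum>i\<in>I. coord i a *\<^sub>o (\<Sum>j\<in>I. coord j a' *\<^sub>o (b i \<odot> b j)))"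
    by (subst op_mult_sum_left) (auto simp: op_mult_sum_right bounded_op_scale bounded_op_sum bounded_basis
        op_mult_scale_left op_mult_scale_right)
  finally show ?thesis
    using assms(3,4) by (simp add: matop.subspace_sum matop.subspace_scale)
qed

lemma cstar_algebra_E:
  assumes "\<And>i j. i \<in> I \<Longrightarrow> j \<in> I \<Longrightarrow> b i \<odot> b j \<in> E" "\<And>i. i \<in> I \<Longrightarrow> op_adj (b i) \<in> E"
  shows "cstar_algebra E"
  unfolding cstar_algebra_def
proof (intro conjI ballI allI)
  fix a assume a: "a \<in> E"
  show "bounded_op a" by (rule bounded_E[OF a])
  have "op_adj a = (\<Sum>i\<in>I. cnj (coord i a) *\<^sub>o op_adj (b i))"
    by (subst expansion[OF a]) (simp add: op_adj_sum op_adj_scale)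
  also have "\<dots> \<in> E" by (intro matop.subspace_sum matop.subspace_scale subspace_E assms(2))
  finally show "op_adj a \<in> E" .
  show "c *\<^sub>o a \<in> E" for c by (intro matop.subspace_scale subspace_E a)
  fix a' assume a': "a' \<in> E"
  show "a + a' \<in> E" by (intro matop.subspace_add subspace_E a a')
  show "a \<odot> a' \<in> E" by (rule bilinear_mem[OF a a' subspace_E assms(1)])
qed (use matop.subspace_0[OF subspace_E] closure_E in auto)

lemma is_unit_E:
  assumes "e \<in> E" "\<And>i. i \<in> I \<Longrightarrow> e \<odot> b i = b i" "\<And>i. i \<in> I \<Longrightarrow> b i \<odot> e = b i"
  shows "is_unit E e"
  unfolding is_unit_def
proof (intro conjI ballI)
  fix a assume a: "a \<in> E"
  have "e \<odot> a = (\<Sum>i\<in>I. coord i a *\<^sub>o (e \<odot> b i))"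
    by (subst expansion[OF a]) (simp add: op_mult_sum_right bounded_op_scale bounded_basis
        bounded_E[OF assms(1)] op_mult_scale_right)
  then show "e \<odot> a = a" using expansion[OF a] assms(2) by simp
  have "a \<odot> e = (\<Sum>i\<in>I. coord i a *\<^sub>o (b i \<odot> e))"
    by (subst expansion[OF a]) (simp add: op_mult_sum_left bounded_op_scale bounded_basis
        bounded_E[OF assms(1)] op_mult_scale_left)
  then show "a \<odot> e = a" using expansion[OF a] assms(3) by simp
qed (fact assms(1))

lemma multiplicativeI:
  assumes "linear_on_ops E f" "\<And>i. i \<in> I \<Longrightarrow> bounded_op (f (b i))"
    and mult: "\<And>i j. i \<in> I \<Longrightarrow> j \<in> I \<Longrightarrow> b i \<odot> b j \<in> E \<and> f (b i \<odot> b j) = f (b i) \<odot> f (b j)"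
    and a: "a \<in> E" and a': "a' \<in> E"
  shows "f (a \<odot> a') = f a \<odot> f a'"
proof -
  let ?c = "\<lambda>i. coord i a" and ?d = "\<lambda>j. coord j a'"
  have "a \<odot> a' = (\<Sum>i\<in>I. ?c i *\<^sub>o b i) \<odot> (\<Sum>j\<in>I. ?d j *\<^sub>o b j)"
    using expansion[OF a] expansion[OF a'] by simp
  also have "\<dots> = (\<Sum>i\<in>I. ?c i *\<^sub>o (\<Sum>j\<in>I. ?d j *\<^sub>o (b i \<odot> b j)))"
    by (subst op_mult_sum_left) (auto simp: op_mult_sum_right bounded_op_scale bounded_op_sum bounded_basis
        op_mult_scale_left op_mult_scale_right)
  finally have "f (a \<odot> a') = f (\<Sum>i\<in>I. ?c i *\<^sub>o (\<Sum>j\<in>I. ?d j *\<^sub>o (b i \<odot> b j)))" by simp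
  also have "\<dots> = (\<Sum>i\<in>I. ?c i *\<^sub>o f (\<Sum>j\<in>I. ?d j *\<^sub>o (b i \<odot> b j)))"
    using mult by (intro linear_on_ops_sum[OF assms(1) subspace_E] matop.subspace_sum
        matop.subspace_scale subspace_E) auto
  also have "\<dots> = (\<Sum>i\<in>I. ?c i *\<^sub>o (\<Sum>j\<in>I. ?d j *\<^sub>o (f (b i) \<odot> f (b j))))"
    using mult by (intro sum.cong refl arg_cong[where f = "op_scale _"])
      (simp add: linear_on_ops_sum[OF assms(1) subspace_E])
  also have "\<dots> = (\<Sum>i\<in>I. ?c i *\<^sub>o f (b i)) \<odot> (\<Sum>j\<in>I. ?d j *\<^sub>o f (b j))"
    by (subst op_mult_sum_left) (auto simp: op_mult_sum_right bounded_op_scale bounded_op_sum assms(2)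
        op_mult_scale_left op_mult_scale_right)
  also have "\<dots> = f a \<odot> f a'" by (simp add: linear_expansion[OF assms(1) a] linear_expansion[OF assms(1) a'])
  finally show ?thesis .
qed

lemma unital_star_hom_ext:
  assumes B: "matop.subspace B" and fB: "\<And>i. i \<in> I \<Longrightarrow> f i \<in> B"
    and bd: "\<And>i. i \<in> I \<Longrightarrow> bounded_op (f i)"
    and mult: "\<And>i j. i \<in> I \<Longrightarrow> j \<in> I \<Longrightarrow> b i \<odot> b j \<in> E \<and> ext f (b i \<odot> b j) = f i \<odot> f j"
    and adj: "\<And>i. i \<in> I \<Longrightarrow> op_adj (b i) \<in> E \<and> ext f (op_adj (b i)) = op_adj (f i)"
    and unit: "ext f (unit_of E) = unit_of B"
  shows "unital_star_hom E B (ext f)"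
  unfolding unital_star_hom_def
proof (intro conjI ballI)
  fix a assume a: "a \<in> E"
  show "ext f a \<in> B" by (rule ext_mem[OF B fB])
  have "ext f (op_adj a) = ext f (\<Sum>i\<in>I. cnj (coord i a) *\<^sub>o op_adj (b i))"
    by (subst expansion[OF a]) (simp add: op_adj_sum op_adj_scale)
  also have "\<dots> = (\<Sum>i\<in>I. cnj (coord i a) *\<^sub>o ext f (op_adj (b i)))"
    by (rule linear_on_ops_sum[OF linear_ext matop.subspace_UNIV]) simp
  also have "\<dots> = op_adj (ext f a)" using adj by (simp add: ext_def op_adj_sum op_adj_scale)
  finally show "ext f (op_adj a) = op_adj (ext f a)" .
  fix a' assume a': "a' \<in> E"
  show "ext f (a \<odot> a') = ext f a \<odot> ext f a'"
    by (rule multiplicativeI[OF linear_ext _ _ a a']) (simp_all add: bd mult ext_basis)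
qed (fact linear_ext, fact unit)


text \<open>The entries of a tensor at the position of a basis element form its slice; slices are
  the coefficients in the expansion with respect to the basis of the first factor.\<close>

definition slice :: "'i \<Rightarrow> ('x \<times> 'y) matop \<Rightarrow> 'y matop" where
  "slice i u = (\<lambda>x y. u (fst (pos i), x) (snd (pos i), y))"

lemma slice_add: "slice i (u + v) = slice i u + slice i v"
  and slice_zero: "slice i 0 = 0"
  and slice_scale: "slice i (k *\<^sub>o u) = k *\<^sub>o slice i u"
  and slice_diff: "slice i (u - v) = slice i u - slice i v"
  by (simp_all add: slice_def op_scale_def fun_eq_iff)

lemma slice_tensor: "slice i (a \<otimes>\<^sub>o q) = coord i a *\<^sub>o q"
  by (simp add: slice_def op_tensor_def coord_def op_scale_def)

lemma slice_basis_tensor: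
  "i \<in> I \<Longrightarrow> j \<in> I \<Longrightarrow> slice i (b j \<otimes>\<^sub>o q) = (if i = j then q else 0)"
  by (simp add: slice_tensor coord_basis)

lemma op_bounded_by_slice:
  fixes u :: "('x \<times> 'y) matop"
  assumes "op_bounded_by c u"
  shows "op_bounded_by c (slice i u)"
proof (rule op_bounded_byI)
  fix F :: "'y set" and \<xi> \<eta> :: "'y \<Rightarrow> complex"
  assume F: "finite F"
  have "cmod (\<Sum>p\<in>{fst (pos i)} \<times> F. \<Sum>q\<in>{snd (pos i)} \<times> F. \<xi> (snd p) * u p q * \<eta> (snd q))
      \<le> c * L2_set (\<lambda>p. cmod (\<xi> (snd p))) ({fst (pos i)} \<times> F)
          * L2_set (\<lambda>q. cmod (\<eta> (snd q))) ({snd (pos i)} \<times> F)"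
    by (rule op_bounded_byD[OF assms]) (use F in auto)
  then show "cmod (\<Sum>x\<in>F. \<Sum>y\<in>F. \<xi> x * slice i u x y * \<eta> y)
      \<le> c * L2_set (\<lambda>x. cmod (\<xi> x)) F * L2_set (\<lambda>y. cmod (\<eta> y)) F"
    by (simp add: L2_set_def sum.cartesian_product' slice_def)
qed (rule op_bounded_by_nonneg[OF assms])

lemma bounded_op_slice: "bounded_op u \<Longrightarrow> bounded_op (slice i u)"
  unfolding bounded_op_def by (metis op_bounded_by_slice)

lemma tensor_combination_mem:
  assumes "matop.subspace Q" "\<And>i. i \<in> I \<Longrightarrow> q i \<in> Q"
  shows "(\<Sum>i\<in>I. b i \<otimes>\<^sub>o q i) \<in> alg_tensor E Q"
  unfolding alg_tensor_def
proof (intro matop.subspace_sum subspace_lin_span subsetD[OF lin_span_superset])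
  fix i assume "i \<in> I"
  then show "b i \<otimes>\<^sub>o q i \<in> {a \<otimes>\<^sub>o c |a c. a \<in> E \<and> c \<in> Q}"
    using assms(2) basis_mem by auto
qed

lemma alg_tensor_expansion:
  assumes Q: "matop.subspace Q" and u: "u \<in> alg_tensor E Q"
  shows "u = (\<Sum>i\<in>I. b i \<otimes>\<^sub>o slice i u) \<and> (\<forall>i\<in>I. slice i u \<in> Q)"
  using u unfolding alg_tensor_def lin_span_eq_span
proof (induction rule: matop.span_induct_alt)
  case base
  show ?case
    by (simp only: slice_zero op_tensor_zero_right sum.neutral_const matop.subspace_0[OF Q]) simp
next
  case (step c x y)
  then obtain a q where x: "x = a \<otimes>\<^sub>o q" "a \<in> E" "q \<in> Q" by auto
  have "x = (\<Sum>i\<in>I. b i \<otimes>\<^sub>o slice i x)"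
    unfolding x(1) slice_tensor
    by (subst expansion[OF x(2)])
      (simp add: op_tensor_sum_left op_tensor_scale_left op_tensor_scale_right)
  moreover have "\<forall>i\<in>I. slice i x \<in> Q"
    using x Q by (simp add: slice_tensor matop.subspace_scale)
  ultimately have "c *\<^sub>o x + y = (\<Sum>i\<in>I. b i \<otimes>\<^sub>o slice i (c *\<^sub>o x + y))"
    using step.IH
    by (simp add: slice_add slice_scale op_tensor_add_right op_tensor_scale_right sum.distrib
        matop.scale_sum_right[symmetric])
  moreover have "\<forall>i\<in>I. slice i (c *\<^sub>o x + y) \<in> Q"
    using step.IH \<open>\<forall>i\<in>I. slice i x \<in> Q\<close> Q
    by (simp add: slice_add slice_scale matop.subspace_add matop.subspace_scale)
  ultimately show ?case ..
qed

text \<open>Slicing is norm-decreasing, so the algebraic tensor product with a finite-dimensional factor is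
  already complete.\<close>

lemma min_tensor_E:
  assumes Q: "cstar_algebra Q"
  shows "min_tensor E Q = alg_tensor E Q"
proof
  have bd: "bounded_op u" if "u \<in> alg_tensor E Q" for u
    using alg_tensor_expansion[OF subspace_cstar[OF Q] that]
    by (metis (no_types, lifting) bounded_op_sum bounded_op_tensor bounded_basis cstar_algebra_bounded[OF Q])
  show "alg_tensor E Q \<subseteq> min_tensor E Q"
    unfolding min_tensor_def by (rule subset_op_closure) (rule bd)
  show "min_tensor E Q \<subseteq> alg_tensor E Q"
  proof
    fix u assume u: "u \<in> min_tensor E Q"
    have mem: "slice i u \<in> Q" if i: "i \<in> I" for i
    proof -
      have "slice i u \<in> op_closure Q"
        unfolding op_closure_def
      proof (intro CollectI conjI allI impI)
        show "bounded_op (slice i u)"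
          using u by (simp add: bounded_op_slice min_tensor_def op_closure_def)
        fix \<epsilon> :: real assume "\<epsilon> > 0"
        with u obtain v where v: "v \<in> alg_tensor E Q" "bounded_op u" "bounded_op v" "op_norm (u - v) < \<epsilon>"
          unfolding min_tensor_def op_closure_def by auto
        have "op_norm (slice i u - slice i v) \<le> op_norm (u - v)"
          unfolding slice_diff[symmetric]
          by (intro op_norm_le op_bounded_by_slice op_norm_bound bounded_op_diff v)
        then show "\<exists>q\<in>Q. bounded_op q \<and> op_norm (slice i u - q) < \<epsilon>"
          using v alg_tensor_expansion[OF subspace_cstar[OF Q] v(1)] i cstar_algebra_bounded[OF Q]
          by (intro bexI[of _ "slice i v"]) auto
      qed
      then show ?thesis using Q by (auto simp: cstar_algebra_def)
    qed
    have "u p q = (\<Sum>i\<in>I. b i \<otimes>\<^sub>o slice i u) p q" for p q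
    proof -
      obtain x z y w where pq: "p = (x, z)" "q = (y, w)" by (cases p; cases q) auto
      define M where "M = 1 + (\<Sum>i\<in>I. cmod (b i x y))"
      have M_eq: "\<delta> + (\<Sum>i\<in>I. \<delta> * cmod (b i x y)) = \<delta> * M" for \<delta>
        by (simp add: M_def distrib_left sum_distrib_left)
      have M: "M > 0" unfolding M_def by (simp add: add_pos_nonneg sum_nonneg)
      have "cmod (u p q - (\<Sum>i\<in>I. b i x y * slice i u z w)) \<le> \<epsilon>" if \<epsilon>: "\<epsilon> > 0" for \<epsilon>
      proof -
        from \<epsilon> M have "\<epsilon> / M > 0" by simp
        with u obtain v where v: "v \<in> alg_tensor E Q" "bounded_op u" "bounded_op v" "op_norm (u - v) < \<epsilon> / M"
          unfolding min_tensor_def op_closure_def by auto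
        have near: "cmod (u r s - v r s) \<le> \<epsilon> / M" for r s
          using entry_le_op_norm[OF bounded_op_diff[OF v(2,3)], of r s] v(4) by simp
        have "v p q = (\<Sum>i\<in>I. b i x y * slice i v z w)"
          using arg_cong[OF conjunct1[OF alg_tensor_expansion[OF subspace_cstar[OF Q] v(1)]], of "\<lambda>r. r p q"]
          by (simp add: sum_matop_apply op_tensor_def pq)
        then have "u p q - (\<Sum>i\<in>I. b i x y * slice i u z w)
            = (u p q - v p q) - (\<Sum>i\<in>I. b i x y * (slice i u z w - slice i v z w))"
          by (simp add: right_diff_distrib sum_subtractf)
        also have "cmod \<dots> \<le> cmod (u p q - v p q) + (\<Sum>i\<in>I. cmod (b i x y * (slice i u z w - slice i v z w)))"
          by (rule order.trans[OF norm_triangle_ineq4]) (intro add_left_mono norm_sum)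
        also have "\<dots> \<le> \<epsilon> / M + (\<Sum>i\<in>I. \<epsilon> / M * cmod (b i x y))"
          unfolding norm_mult slice_def
          by (subst mult.commute) (intro add_mono sum_mono mult_right_mono near norm_ge_zero)
        also have "\<dots> = \<epsilon> / M * M" by (rule M_eq)
        finally show ?thesis using M by simp
      qed
      then have "cmod (u p q - (\<Sum>i\<in>I. b i x y * slice i u z w)) \<le> 0"
        by (rule field_le_epsilon) simp
      then show ?thesis by (simp add: sum_matop_apply op_tensor_def pq)
    qed
    then have "u = (\<Sum>i\<in>I. b i \<otimes>\<^sub>o slice i u)" by (intro ext)
    then show "u \<in> alg_tensor E Q"
      by (rule ssubst[where P = "\<lambda>v. v \<in> alg_tensor E Q"])
        (rule tensor_combination_mem[OF subspace_cstar[OF Q] mem])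
  qed
qed

end

lemma coordinate_basis_tensor:
  assumes "coordinate_basis I b pos" "coordinate_basis J b' pos'"
  shows "coordinate_basis (I \<times> J) (\<lambda>(i, j). b i \<otimes>\<^sub>o b' j)
    (\<lambda>(i, j). ((fst (pos i), fst (pos' j)), (snd (pos i), snd (pos' j))))"
  using assms unfolding coordinate_basis_def
  by (auto intro!: bounded_op_tensor) (auto simp: op_tensor_def)

lemma coordinate_basis_subset:
  "coordinate_basis I b pos \<Longrightarrow> H \<subseteq> I \<Longrightarrow> coordinate_basis H b pos"
  unfolding coordinate_basis_def using finite_subset by blast

locale coordinate_basis_pair =
  fst: coordinate_basis I b pos + snd: coordinate_basis J b' pos'
  for I :: "'i set" and b :: "'i \<Rightarrow> 'x matop" and pos :: "'i \<Rightarrow> 'x \<times> 'x"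
    and J :: "'j set" and b' :: "'j \<Rightarrow> 'y matop" and pos' :: "'j \<Rightarrow> 'y \<times> 'y"
begin

sublocale pair: coordinate_basis "I \<times> J" "\<lambda>(i, j). b i \<otimes>\<^sub>o b' j"
  "\<lambda>(i, j). ((fst (pos i), fst (pos' j)), (snd (pos i), snd (pos' j)))"
  by (rule coordinate_basis_tensor) unfold_locales

lemma alg_tensor_pair: "alg_tensor fst.E snd.E = pair.E"
  unfolding alg_tensor_def pair.E_def
proof (rule lin_span_eqI)
  show "(\<lambda>(i, j). b i \<otimes>\<^sub>o b' j) ` (I \<times> J) \<subseteq> lin_span {a \<otimes>\<^sub>o c |a c. a \<in> fst.E \<and> c \<in> snd.E}"
    using lin_span_superset fst.basis_mem snd.basis_mem by fast
  show "{a \<otimes>\<^sub>o c |a c. a \<in> fst.E \<and> c \<in> snd.E} \<subseteq> lin_span ((\<lambda>(i, j). b i \<otimes>\<^sub>o b' j) ` (I \<times> J))"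
  proof safe
    fix a c assume a: "a \<in> fst.E" and c: "c \<in> snd.E"
    have "a \<otimes>\<^sub>o c = (\<Sum>i\<in>I. fst.coord i a *\<^sub>o b i) \<otimes>\<^sub>o (\<Sum>j\<in>J. snd.coord j c *\<^sub>o b' j)"
      using fst.expansion[OF a] snd.expansion[OF c] by simp
    also have "\<dots> = (\<Sum>i\<in>I. \<Sum>j\<in>J. fst.coord i a *\<^sub>o snd.coord j c *\<^sub>o (b i \<otimes>\<^sub>o b' j))"
      unfolding op_tensor_sum_left by (simp add: op_tensor_sum_right op_tensor_scale_left
          op_tensor_scale_right matop.scale_sum_right mult.commute)
    also have "\<dots> \<in> lin_span ((\<lambda>(i, j). b i \<otimes>\<^sub>o b' j) ` (I \<times> J))"
      using lin_span_superset
      by (intro matop.subspace_sum matop.subspace_scale subspace_lin_span) fastforce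
    finally show "a \<otimes>\<^sub>o c \<in> lin_span ((\<lambda>(i, j). b i \<otimes>\<^sub>o b' j) ` (I \<times> J))" .
  qed
qed

lemma min_tensor_pair: "min_tensor fst.E snd.E = pair.E"
  unfolding min_tensor_def alg_tensor_pair by (rule pair.closure_E)

lemma tensor_map_pair:
  assumes f: "linear_on_ops fst.E f" "\<And>i. i \<in> I \<Longrightarrow> bounded_op (f (b i))"
    and g: "linear_on_ops snd.E g" "\<And>j. j \<in> J \<Longrightarrow> bounded_op (g (b' j))"
  shows "tensor_map fst.E snd.E f g (pair.ext (\<lambda>(i, j). f (b i) \<otimes>\<^sub>o g (b' j)))"
  unfolding tensor_map_def
proof (intro conjI ballI)
  let ?T = "pair.ext (\<lambda>(i, j). f (b i) \<otimes>\<^sub>o g (b' j))"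
  show "linear_on_ops (min_tensor fst.E snd.E) ?T" by (rule pair.linear_ext)
  have "\<exists>K. \<forall>u. bounded_op u \<longrightarrow> bounded_op (?T u) \<and> op_norm (?T u) \<le> K * op_norm u"
    by (rule pair.ext_bounded) (auto intro!: bounded_op_tensor f g)
  then show "\<exists>K. \<forall>u\<in>min_tensor fst.E snd.E. bounded_op (?T u) \<and> op_norm (?T u) \<le> K * op_norm u"
    unfolding min_tensor_pair using pair.bounded_E by blast
  fix a c assume a: "a \<in> fst.E" and c: "c \<in> snd.E"
  have "?T (a \<otimes>\<^sub>o c) = (\<Sum>i\<in>I. \<Sum>j\<in>J. fst.coord i a *\<^sub>o snd.coord j c *\<^sub>o (f (b i) \<otimes>\<^sub>o g (b' j)))"
    by (simp add: pair.ext_def sum.cartesian_product' pair.coord_def fst.coord_def snd.coord_def op_tensor_def)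
  also have "\<dots> = f a \<otimes>\<^sub>o g c"
    unfolding fst.linear_expansion[OF f(1) a] snd.linear_expansion[OF g(1) c] op_tensor_sum_left
    by (simp add: op_tensor_sum_right op_tensor_scale_left op_tensor_scale_right
          matop.scale_sum_right mult.commute)
  finally show "?T (a \<otimes>\<^sub>o c) = f a \<otimes>\<^sub>o g c" .
qed

end

lemma op_dsum_sum: "(\<Sum>i\<in>I. a i \<oplus>\<^sub>o c i) = (\<Sum>i\<in>I. a i) \<oplus>\<^sub>o (\<Sum>i\<in>I. c i)"
proof (intro ext)
  show "(\<Sum>i\<in>I. a i \<oplus>\<^sub>o c i) p q = ((\<Sum>i\<in>I. a i) \<oplus>\<^sub>o (\<Sum>i\<in>I. c i)) p q" for p q
    by (cases p; cases q) (simp_all add: sum_matop_apply)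
qed

lemma linear_on_ops_comp:
  assumes "linear_on_ops A f" "\<And>a. a \<in> A \<Longrightarrow> f a \<in> B" "linear_on_ops B g"
  shows "linear_on_ops A (\<lambda>a. g (f a))"
  using assms unfolding linear_on_ops_def by simp

lemma linear_op_assoc: "linear_on_ops A op_assoc"
  by (auto simp: linear_on_ops_def op_assoc_def op_scale_def fun_eq_iff)

lemma tensor_mem_min_tensor:
  assumes "cstar_algebra A" "cstar_algebra B" "a \<in> A" "b \<in> B"
  shows "a \<otimes>\<^sub>o b \<in> min_tensor A B"
proof -
  have "a \<otimes>\<^sub>o b \<in> alg_tensor A B"
    unfolding alg_tensor_def by (rule subsetD[OF lin_span_superset]) (use assms in auto)
  moreover have "bounded_op (a \<otimes>\<^sub>o b)"
    by (intro bounded_op_tensor cstar_algebra_bounded[OF assms(1)] cstar_algebra_bounded[OF assms(2)] assms)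
  ultimately show ?thesis
    unfolding min_tensor_def op_closure_def mem_Collect_eq by (metis diff_self op_norm_zero)
qed

lemma tensor_map_add:
  assumes "tensor_map A B f g T" "cstar_algebra A" "cstar_algebra B" "a \<in> A" "b \<in> B" "a' \<in> A" "b' \<in> B"
  shows "T (a \<otimes>\<^sub>o b + a' \<otimes>\<^sub>o b') = f a \<otimes>\<^sub>o g b + f a' \<otimes>\<^sub>o g b'"
proof -
  have "T (a \<otimes>\<^sub>o b + a' \<otimes>\<^sub>o b') = T (a \<otimes>\<^sub>o b) + T (a' \<otimes>\<^sub>o b')"
    using assms(1) tensor_mem_min_tensor[OF assms(2-5)] tensor_mem_min_tensor[OF assms(2,3,6,7)]
    unfolding tensor_map_def linear_on_ops_def by blast
  then show ?thesis using assms unfolding tensor_map_def by simp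
qed

context coordinate_basis
begin

lemma subspace_min_tensor: "cstar_algebra Q \<Longrightarrow> matop.subspace (min_tensor E Q)"
  by (simp add: min_tensor_E alg_tensor_def subspace_lin_span)

lemma min_tensor_mult:
  assumes Q: "cstar_algebra Q" and E: "cstar_algebra E"
    and u: "u \<in> min_tensor E Q" and v: "v \<in> min_tensor E Q"
  shows "u \<odot> v \<in> min_tensor E Q"
proof -
  have *: "u = (\<Sum>i\<in>I. b i \<otimes>\<^sub>o slice i u) \<and> (\<forall>i\<in>I. slice i u \<in> Q)" if "u \<in> min_tensor E Q" for u
    using alg_tensor_expansion[OF subspace_cstar[OF Q]] that min_tensor_E[OF Q] by blast
  have bd: "bounded_op (slice i u)" "bounded_op (slice i v)" if "i \<in> I" for i
    using *[OF u] *[OF v] cstar_algebra_bounded[OF Q] that by auto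
  have "u \<odot> v = (\<Sum>i\<in>I. b i \<otimes>\<^sub>o slice i u) \<odot> (\<Sum>j\<in>I. b j \<otimes>\<^sub>o slice j v)"
    using *[OF u] *[OF v] by simp
  also have "\<dots> = (\<Sum>i\<in>I. \<Sum>j\<in>I. (b i \<odot> b j) \<otimes>\<^sub>o (slice i u \<odot> slice j v))"
    by (subst op_mult_sum_left)
      (auto simp: op_mult_sum_right op_tensor_mult bounded_op_tensor bounded_op_sum bounded_basis bd)
  also have "\<dots> \<in> min_tensor E Q"
    using *[OF u] *[OF v]
    by (intro matop.subspace_sum subspace_min_tensor Q tensor_mem_min_tensor E
        cstar_algebra_mult basis_mem) auto
  finally show ?thesis .
qed

lemma is_unit_min_tensor:
  assumes Q: "cstar_algebra Q" and E: "cstar_algebra E" and e: "is_unit E e" and u: "is_unit Q u"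
  shows "is_unit (min_tensor E Q) (e \<otimes>\<^sub>o u)"
  unfolding is_unit_def
proof (intro conjI ballI)
  have mem: "e \<in> E" "u \<in> Q" using e u by (auto simp: is_unit_def)
  then show "e \<otimes>\<^sub>o u \<in> min_tensor E Q" by (intro tensor_mem_min_tensor Q E)
  have bd: "bounded_op e" "bounded_op u"
    using mem cstar_algebra_bounded Q E by blast+
  fix v assume "v \<in> min_tensor E Q"
  then have v: "v = (\<Sum>i\<in>I. b i \<otimes>\<^sub>o slice i v)" "\<And>i. i \<in> I \<Longrightarrow> slice i v \<in> Q"
    using alg_tensor_expansion[OF subspace_cstar[OF Q]] min_tensor_E[OF Q] by blast+
  have bq: "bounded_op (slice i v)" if "i \<in> I" for i
    using v(2)[OF that] cstar_algebra_bounded[OF Q] by blast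
  have "(e \<otimes>\<^sub>o u) \<odot> (\<Sum>i\<in>I. b i \<otimes>\<^sub>o slice i v) = (\<Sum>i\<in>I. b i \<otimes>\<^sub>o slice i v)"
    by (subst op_mult_sum_right)
      (use e u v(2) in \<open>auto simp: op_tensor_mult bounded_op_tensor bounded_basis bd bq basis_mem is_unit_def\<close>)
  then show "(e \<otimes>\<^sub>o u) \<odot> v = v" using v(1) by simp
  have "(\<Sum>i\<in>I. b i \<otimes>\<^sub>o slice i v) \<odot> (e \<otimes>\<^sub>o u) = (\<Sum>i\<in>I. b i \<otimes>\<^sub>o slice i v)"
    by (subst op_mult_sum_left)
      (use e u v(2) in \<open>auto simp: op_tensor_mult bounded_op_tensor bounded_basis bd bq basis_mem is_unit_def\<close>)
  then show "v \<odot> (e \<otimes>\<^sub>o u) = v" using v(1) by simp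
qed

end

text \<open>In finite dimensions density means spanning, so the density conditions on coproducts and actions
  amount to reaching every tensor of basis elements.\<close>

lemma (in coordinate_basis_pair) dense_pairI:
  assumes "X \<subseteq> min_tensor fst.E snd.E" "\<And>i j. i \<in> I \<Longrightarrow> j \<in> J \<Longrightarrow> b i \<otimes>\<^sub>o b' j \<in> X"
  shows "op_closure (lin_span X) = min_tensor fst.E snd.E"
proof -
  have "lin_span X = pair.E"
    unfolding pair.E_def
  proof (rule lin_span_eqI)
    show "X \<subseteq> lin_span ((\<lambda>(i, j). b i \<otimes>\<^sub>o b' j) ` (I \<times> J))"
      using assms(1) unfolding min_tensor_pair pair.E_def .
    have "(\<lambda>(i, j). b i \<otimes>\<^sub>o b' j) ` (I \<times> J) \<subseteq> X" using assms(2) by auto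
    then show "(\<lambda>(i, j). b i \<otimes>\<^sub>o b' j) ` (I \<times> J) \<subseteq> lin_span X"
      using lin_span_superset by (rule order.trans)
  qed
  then show ?thesis by (simp only: pair.closure_E min_tensor_pair)
qed


section \<open>The algebra of a finite group\<close>

locale finite_group = group G for G (structure) +
  assumes finite_carrier: "finite (carrier G)"
begin

abbreviation L :: "'a \<Rightarrow> 'a matop" where "L \<equiv> lreg G"

lemma bounded_lreg [simp]: "bounded_op (L g)"
  by (rule bounded_op_finite_support[OF finite_carrier]) (auto simp: lreg_def split: if_splits)

lemma lreg_mult:
  assumes "g \<in> carrier G" "h \<in> carrier G"
  shows "L g \<odot> L h = L (g \<otimes> h)"
proof (rule op_mult_eqI)
  fix x z
  show "((\<lambda>y. L g x y * L h y z) has_sum L (g \<otimes> h) x z) UNIV"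
    by (rule has_sum_finite_neutralI[of "{h \<otimes> z}"]) (use assms in \<open>auto simp: lreg_def m_assoc\<close>)
qed auto

lemma lreg_adj: "g \<in> carrier G \<Longrightarrow> op_adj (L g) = L (inv g)"
  by (intro ext) (simp add: op_adj_def lreg_def inv_solve_left cong: conj_cong)

lemma lreg_entry_one:
  "g \<in> carrier G \<Longrightarrow> h \<in> carrier G \<Longrightarrow> L h g \<one> = (if g = h then 1 else 0)"
  by (simp add: lreg_def)

sublocale CG: coordinate_basis "carrier G" L "\<lambda>g. (g, \<one>)"
  by unfold_locales (simp_all add: finite_carrier lreg_entry_one)

lemma cstar_algebra_CG: "cstar_algebra CG.E"
  by (rule CG.cstar_algebra_E) (auto simp: lreg_mult lreg_adj intro!: CG.basis_mem)

lemma Cred_eq: "Cred G = CG.E"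
proof
  show "Cred G \<subseteq> CG.E"
    unfolding Cred_def cstar_generated_def
    using cstar_algebra_CG CG.basis_mem by blast
  show "CG.E \<subseteq> Cred G"
    unfolding Cred_def cstar_generated_def CG.E_def
  proof (intro Inter_greatest)
    fix B assume "B \<in> {B. cstar_algebra B \<and> L ` carrier G \<subseteq> B}"
    then show "lin_span (L ` carrier G) \<subseteq> B" using lin_span_least subspace_cstar by auto
  qed
qed

lemma is_unit_CG: "is_unit CG.E (L \<one>)"
  by (rule CG.is_unit_E) (auto simp: lreg_mult intro: CG.basis_mem)

end

text \<open>The automorphism maps a word for \<open>g\<close> to a word for \<open>\<theta> g\<close> of the same length, and back.\<close>

lemma word_length_automorphism:
  fixes G (structure)
  assumes "group G" "S \<subseteq> carrier G" "g \<in> carrier G"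
    and \<theta>: "\<theta> \<in> hom G G" "\<And>g. g \<in> carrier G \<Longrightarrow> \<theta> (\<theta> g) = g" "\<theta> ` S \<subseteq> S"
  shows "word_length G S (\<theta> g) = word_length G S g"
proof -
  interpret group G by fact
  have step: "\<exists>ws. set ws \<subseteq> S \<and> length ws = n \<and> foldr (\<otimes>) ws \<one> = \<theta> h"
    if ws: "set ws \<subseteq> S" "length ws = n" "foldr (\<otimes>) ws \<one> = h" for ws n h
  proof -
    have "foldr (\<otimes>) ws \<one> \<in> carrier G \<and> foldr (\<otimes>) (map \<theta> ws) \<one> = \<theta> (foldr (\<otimes>) ws \<one>)"
      using ws(1) assms(2) \<theta>(1) by (induction ws) (auto simp: hom_one hom_mult[OF \<theta>(1)] group_axioms)
    then show ?thesis using ws \<theta>(3) by (intro exI[of _ "map \<theta> ws"]) auto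
  qed
  have "(\<exists>ws. set ws \<subseteq> S \<and> length ws = n \<and> foldr (\<otimes>) ws \<one> = \<theta> g)
      \<longleftrightarrow> (\<exists>ws. set ws \<subseteq> S \<and> length ws = n \<and> foldr (\<otimes>) ws \<one> = g)" for n
    using step[of _ n g] step[of _ n "\<theta> g"] \<theta>(2)[OF assms(3)] by auto
  then show ?thesis by (simp add: word_length_def)
qed


section \<open>Doubling a finite group along an involutive automorphism\<close>

locale doubling = finite_group G for G (structure) +
  fixes \<theta> :: "'a \<Rightarrow> 'a"
  assumes \<theta>_hom: "\<theta> \<in> hom G G"
    and \<theta>_invol: "g \<in> carrier G \<Longrightarrow> \<theta> (\<theta> g) = g"
begin

lemma \<theta>_closed [simp]: "g \<in> carrier G \<Longrightarrow> \<theta> g \<in> carrier G"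
  using \<theta>_hom by (auto simp: hom_def)

lemma \<theta>_mult: "g \<in> carrier G \<Longrightarrow> h \<in> carrier G \<Longrightarrow> \<theta> (g \<otimes> h) = \<theta> g \<otimes> \<theta> h"
  using \<theta>_hom by (auto simp: hom_def)

lemma \<theta>_one: "\<theta> \<one> = \<one>"
  using hom_one[OF \<theta>_hom group_axioms group_axioms] .

lemma \<theta>_inv: "g \<in> carrier G \<Longrightarrow> \<theta> (inv g) = inv (\<theta> g)"
  using group_hom.hom_inv[of G G \<theta>] \<theta>_hom group_axioms by (simp add: group_hom_def group_hom_axioms_def)

lemma \<theta>_eq_one: "g \<in> carrier G \<Longrightarrow> \<theta> g = \<one> \<longleftrightarrow> g = \<one>"
  using \<theta>_invol \<theta>_one by metis

definition V :: "'a \<Rightarrow> ('a + 'a) matop" where "V g = L g \<oplus>\<^sub>o 0"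
definition Z :: "'a \<Rightarrow> ('a + 'a) matop" where "Z g = 0 \<oplus>\<^sub>o L g"

lemma bounded_V [simp]: "bounded_op (V g)" and bounded_Z [simp]: "bounded_op (Z g)"
proof -
  have fin: "finite (Inl ` carrier G \<union> Inr ` carrier G)" using finite_carrier by simp
  show "bounded_op (V g)"
    unfolding V_def
    by (rule bounded_op_finite_support[OF fin], case_tac x; case_tac y)
      (auto simp: lreg_def split: if_splits)
  show "bounded_op (Z g)"
    unfolding Z_def
    by (rule bounded_op_finite_support[OF fin], case_tac x; case_tac y)
      (auto simp: lreg_def split: if_splits)
qed

lemma V_mult: "g \<in> carrier G \<Longrightarrow> h \<in> carrier G \<Longrightarrow> V g \<odot> V h = V (g \<otimes> h)"
  and Z_mult: "g \<in> carrier G \<Longrightarrow> h \<in> carrier G \<Longrightarrow> Z g \<odot> Z h = Z (g \<otimes> h)"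
  and V_Z_mult: "V g \<odot> Z h = 0" and Z_V_mult: "Z g \<odot> V h = 0"
  by (simp_all only: V_def Z_def op_dsum_mult lreg_mult op_mult_zero_left op_mult_zero_right op_dsum_zero)

lemma V_adj: "g \<in> carrier G \<Longrightarrow> op_adj (V g) = V (inv g)"
  and Z_adj: "g \<in> carrier G \<Longrightarrow> op_adj (Z g) = Z (inv g)"
  by (simp_all only: V_def Z_def op_dsum_adj lreg_adj op_adj_zero)

sublocale DG: coordinate_basis "carrier G <+> carrier G" "case_sum V Z"
  "case_sum (\<lambda>g. (Inl g, Inl \<one>)) (\<lambda>g. (Inr g, Inr \<one>))"
proof unfold_locales
  fix i j assume "i \<in> carrier G <+> carrier G" "j \<in> carrier G <+> carrier G"
  then show "case_sum V Z j (fst (case_sum (\<lambda>g. (Inl g, Inl \<one>)) (\<lambda>g. (Inr g, Inr \<one>)) i))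
      (snd (case_sum (\<lambda>g. (Inl g, Inl \<one>)) (\<lambda>g. (Inr g, Inr \<one>)) i)) = (if i = j then 1 else 0)"
    by (elim PlusE) (simp_all add: V_def Z_def lreg_entry_one)
qed (auto simp: finite_carrier)

lemma V_mem: "g \<in> carrier G \<Longrightarrow> V g \<in> DG.E" and Z_mem: "g \<in> carrier G \<Longrightarrow> Z g \<in> DG.E"
  using DG.basis_mem[of "Inl g"] DG.basis_mem[of "Inr g"] by auto

lemma DG_ext_V: "g \<in> carrier G \<Longrightarrow> DG.ext f (V g) = f (Inl g)"
  and DG_ext_Z: "g \<in> carrier G \<Longrightarrow> DG.ext f (Z g) = f (Inr g)"
  using DG.ext_basis[of "Inl g" f] DG.ext_basis[of "Inr g" f] by auto

lemma cstar_algebra_DG: "cstar_algebra DG.E"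
  by (rule DG.cstar_algebra_E)
    (auto simp: V_mult Z_mult V_Z_mult Z_V_mult V_adj Z_adj
      intro!: V_mem Z_mem matop.subspace_0[OF DG.subspace_E])

lemma DG_eq: "cstar_dsum (Cred G) (Cred G) = DG.E"
proof
  have "a \<oplus>\<^sub>o c \<in> DG.E" if a: "a \<in> CG.E" and c: "c \<in> CG.E" for a c
  proof -
    have "a \<oplus>\<^sub>o c = (\<Sum>g\<in>carrier G. CG.coord g a *\<^sub>o L g) \<oplus>\<^sub>o (\<Sum>g\<in>carrier G. CG.coord g c *\<^sub>o L g)"
      using CG.expansion[OF a] CG.expansion[OF c] by simp
    also have "\<dots> = (\<Sum>g\<in>carrier G. CG.coord g a *\<^sub>o V g + CG.coord g c *\<^sub>o Z g)"
      by (simp add: V_def Z_def op_dsum_scale op_dsum_add op_dsum_sum)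
    also have "\<dots> \<in> DG.E"
      by (intro matop.subspace_sum matop.subspace_add matop.subspace_scale DG.subspace_E V_mem Z_mem)
    finally show ?thesis .
  qed
  then show "cstar_dsum (Cred G) (Cred G) \<subseteq> DG.E"
    unfolding cstar_dsum_def Cred_eq by blast
  have "matop.subspace (cstar_dsum CG.E CG.E)"
  proof (rule matop.subspaceI)
    show "0 \<in> cstar_dsum CG.E CG.E"
      unfolding cstar_dsum_def using matop.subspace_0[OF CG.subspace_E] op_dsum_zero by fastforce
    show "u + v \<in> cstar_dsum CG.E CG.E" if "u \<in> cstar_dsum CG.E CG.E" "v \<in> cstar_dsum CG.E CG.E" for u v
      using that matop.subspace_add[OF CG.subspace_E] unfolding cstar_dsum_def by (fastforce simp: op_dsum_add)
    show "k *\<^sub>o u \<in> cstar_dsum CG.E CG.E" if "u \<in> cstar_dsum CG.E CG.E" for k u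
      using that matop.subspace_scale[OF CG.subspace_E] unfolding cstar_dsum_def by (fastforce simp: op_dsum_scale)
  qed
  moreover have "case_sum V Z ` (carrier G <+> carrier G) \<subseteq> cstar_dsum CG.E CG.E"
    unfolding cstar_dsum_def V_def Z_def
    using CG.basis_mem matop.subspace_0[OF CG.subspace_E] by fastforce
  ultimately show "DG.E \<subseteq> cstar_dsum (Cred G) (Cred G)"
    unfolding DG.E_def Cred_eq by (intro lin_span_least)
qed

lemma is_unit_DG: "is_unit DG.E (V \<one> + Z \<one>)"
proof (rule DG.is_unit_E)
  show "V \<one> + Z \<one> \<in> DG.E" by (intro matop.subspace_add DG.subspace_E V_mem Z_mem) auto
qed (auto simp: op_mult_add_left op_mult_add_right V_mult Z_mult V_Z_mult Z_V_mult)

text \<open>The first summand carries the canonical coaction \<open>\<lambda>\<^sub>g \<mapsto> \<lambda>\<^sub>g \<otimes> \<lambda>\<^sub>g\<close> and the second one the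
  automorphism followed by the canonical coaction.  The coproduct describes how these symmetries
  compose: as \<open>\<theta>\<close> is an involution, two of the same kind give one of the first kind and two of
  different kinds give one of the second kind.\<close>

definition \<alpha> :: "'a matop \<Rightarrow> ('a \<times> ('a + 'a)) matop" where
  "\<alpha> = CG.ext (\<lambda>g. L g \<otimes>\<^sub>o V g + L (\<theta> g) \<otimes>\<^sub>o Z (\<theta> g))"

definition \<Delta> :: "('a + 'a) matop \<Rightarrow> (('a + 'a) \<times> ('a + 'a)) matop" where
  "\<Delta> = DG.ext (case_sum (\<lambda>g. V g \<otimes>\<^sub>o V g + Z (\<theta> g) \<otimes>\<^sub>o Z g) (\<lambda>g. V (\<theta> g) \<otimes>\<^sub>o Z g + Z g \<otimes>\<^sub>o V g))"

lemma \<alpha>_lreg: "g \<in> carrier G \<Longrightarrow> \<alpha> (L g) = L g \<otimes>\<^sub>o V g + L (\<theta> g) \<otimes>\<^sub>o Z (\<theta> g)"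
  unfolding \<alpha>_def by (rule CG.ext_basis)

lemma \<Delta>_V: "g \<in> carrier G \<Longrightarrow> \<Delta> (V g) = V g \<otimes>\<^sub>o V g + Z (\<theta> g) \<otimes>\<^sub>o Z g"
  and \<Delta>_Z: "g \<in> carrier G \<Longrightarrow> \<Delta> (Z g) = V (\<theta> g) \<otimes>\<^sub>o Z g + Z g \<otimes>\<^sub>o V g"
  unfolding \<Delta>_def by (simp_all only: DG_ext_V DG_ext_Z sum.case)

sublocale CD: coordinate_basis_pair "carrier G" L "\<lambda>g. (g, \<one>)"
  "carrier G <+> carrier G" "case_sum V Z"
  "case_sum (\<lambda>g. (Inl g, Inl \<one>)) (\<lambda>g. (Inr g, Inr \<one>))" ..

sublocale DD: coordinate_basis_pair "carrier G <+> carrier G" "case_sum V Z"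
  "case_sum (\<lambda>g. (Inl g, Inl \<one>)) (\<lambda>g. (Inr g, Inr \<one>))"
  "carrier G <+> carrier G" "case_sum V Z"
  "case_sum (\<lambda>g. (Inl g, Inl \<one>)) (\<lambda>g. (Inr g, Inr \<one>))" ..

lemmas mult_simps = op_mult_add_left op_mult_add_right op_tensor_mult bounded_op_tensor
  bounded_op_add lreg_mult V_mult Z_mult V_Z_mult Z_V_mult op_tensor_zero_left op_tensor_zero_right

lemmas CD_mem = tensor_mem_min_tensor[OF cstar_algebra_CG cstar_algebra_DG]
lemmas DD_mem = tensor_mem_min_tensor[OF cstar_algebra_DG cstar_algebra_DG]
lemmas subspace_CD = CG.subspace_min_tensor[OF cstar_algebra_DG]
lemmas subspace_DD = DG.subspace_min_tensor[OF cstar_algebra_DG]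

lemma star_hom_\<alpha>: "unital_star_hom CG.E (min_tensor CG.E DG.E) \<alpha>"
  unfolding \<alpha>_def
proof (rule CG.unital_star_hom_ext)
  show "matop.subspace (min_tensor CG.E DG.E)" by (rule subspace_CD)
  fix g assume g: "g \<in> carrier G"
  show "L g \<otimes>\<^sub>o V g + L (\<theta> g) \<otimes>\<^sub>o Z (\<theta> g) \<in> min_tensor CG.E DG.E"
    using g by (intro matop.subspace_add subspace_CD CD_mem CG.basis_mem V_mem Z_mem) auto
  show "bounded_op (L g \<otimes>\<^sub>o V g + L (\<theta> g) \<otimes>\<^sub>o Z (\<theta> g))"
    by (simp add: bounded_op_add bounded_op_tensor)
  fix h assume h: "h \<in> carrier G"
  show "L g \<odot> L h \<in> CG.E \<and> CG.ext (\<lambda>g. L g \<otimes>\<^sub>o V g + L (\<theta> g) \<otimes>\<^sub>o Z (\<theta> g)) (L g \<odot> L h)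
      = (L g \<otimes>\<^sub>o V g + L (\<theta> g) \<otimes>\<^sub>o Z (\<theta> g)) \<odot> (L h \<otimes>\<^sub>o V h + L (\<theta> h) \<otimes>\<^sub>o Z (\<theta> h))"
    using g h by (simp add: mult_simps CG.ext_basis CG.basis_mem \<theta>_mult) (simp add: plus_fun_def)
next
  fix g assume g: "g \<in> carrier G"
  show "op_adj (L g) \<in> CG.E \<and> CG.ext (\<lambda>g. L g \<otimes>\<^sub>o V g + L (\<theta> g) \<otimes>\<^sub>o Z (\<theta> g)) (op_adj (L g))
      = op_adj (L g \<otimes>\<^sub>o V g + L (\<theta> g) \<otimes>\<^sub>o Z (\<theta> g))"
    using g by (simp add: lreg_adj CG.ext_basis CG.basis_mem op_adj_add op_tensor_adj V_adj Z_adj \<theta>_inv)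
      (simp add: plus_fun_def)
next
  have "is_unit (min_tensor CG.E DG.E) (L \<one> \<otimes>\<^sub>o (V \<one> + Z \<one>))"
    by (rule CG.is_unit_min_tensor[OF cstar_algebra_DG cstar_algebra_CG is_unit_CG is_unit_DG])
  then show "CG.ext (\<lambda>g. L g \<otimes>\<^sub>o V g + L (\<theta> g) \<otimes>\<^sub>o Z (\<theta> g)) (unit_of CG.E) = unit_of (min_tensor CG.E DG.E)"
    by (simp add: unit_of_eqI[OF is_unit_CG] unit_of_eqI CG.ext_basis \<theta>_one op_tensor_add_right)
      (simp add: plus_fun_def)
qed

lemma star_hom_\<Delta>: "unital_star_hom DG.E (min_tensor DG.E DG.E) \<Delta>"
  unfolding \<Delta>_def
proof (rule DG.unital_star_hom_ext)
  let ?f = "case_sum (\<lambda>g. V g \<otimes>\<^sub>o V g + Z (\<theta> g) \<otimes>\<^sub>o Z g) (\<lambda>g. V (\<theta> g) \<otimes>\<^sub>o Z g + Z g \<otimes>\<^sub>o V g)"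
  show "matop.subspace (min_tensor DG.E DG.E)" by (rule subspace_DD)
  fix i assume i: "i \<in> carrier G <+> carrier G"
  show "?f i \<in> min_tensor DG.E DG.E"
    using i by (auto intro!: matop.subspace_add[OF subspace_DD] DD_mem V_mem Z_mem)
  show "bounded_op (?f i)"
    using i by (auto simp: bounded_op_add bounded_op_tensor)
  fix j assume j: "j \<in> carrier G <+> carrier G"
  show "case_sum V Z i \<odot> case_sum V Z j \<in> DG.E \<and> DG.ext ?f (case_sum V Z i \<odot> case_sum V Z j) = ?f i \<odot> ?f j"
    using i j by (elim PlusE) (simp_all add: mult_simps DG_ext_V DG_ext_Z V_mem Z_mem \<theta>_mult DG.ext_zero
        matop.subspace_0[OF DG.subspace_E], simp_all add: plus_fun_def)
next
  let ?f = "case_sum (\<lambda>g. V g \<otimes>\<^sub>o V g + Z (\<theta> g) \<otimes>\<^sub>o Z g) (\<lambda>g. V (\<theta> g) \<otimes>\<^sub>o Z g + Z g \<otimes>\<^sub>o V g)"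
  fix i assume i: "i \<in> carrier G <+> carrier G"
  show "op_adj (case_sum V Z i) \<in> DG.E \<and> DG.ext ?f (op_adj (case_sum V Z i)) = op_adj (?f i)"
    using i by (elim PlusE) (simp_all add: V_adj Z_adj DG_ext_V DG_ext_Z V_mem Z_mem op_adj_add op_tensor_adj \<theta>_inv,
        simp_all add: plus_fun_def)
next
  let ?f = "case_sum (\<lambda>g. V g \<otimes>\<^sub>o V g + Z (\<theta> g) \<otimes>\<^sub>o Z g) (\<lambda>g. V (\<theta> g) \<otimes>\<^sub>o Z g + Z g \<otimes>\<^sub>o V g)"
  have "is_unit (min_tensor DG.E DG.E) ((V \<one> + Z \<one>) \<otimes>\<^sub>o (V \<one> + Z \<one>))"
    by (rule DG.is_unit_min_tensor[OF cstar_algebra_DG cstar_algebra_DG is_unit_DG is_unit_DG])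
  then show "DG.ext ?f (unit_of DG.E) = unit_of (min_tensor DG.E DG.E)"
    by (simp add: unit_of_eqI[OF is_unit_DG] unit_of_eqI DG.ext_add DG_ext_V DG_ext_Z \<theta>_one
        op_tensor_add_right op_tensor_add_left add_ac)
      (simp add: plus_fun_def add_ac)
qed

lemma \<alpha>_mem: "a \<in> CG.E \<Longrightarrow> \<alpha> a \<in> min_tensor CG.E DG.E"
  and \<Delta>_mem: "q \<in> DG.E \<Longrightarrow> \<Delta> q \<in> min_tensor DG.E DG.E"
  using star_hom_\<alpha> star_hom_\<Delta> by (auto simp: unital_star_hom_def)

lemma linear_\<alpha>: "linear_on_ops A \<alpha>" and linear_\<Delta>: "linear_on_ops B \<Delta>"
  unfolding \<alpha>_def \<Delta>_def by (rule CG.linear_ext, rule DG.linear_ext)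

lemma bounded_\<alpha>_lreg: "g \<in> carrier G \<Longrightarrow> bounded_op (\<alpha> (L g))"
  by (simp add: \<alpha>_lreg bounded_op_add bounded_op_tensor)

lemma bounded_\<Delta>_basis: "i \<in> carrier G <+> carrier G \<Longrightarrow> bounded_op (\<Delta> (case_sum V Z i))"
  by (elim PlusE) (simp_all add: \<Delta>_V \<Delta>_Z bounded_op_add bounded_op_tensor)

text \<open>The density conditions hold because one of the two terms of each coproduct is annihilated by a
  basis element in the other leg, as in \<open>\<Delta> (V g) (1 \<otimes> V h) = V g \<otimes> V (g h)\<close>, and \<open>h\<close> can be chosen so
  that the remaining term is any given tensor of basis elements.\<close>

lemma compact_quantum_group_doubling: "compact_quantum_group DG.E \<Delta>"
  unfolding compact_quantum_group_def
proof (intro conjI)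
  show "unital_cstar_algebra DG.E"
    unfolding unital_cstar_algebra_def using cstar_algebra_DG is_unit_DG by blast
  show "unital_star_hom DG.E (min_tensor DG.E DG.E) \<Delta>" by (rule star_hom_\<Delta>)
  show "\<exists>T1 T2. tensor_map DG.E DG.E \<Delta> id T1 \<and> tensor_map DG.E DG.E id \<Delta> T2
      \<and> (\<forall>a\<in>DG.E. T1 (\<Delta> a) = op_assoc (T2 (\<Delta> a)))"
  proof -
    have id: "linear_on_ops DG.E id" by (simp add: linear_on_ops_def)
    obtain T1 where T1: "tensor_map DG.E DG.E \<Delta> id T1"
      using DD.tensor_map_pair[OF linear_\<Delta> bounded_\<Delta>_basis id] DG.bounded_basis by auto
    obtain T2 where T2: "tensor_map DG.E DG.E id \<Delta> T2"
      using DD.tensor_map_pair[OF id _ linear_\<Delta> bounded_\<Delta>_basis] DG.bounded_basis by auto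
    have "T1 (\<Delta> a) = op_assoc (T2 (\<Delta> a))" if "a \<in> DG.E" for a
    proof (rule DG.linear_eqI[OF _ _ _ that])
      have lin: "linear_on_ops (min_tensor DG.E DG.E) T1" "linear_on_ops (min_tensor DG.E DG.E) T2"
        using T1 T2 by (simp_all add: tensor_map_def)
      show "linear_on_ops DG.E (\<lambda>a. T1 (\<Delta> a))"
        by (rule linear_on_ops_comp[OF linear_\<Delta> \<Delta>_mem lin(1)])
      show "linear_on_ops DG.E (\<lambda>a. op_assoc (T2 (\<Delta> a)))"
        by (rule linear_on_ops_comp[OF linear_on_ops_comp[OF linear_\<Delta> \<Delta>_mem lin(2)] UNIV_I linear_op_assoc])
      show "T1 (\<Delta> (case_sum V Z i)) = op_assoc (T2 (\<Delta> (case_sum V Z i)))" if "i \<in> carrier G <+> carrier G" for i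
        using that
        by (elim PlusE)
          (simp_all add: \<Delta>_V \<Delta>_Z V_mem Z_mem \<theta>_invol tensor_map_add[OF T1 cstar_algebra_DG cstar_algebra_DG]
            tensor_map_add[OF T2 cstar_algebra_DG cstar_algebra_DG] op_tensor_add_left op_tensor_add_right
            op_assoc_add op_assoc_tensor add_ac)
    qed
    then show ?thesis using T1 T2 by blast
  qed
  have D: "V g \<odot> (V \<one> + Z \<one>) = V g" "(V \<one> + Z \<one>) \<odot> V g = V g"
    "Z g \<odot> (V \<one> + Z \<one>) = Z g" "(V \<one> + Z \<one>) \<odot> Z g = Z g" if "g \<in> carrier G" for g
    using that by (simp_all add: mult_simps)
  have g: "inv g \<otimes> h \<in> carrier G" "g \<otimes> (inv g \<otimes> h) = h" if "g \<in> carrier G" "h \<in> carrier G" for g h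
    using that by (simp_all flip: m_assoc)
  show "op_closure (lin_span {\<Delta> a \<odot> (unit_of DG.E \<otimes>\<^sub>o b) |a b. a \<in> DG.E \<and> b \<in> DG.E}) = min_tensor DG.E DG.E"
    (is "op_closure (lin_span ?X) = _")
  proof (rule DD.dense_pairI)
    show "?X \<subseteq> min_tensor DG.E DG.E"
      using is_unit_unit_of cstar_algebra_DG is_unit_DG unit_of_eqI[OF is_unit_DG]
      by (auto intro!: DG.min_tensor_mult \<Delta>_mem DD_mem simp: is_unit_def)
    have X: "\<Delta> a \<odot> ((V \<one> + Z \<one>) \<otimes>\<^sub>o b) \<in> ?X" if "a \<in> DG.E" "b \<in> DG.E" for a b
      using that unit_of_eqI[OF is_unit_DG] by auto
    show "case_sum V Z i \<otimes>\<^sub>o case_sum V Z j \<in> ?X"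
      if "i \<in> carrier G <+> carrier G" "j \<in> carrier G <+> carrier G" for i j
      using that
    proof (elim PlusE; hypsubst)
      fix x y assume "x \<in> carrier G" "y \<in> carrier G"
      note xy = this g[OF this] g[OF \<theta>_closed[OF this(1)] this(2)]
      show "case_sum V Z (Inl x) \<otimes>\<^sub>o case_sum V Z (Inl y) \<in> ?X"
        using X[OF V_mem[OF xy(1)] V_mem[OF xy(3)]] xy by (simp add: \<Delta>_V mult_simps D)
      show "case_sum V Z (Inr x) \<otimes>\<^sub>o case_sum V Z (Inl y) \<in> ?X"
        using X[OF Z_mem[OF xy(1)] V_mem[OF xy(3)]] xy by (simp add: \<Delta>_Z mult_simps D)
      show "case_sum V Z (Inl x) \<otimes>\<^sub>o case_sum V Z (Inr y) \<in> ?X"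
        using X[OF Z_mem[OF \<theta>_closed[OF xy(1)]] Z_mem[OF xy(5)]] xy by (simp add: \<Delta>_Z mult_simps D \<theta>_invol)
      show "case_sum V Z (Inr x) \<otimes>\<^sub>o case_sum V Z (Inr y) \<in> ?X"
        using X[OF V_mem[OF \<theta>_closed[OF xy(1)]] Z_mem[OF xy(5)]] xy by (simp add: \<Delta>_V mult_simps D \<theta>_invol)
    qed
  qed
  show "op_closure (lin_span {\<Delta> a \<odot> (b \<otimes>\<^sub>o unit_of DG.E) |a b. a \<in> DG.E \<and> b \<in> DG.E}) = min_tensor DG.E DG.E"
    (is "op_closure (lin_span ?X) = _")
  proof (rule DD.dense_pairI)
    show "?X \<subseteq> min_tensor DG.E DG.E"
      using is_unit_unit_of cstar_algebra_DG is_unit_DG unit_of_eqI[OF is_unit_DG]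
      by (auto intro!: DG.min_tensor_mult \<Delta>_mem DD_mem simp: is_unit_def)
    have X: "\<Delta> a \<odot> (b \<otimes>\<^sub>o (V \<one> + Z \<one>)) \<in> ?X" if "a \<in> DG.E" "b \<in> DG.E" for a b
      using that unit_of_eqI[OF is_unit_DG] by auto
    show "case_sum V Z i \<otimes>\<^sub>o case_sum V Z j \<in> ?X"
      if "i \<in> carrier G <+> carrier G" "j \<in> carrier G <+> carrier G" for i j
      using that
    proof (elim PlusE; hypsubst)
      fix x y assume "x \<in> carrier G" "y \<in> carrier G"
      note xy = this g[OF this(2,1)] g[OF \<theta>_closed[OF this(2)] this(1)]
      show "case_sum V Z (Inl x) \<otimes>\<^sub>o case_sum V Z (Inl y) \<in> ?X"
        using X[OF V_mem[OF xy(2)] V_mem[OF xy(3)]] xy by (simp add: \<Delta>_V mult_simps D)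
      show "case_sum V Z (Inr x) \<otimes>\<^sub>o case_sum V Z (Inl y) \<in> ?X"
        using X[OF Z_mem[OF xy(2)] Z_mem[OF xy(3)]] xy by (simp add: \<Delta>_Z mult_simps D)
      show "case_sum V Z (Inl x) \<otimes>\<^sub>o case_sum V Z (Inr y) \<in> ?X"
        using X[OF Z_mem[OF xy(2)] V_mem[OF xy(5)]] xy by (simp add: \<Delta>_Z mult_simps D)
      show "case_sum V Z (Inr x) \<otimes>\<^sub>o case_sum V Z (Inr y) \<in> ?X"
        using X[OF V_mem[OF xy(2)] Z_mem[OF xy(5)]] xy by (simp add: \<Delta>_V mult_simps D)
    qed
  qed
qed

lemma cqg_action_doubling: "cqg_action CG.E DG.E \<Delta> \<alpha>"
  unfolding cqg_action_def
proof (intro conjI)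
  show "unital_star_hom CG.E (min_tensor CG.E DG.E) \<alpha>" by (rule star_hom_\<alpha>)
  show "\<exists>T1 T2. tensor_map CG.E DG.E \<alpha> id T1 \<and> tensor_map CG.E DG.E id (\<lambda>q. op_flip (\<Delta> q)) T2
      \<and> (\<forall>a\<in>CG.E. T1 (\<alpha> a) = op_assoc (T2 (\<alpha> a)))"
  proof -
    have id: "linear_on_ops A id" for A :: "'x matop set" by (simp add: linear_on_ops_def)
    have flip: "linear_on_ops DG.E (\<lambda>q. op_flip (\<Delta> q))"
      by (rule linear_on_ops_comp[OF linear_\<Delta> UNIV_I])
        (auto simp: linear_on_ops_def op_flip_def op_scale_def fun_eq_iff)
    have flip_V: "op_flip (\<Delta> (V g)) = V g \<otimes>\<^sub>o V g + Z g \<otimes>\<^sub>o Z (\<theta> g)"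
      and flip_Z: "op_flip (\<Delta> (Z g)) = Z g \<otimes>\<^sub>o V (\<theta> g) + V g \<otimes>\<^sub>o Z g" if "g \<in> carrier G" for g
      using that by (simp_all add: \<Delta>_V \<Delta>_Z op_flip_add op_flip_tensor)
    obtain T1 where T1: "tensor_map CG.E DG.E \<alpha> id T1"
      using CD.tensor_map_pair[OF linear_\<alpha> bounded_\<alpha>_lreg id] DG.bounded_basis by auto
    have "bounded_op (op_flip (\<Delta> (case_sum V Z i)))" if "i \<in> carrier G <+> carrier G" for i
      using that by (elim PlusE) (simp_all add: flip_V flip_Z bounded_op_add bounded_op_tensor)
    then obtain T2 where T2: "tensor_map CG.E DG.E id (\<lambda>q. op_flip (\<Delta> q)) T2"
      using CD.tensor_map_pair[OF id _ flip] by auto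
    have "T1 (\<alpha> a) = op_assoc (T2 (\<alpha> a))" if "a \<in> CG.E" for a
    proof (rule CG.linear_eqI[OF _ _ _ that])
      have lin: "linear_on_ops (min_tensor CG.E DG.E) T1" "linear_on_ops (min_tensor CG.E DG.E) T2"
        using T1 T2 by (simp_all add: tensor_map_def)
      show "linear_on_ops CG.E (\<lambda>a. T1 (\<alpha> a))"
        by (rule linear_on_ops_comp[OF linear_\<alpha> \<alpha>_mem lin(1)])
      show "linear_on_ops CG.E (\<lambda>a. op_assoc (T2 (\<alpha> a)))"
        by (rule linear_on_ops_comp[OF linear_on_ops_comp[OF linear_\<alpha> \<alpha>_mem lin(2)] UNIV_I linear_op_assoc])
      show "T1 (\<alpha> (L g)) = op_assoc (T2 (\<alpha> (L g)))" if "g \<in> carrier G" for g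
        using that
        by (simp add: \<alpha>_lreg flip_V flip_Z V_mem Z_mem CG.basis_mem \<theta>_invol
            tensor_map_add[OF T1 cstar_algebra_CG cstar_algebra_DG]
            tensor_map_add[OF T2 cstar_algebra_CG cstar_algebra_DG] op_tensor_add_left op_tensor_add_right
            op_assoc_add op_assoc_tensor add_ac)
    qed
    then show ?thesis using T1 T2 by blast
  qed
  have D: "L g \<odot> L \<one> = L g" if "g \<in> carrier G" for g
    using that by (simp add: lreg_mult)
  have g: "inv g \<otimes> h \<in> carrier G" "g \<otimes> (inv g \<otimes> h) = h" if "g \<in> carrier G" "h \<in> carrier G" for g h
    using that by (simp_all flip: m_assoc)
  show "op_closure (lin_span {\<alpha> a \<odot> (unit_of CG.E \<otimes>\<^sub>o b) |a b. a \<in> CG.E \<and> b \<in> DG.E}) = min_tensor CG.E DG.E"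
    (is "op_closure (lin_span ?X) = _")
  proof (rule CD.dense_pairI)
    show "?X \<subseteq> min_tensor CG.E DG.E"
      using cstar_algebra_DG cstar_algebra_CG is_unit_CG unit_of_eqI[OF is_unit_CG]
      by (auto intro!: CG.min_tensor_mult \<alpha>_mem CD_mem simp: is_unit_def)
    have X: "\<alpha> a \<odot> (L \<one> \<otimes>\<^sub>o b) \<in> ?X" if "a \<in> CG.E" "b \<in> DG.E" for a b
      using that unit_of_eqI[OF is_unit_CG] by auto
    show "L x \<otimes>\<^sub>o case_sum V Z j \<in> ?X"
      if x: "x \<in> carrier G" and j: "j \<in> carrier G <+> carrier G" for x j
      using j
    proof (elim PlusE; hypsubst)
      fix y assume "y \<in> carrier G"
      note xy = x this g[OF x this]
      show "L x \<otimes>\<^sub>o case_sum V Z (Inl y) \<in> ?X"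
        using X[OF CG.basis_mem[OF xy(1)] V_mem[OF xy(3)]] xy by (simp add: \<alpha>_lreg mult_simps D)
      show "L x \<otimes>\<^sub>o case_sum V Z (Inr y) \<in> ?X"
        using X[OF CG.basis_mem[OF \<theta>_closed[OF xy(1)]] Z_mem[OF xy(3)]] xy
        by (simp add: \<alpha>_lreg mult_simps D \<theta>_invol)
    qed
  qed
qed

text \<open>The trace is preserved since \<open>\<theta> g = 1\<close> only for \<open>g = 1\<close>, and the grading by length since \<open>\<theta>\<close> permutes
  the generators.\<close>

lemma orientation_preserving_doubling:
  assumes S: "S \<subseteq> carrier G" "\<theta> ` S \<subseteq> S"
  shows "orientation_preserving_action G S DG.E \<Delta> \<alpha>"
  unfolding orientation_preserving_action_def Cred_eq
proof (intro conjI ballI)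
  show "compact_quantum_group DG.E \<Delta>" by (rule compact_quantum_group_doubling)
  show "cqg_action CG.E DG.E \<Delta> \<alpha>" by (rule cqg_action_doubling)
  have slice: "gtrace_slice G u = CG.slice \<one> u" for u :: "('a \<times> ('a + 'a)) matop"
    by (simp add: gtrace_slice_def CG.slice_def)
  show "gtrace_slice G (\<alpha> a) = gtrace G a *\<^sub>o unit_of DG.E" if "a \<in> CG.E" for a
  proof (rule CG.linear_eqI[OF _ _ _ that])
    show "linear_on_ops CG.E (\<lambda>a. gtrace_slice G (\<alpha> a))"
      by (rule linear_on_ops_comp[OF linear_\<alpha> UNIV_I])
        (simp add: linear_on_ops_def slice CG.slice_add CG.slice_scale)
    show "linear_on_ops CG.E (\<lambda>a. gtrace G a *\<^sub>o unit_of DG.E)"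
      by (simp add: linear_on_ops_def gtrace_def matop.scale_left_distrib op_scale_def[of _ "_ :: 'a matop"])
    show "gtrace_slice G (\<alpha> (L g)) = gtrace G (L g) *\<^sub>o unit_of DG.E" if "g \<in> carrier G" for g
      using that \<theta>_eq_one[of g] unit_of_eqI[OF is_unit_DG]
      by (auto simp: slice \<alpha>_lreg CG.slice_add CG.slice_basis_tensor gtrace_def lreg_entry_one)
  qed
  fix g assume g: "g \<in> carrier G"
  let ?H = "{L h |h. h \<in> carrier G \<and> word_length G S h = word_length G S g}"
  have "word_length G S (\<theta> g) = word_length G S g"
    by (rule word_length_automorphism[OF is_group S(1) g \<theta>_hom \<theta>_invol S(2)])
  then have "L g \<in> lin_span ?H" "L (\<theta> g) \<in> lin_span ?H"
    using g by (auto intro!: subsetD[OF lin_span_superset])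
  then show "\<alpha> (L g) \<in> alg_tensor (lin_span ?H) DG.E"
    unfolding \<alpha>_lreg[OF g] alg_tensor_def using V_mem[OF g] Z_mem[OF \<theta>_closed[OF g]]
    by (intro matop.subspace_add subspace_lin_span subsetD[OF lin_span_superset]) auto
qed

end

section \<open>The universal property of the doubling\<close>

locale generated_doubling = doubling G \<theta> for G (structure) and \<theta> +
  fixes S :: "'a set"
  assumes S_closed: "S \<subseteq> carrier G"
    and S_nonempty: "S \<noteq> {}"
    and S_inv: "s \<in> S \<Longrightarrow> inv s \<in> S"
    and S_generates: "g \<in> carrier G \<Longrightarrow> \<exists>ws. set ws \<subseteq> S \<and> foldr (\<otimes>) ws \<one> = g"
    and \<theta>_S: "s \<in> S \<Longrightarrow> \<theta> s \<in> S"
    and \<theta>_moves: "s \<in> S \<Longrightarrow> \<theta> s \<noteq> s"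
begin

lemma S_carrier: "s \<in> S \<Longrightarrow> s \<in> carrier G"
  using S_closed by blast

text \<open>The unit also counts as a nonempty product of generators, namely \<open>s s\<^sup>-\<^sup>1\<close>; this is why the rule
  has only the two cases.\<close>

lemma generator_induct [consumes 1, case_names gen mult]:
  assumes g: "g \<in> carrier G" and gen: "\<And>s. s \<in> S \<Longrightarrow> P s"
    and mult: "\<And>g h. g \<in> carrier G \<Longrightarrow> h \<in> carrier G \<Longrightarrow> P g \<Longrightarrow> P h \<Longrightarrow> P (g \<otimes> h)"
  shows "P g"
proof -
  obtain s where s: "s \<in> S" using S_nonempty by blast
  have one: "P \<one>"
    using mult[of s "inv s"] gen[OF s] gen[OF S_inv[OF s]] S_carrier[OF s] by simp
  obtain ws where ws: "set ws \<subseteq> S" "foldr (\<otimes>) ws \<one> = g"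
    using S_generates[OF g] by blast
  have "foldr (\<otimes>) ws \<one> \<in> carrier G \<and> P (foldr (\<otimes>) ws \<one>)"
    using ws(1)
  proof (induction ws)
    case Nil
    then show ?case using one by simp
  next
    case (Cons w ws)
    then show ?case using mult[of w "foldr (\<otimes>) ws \<one>"] gen[of w] S_carrier[of w] by simp
  qed
  then show ?thesis using ws(2) by simp
qed

lemma eq_on_CG_if_eq_on_generators:
  assumes f: "linear_on_ops CG.E f" "\<And>a b. a \<in> CG.E \<Longrightarrow> b \<in> CG.E \<Longrightarrow> f (a \<odot> b) = f a \<odot> f b"
    and f': "linear_on_ops CG.E f'" "\<And>a b. a \<in> CG.E \<Longrightarrow> b \<in> CG.E \<Longrightarrow> f' (a \<odot> b) = f' a \<odot> f' b"
    and S: "\<And>s. s \<in> S \<Longrightarrow> f (L s) = f' (L s)" and a: "a \<in> CG.E"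
  shows "f a = f' a"
proof (rule CG.linear_eqI[OF f(1) f'(1) _ a])
  fix g assume "g \<in> carrier G"
  then show "f (L g) = f' (L g)"
  proof (induction rule: generator_induct)
    case (mult g h)
    then show ?case
      using f(2)[OF CG.basis_mem CG.basis_mem, of g h] f'(2)[OF CG.basis_mem CG.basis_mem, of g h]
      by (simp add: lreg_mult)
  qed (rule S)
qed

lemma eq_on_DG_if_eq_on_generators:
  assumes f: "linear_on_ops DG.E f" "\<And>a b. a \<in> DG.E \<Longrightarrow> b \<in> DG.E \<Longrightarrow> f (a \<odot> b) = f a \<odot> f b"
    and f': "linear_on_ops DG.E f'" "\<And>a b. a \<in> DG.E \<Longrightarrow> b \<in> DG.E \<Longrightarrow> f' (a \<odot> b) = f' a \<odot> f' b"
    and S: "\<And>s. s \<in> S \<Longrightarrow> f (V s) = f' (V s)" "\<And>s. s \<in> S \<Longrightarrow> f (Z s) = f' (Z s)" and a: "a \<in> DG.E"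
  shows "f a = f' a"
proof (rule DG.linear_eqI[OF f(1) f'(1) _ a])
  have "f (V g) = f' (V g) \<and> f (Z g) = f' (Z g)" if "g \<in> carrier G" for g
    using that
  proof (induction rule: generator_induct)
    case (mult g h)
    then show ?case
      using f(2)[OF V_mem V_mem, of g h] f'(2)[OF V_mem V_mem, of g h]
        f(2)[OF Z_mem Z_mem, of g h] f'(2)[OF Z_mem Z_mem, of g h]
      by (simp add: V_mult Z_mult)
  qed (use S in blast)
  then show "f (case_sum V Z i) = f' (case_sum V Z i)" if "i \<in> carrier G <+> carrier G" for i
    using that by (elim PlusE) auto
qed

lemma cstar_generated_DG: "cstar_generated (V ` S \<union> Z ` S) = DG.E"
proof
  show "cstar_generated (V ` S \<union> Z ` S) \<subseteq> DG.E"
    unfolding cstar_generated_def using cstar_algebra_DG V_mem Z_mem S_carrier by blast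
  show "DG.E \<subseteq> cstar_generated (V ` S \<union> Z ` S)"
    unfolding cstar_generated_def
  proof (intro Inter_greatest)
    fix B assume "B \<in> {B. cstar_algebra B \<and> V ` S \<union> Z ` S \<subseteq> B}"
    then have B: "cstar_algebra B" "V ` S \<union> Z ` S \<subseteq> B" by auto
    have "V g \<in> B \<and> Z g \<in> B" if "g \<in> carrier G" for g
      using that
    proof (induction rule: generator_induct)
      case (gen s)
      then show ?case using B(2) by auto
    next
      case (mult g h)
      then show ?case
        using cstar_algebra_mult[OF B(1), of "V g" "V h"] cstar_algebra_mult[OF B(1), of "Z g" "Z h"]
        by (simp add: V_mult Z_mult)
    qed
    then have "case_sum V Z ` (carrier G <+> carrier G) \<subseteq> B" by (auto elim!: PlusE)
    then show "DG.E \<subseteq> B"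
      unfolding DG.E_def by (rule lin_span_least[OF _ subspace_cstar[OF B(1)]])
  qed
qed

end

lemma op_assoc_inject: "op_assoc u = op_assoc u' \<longleftrightarrow> u = u'"
proof
  assume *: "op_assoc u = op_assoc u'"
  show "u = u'"
  proof (intro ext)
    fix p q :: "'a \<times> 'b \<times> 'c"
    obtain x y z x' y' z' where "p = (x, y, z)" "q = (x', y', z')" by (cases p; cases q) auto
    then show "u p q = u' p q"
      using fun_cong[OF fun_cong[OF *], of "((x, y), z)" "((x', y'), z')"] by (simp add: op_assoc_def)
  qed
qed simp

lemma op_flip_flip: "op_flip (op_flip u) = u"
  by (simp add: op_flip_def)

text \<open>The actions that look like the one of the doubling on generators: the algebra has complementary
  projections \<open>p\<close> and \<open>q\<close>, the \<open>p\<close>-part of the image of \<open>\<lambda>\<^sub>s\<close> sits over \<open>\<lambda>\<^sub>s\<close> and the \<open>q\<close>-part over its image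
  under the automorphism.  Such an action turns out to look like this on the whole group, so
  that its two parts are representations of the group, and these two representations make up the
  morphism from the doubling.\<close>

locale splitting = generated_doubling G \<theta> S for G (structure) and \<theta> and S +
  fixes Q :: "'y matop set" and \<Gamma> :: "'y matop \<Rightarrow> ('y \<times> 'y) matop" and \<beta> :: "'a matop \<Rightarrow> ('a \<times> 'y) matop"
    and p q :: "'y matop"
  assumes action: "orientation_preserving_action G S Q \<Gamma> \<beta>"
    and p_mem: "p \<in> Q" and q_mem: "q \<in> Q" and pq_unit: "is_unit Q (p + q)"
    and pq: "p \<odot> q = 0" "q \<odot> p = 0"
    and p_adj: "op_adj p = p" and q_adj: "op_adj q = q"
    and split: "s \<in> S \<Longrightarrow> \<exists>v w. v \<in> Q \<and> w \<in> Q \<and> p \<odot> v = v \<and> v \<odot> p = v \<and> q \<odot> w = w \<and> w \<odot> q = w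
      \<and> \<beta> (L s) = L s \<otimes>\<^sub>o v + L (\<theta> s) \<otimes>\<^sub>o w"
begin

lemma cstar_Q: "cstar_algebra Q"
  using action by (simp add: orientation_preserving_action_def compact_quantum_group_def unital_cstar_algebra_def)

lemma bounded_Q: "a \<in> Q \<Longrightarrow> bounded_op a"
  by (rule cstar_algebra_bounded[OF cstar_Q])

lemma \<beta>_hom: "unital_star_hom CG.E (min_tensor CG.E Q) \<beta>"
  using action by (simp add: orientation_preserving_action_def cqg_action_def Cred_eq)

lemma linear_\<beta>: "linear_on_ops CG.E \<beta>"
  using \<beta>_hom by (simp add: unital_star_hom_def)

lemma \<beta>_mult: "a \<in> CG.E \<Longrightarrow> b \<in> CG.E \<Longrightarrow> \<beta> (a \<odot> b) = \<beta> a \<odot> \<beta> b"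
  and \<beta>_adj: "a \<in> CG.E \<Longrightarrow> \<beta> (op_adj a) = op_adj (\<beta> a)"
  using \<beta>_hom by (simp_all add: unital_star_hom_def)

lemma \<beta>_one: "\<beta> (L \<one>) = L \<one> \<otimes>\<^sub>o (p + q)"
proof -
  have "is_unit (min_tensor CG.E Q) (L \<one> \<otimes>\<^sub>o (p + q))"
    by (rule CG.is_unit_min_tensor[OF cstar_Q cstar_algebra_CG is_unit_CG pq_unit])
  moreover have "\<beta> (unit_of CG.E) = unit_of (min_tensor CG.E Q)"
    using \<beta>_hom by (simp add: unital_star_hom_def)
  ultimately show ?thesis by (simp only: unit_of_eqI unit_of_eqI[OF is_unit_CG])
qed

lemma \<Gamma>_hom: "unital_star_hom Q (min_tensor Q Q) \<Gamma>"
  using action by (simp add: orientation_preserving_action_def compact_quantum_group_def)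

lemma assoc_Q: "a \<in> Q \<Longrightarrow> b \<in> Q \<Longrightarrow> c \<in> Q \<Longrightarrow> (a \<odot> b) \<odot> c = a \<odot> (b \<odot> c)"
  by (rule op_mult_assoc) (rule bounded_Q, assumption)+

definition corners :: "'y matop \<Rightarrow> 'y matop \<Rightarrow> bool" where
  "corners v w \<longleftrightarrow> v \<in> Q \<and> w \<in> Q \<and> p \<odot> v = v \<and> v \<odot> p = v \<and> q \<odot> w = w \<and> w \<odot> q = w"

lemma cornersD:
  assumes "corners v w"
  shows "v \<in> Q" "w \<in> Q" "p \<odot> v = v" "v \<odot> p = v" "q \<odot> w = w" "w \<odot> q = w"
    "p \<odot> w = 0" "w \<odot> p = 0" "q \<odot> v = 0" "v \<odot> q = 0"
proof -
  show *: "v \<in> Q" "w \<in> Q" "p \<odot> v = v" "v \<odot> p = v" "q \<odot> w = w" "w \<odot> q = w"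
    using assms by (simp_all add: corners_def)
  show "p \<odot> w = 0" using assoc_Q[OF p_mem q_mem *(2)] *(5) pq by simp
  show "w \<odot> p = 0" using assoc_Q[OF *(2) q_mem p_mem] *(6) pq by simp
  show "q \<odot> v = 0" using assoc_Q[OF q_mem p_mem *(1)] *(3) pq by simp
  show "v \<odot> q = 0" using assoc_Q[OF *(1) p_mem q_mem] *(4) pq by simp
qed

lemma corners_orthogonal:
  assumes "corners v w" "corners v' w'"
  shows "v \<odot> w' = 0" "w \<odot> v' = 0"
proof -
  show "v \<odot> w' = 0"
    using assoc_Q[OF cornersD(1)[OF assms(1)] p_mem cornersD(2)[OF assms(2)]]
    by (simp add: cornersD[OF assms(1)] cornersD[OF assms(2)])
  show "w \<odot> v' = 0"
    using assoc_Q[OF cornersD(2)[OF assms(1)] q_mem cornersD(1)[OF assms(2)]]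
    by (simp add: cornersD[OF assms(1)] cornersD[OF assms(2)])
qed

definition component :: "'a \<Rightarrow> 'y matop \<Rightarrow> 'y matop \<Rightarrow> bool" where
  "component g v w \<longleftrightarrow> corners v w \<and> \<beta> (L g) = L g \<otimes>\<^sub>o v + L (\<theta> g) \<otimes>\<^sub>o w"

text \<open>If \<open>\<theta> g = g\<close>, the two terms have the same first factor; multiplication by the projections
  still separates them.\<close>

lemma component_unique:
  assumes "component g v w" "component g v' w'" and g: "g \<in> carrier G"
  shows "v = v' \<and> w = w'"
proof -
  have c: "corners v w" "corners v' w'" using assms by (auto simp: component_def)
  note bd = bounded_Q[OF p_mem] bounded_Q[OF q_mem] bounded_Q[OF cornersD(1)[OF c(1)]]
    bounded_Q[OF cornersD(2)[OF c(1)]] bounded_Q[OF cornersD(1)[OF c(2)]] bounded_Q[OF cornersD(2)[OF c(2)]]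
    bounded_op_zero
  have eq: "L g \<otimes>\<^sub>o v + L (\<theta> g) \<otimes>\<^sub>o w = L g \<otimes>\<^sub>o v' + L (\<theta> g) \<otimes>\<^sub>o w'"
    using assms by (simp add: component_def)
  have "v + (if g = \<theta> g then w else 0) = v' + (if g = \<theta> g then w' else 0)"
    using arg_cong[OF eq, of "CG.slice g"] g by (simp only: CG.slice_add CG.slice_basis_tensor \<theta>_closed if_True simp_thms)
  from arg_cong[OF this, of "(\<odot>) p"] have "v = v'"
    using bd by (cases "g = \<theta> g") (simp_all add: op_mult_add_right cornersD[OF c(1)] cornersD[OF c(2)])
  moreover have "(if \<theta> g = g then v else 0) + w = (if \<theta> g = g then v' else 0) + w'"
    using arg_cong[OF eq, of "CG.slice (\<theta> g)"] g by (simp only: CG.slice_add CG.slice_basis_tensor \<theta>_closed if_True simp_thms)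
  from arg_cong[OF this, of "(\<odot>) q"] have "w = w'"
    using bd by (cases "\<theta> g = g") (simp_all add: op_mult_add_right cornersD[OF c(1)] cornersD[OF c(2)])
  ultimately show ?thesis by simp
qed

text \<open>The cross terms vanish as \<open>p q = q p = 0\<close>, and the surviving terms stay over \<open>g h\<close> and \<open>\<theta> (g h)\<close>
  because \<open>\<theta>\<close> is multiplicative.\<close>

lemma component_mult:
  assumes "component g v w" "component h v' w'" "g \<in> carrier G" "h \<in> carrier G"
  shows "component (g \<otimes> h) (v \<odot> v') (w \<odot> w')"
proof -
  have c: "corners v w" "corners v' w'" using assms by (auto simp: component_def)
  note m = cornersD(1,2)[OF c(1)] cornersD(1,2)[OF c(2)] p_mem q_mem
  have "corners (v \<odot> v') (w \<odot> w')"
    unfolding corners_def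
    using m assoc_Q[OF m(1,3,5)] assoc_Q[OF m(5,1,3)] assoc_Q[OF m(2,4,6)] assoc_Q[OF m(6,2,4)]
    by (simp add: cornersD[OF c(1)] cornersD[OF c(2)] cstar_algebra_mult[OF cstar_Q])
  moreover have "\<beta> (L (g \<otimes> h)) = \<beta> (L g) \<odot> \<beta> (L h)"
    using \<beta>_mult[OF CG.basis_mem CG.basis_mem, of g h] assms(3,4) by (simp add: lreg_mult)
  moreover have "\<beta> (L g) \<odot> \<beta> (L h) = L (g \<otimes> h) \<otimes>\<^sub>o (v \<odot> v') + L (\<theta> (g \<otimes> h)) \<otimes>\<^sub>o (w \<odot> w')"
    using assms m[THEN bounded_Q] unfolding component_def
    by (simp add: mult_simps corners_orthogonal[OF c] \<theta>_mult)
  ultimately show ?thesis by (simp add: component_def)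
qed

lemma component_inv:
  assumes "component g v w" "g \<in> carrier G"
  shows "component (inv g) (op_adj v) (op_adj w)"
proof -
  have c: "corners v w" using assms by (simp add: component_def)
  have "corners (op_adj v) (op_adj w)"
    unfolding corners_def
    using op_adj_mult[of p v] op_adj_mult[of v p] op_adj_mult[of q w] op_adj_mult[of w q]
    by (simp add: cornersD[OF c] cstar_algebra_adj[OF cstar_Q] p_adj q_adj)
  moreover have "\<beta> (L (inv g)) = op_adj (\<beta> (L g))"
    using \<beta>_adj[OF CG.basis_mem[OF assms(2)]] assms(2) by (simp add: lreg_adj)
  ultimately show ?thesis
    using assms unfolding component_def by (simp only: op_adj_add op_tensor_adj lreg_adj \<theta>_closed \<theta>_inv simp_thms)
qed

lemma component_one: "component \<one> p q"
proof -
  have bd: "bounded_op p" "bounded_op q" by (rule bounded_Q, rule p_mem, rule bounded_Q, rule q_mem)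
  have "p \<odot> (p + q) = p" "q \<odot> (p + q) = q" using pq_unit p_mem q_mem by (auto simp: is_unit_def)
  then have "p \<odot> p = p" "q \<odot> q = q" using bd pq by (simp_all add: op_mult_add_right)
  then have "corners p q" using p_mem q_mem by (simp add: corners_def)
  then show ?thesis by (simp add: component_def \<beta>_one \<theta>_one op_tensor_add_right)
qed

lemma component_exists: "g \<in> carrier G \<Longrightarrow> \<exists>v w. component g v w"
proof (induction rule: generator_induct)
  case (gen s)
  then show ?case using split unfolding component_def corners_def by meson
next
  case (mult g h)
  then show ?case using component_mult by blast
qed

text \<open>By uniqueness of the components, products and adjoints of components are again components,
  which makes \<open>v\<close> and \<open>z\<close> multiplicative.  The shift by \<open>\<theta>\<close> in \<open>z\<close> matches the index of \<open>Z\<close> in \<open>\<alpha>\<close>.\<close>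

definition v :: "'a \<Rightarrow> 'y matop" where "v g = (SOME v. \<exists>w. component g v w)"
definition z :: "'a \<Rightarrow> 'y matop" where "z g = (SOME w. \<exists>v. component (\<theta> g) v w)"

lemma component_v_z: "g \<in> carrier G \<Longrightarrow> component g (v g) (z (\<theta> g))"
proof -
  assume g: "g \<in> carrier G"
  obtain v0 w0 where c: "component g v0 w0" using component_exists[OF g] by blast
  have "v g = v0" unfolding v_def
    by (rule some_equality) (use c component_unique[OF _ c g] in blast)+
  moreover have "z (\<theta> g) = w0" unfolding z_def \<theta>_invol[OF g]
    by (rule some_equality) (use c component_unique[OF _ c g] in blast)+
  ultimately show ?thesis using c by simp
qed

lemma component_z: "g \<in> carrier G \<Longrightarrow> component (\<theta> g) (v (\<theta> g)) (z g)"
  using component_v_z[of "\<theta> g"] by (simp add: \<theta>_invol)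

lemma v_eqI: "component g v0 w0 \<Longrightarrow> g \<in> carrier G \<Longrightarrow> v g = v0"
  using component_unique component_v_z by blast

lemma z_eqI: "component (\<theta> g) v0 w0 \<Longrightarrow> g \<in> carrier G \<Longrightarrow> z g = w0"
  using component_unique component_z \<theta>_closed by blast

lemma v_mem: "g \<in> carrier G \<Longrightarrow> v g \<in> Q" and z_mem: "g \<in> carrier G \<Longrightarrow> z g \<in> Q"
  using component_v_z component_z cornersD unfolding component_def by blast+

lemma \<beta>_lreg: "g \<in> carrier G \<Longrightarrow> \<beta> (L g) = L g \<otimes>\<^sub>o v g + L (\<theta> g) \<otimes>\<^sub>o z (\<theta> g)"
  using component_v_z by (simp add: component_def)

lemma v_mult: "g \<in> carrier G \<Longrightarrow> h \<in> carrier G \<Longrightarrow> v g \<odot> v h = v (g \<otimes> h)"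
  by (rule sym, rule v_eqI, rule component_mult[OF component_v_z component_v_z]) auto

lemma z_mult: "g \<in> carrier G \<Longrightarrow> h \<in> carrier G \<Longrightarrow> z g \<odot> z h = z (g \<otimes> h)"
  by (rule sym, rule z_eqI, subst \<theta>_mult, assumption+, rule component_mult[OF component_z component_z]) auto

lemma v_adj: "g \<in> carrier G \<Longrightarrow> op_adj (v g) = v (inv g)"
  by (rule sym, rule v_eqI, rule component_inv[OF component_v_z]) auto

lemma z_adj: "g \<in> carrier G \<Longrightarrow> op_adj (z g) = z (inv g)"
  by (rule sym, rule z_eqI, subst \<theta>_inv, assumption+, rule component_inv[OF component_z]) auto

lemma v_one: "v \<one> = p" and z_one: "z \<one> = q"
  using v_eqI[OF component_one] z_eqI[of \<one> p q] component_one by (simp_all add: \<theta>_one)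

lemma v_z_mult: "v g \<odot> z h = 0" and z_v_mult: "z h \<odot> v g = 0"
  if "g \<in> carrier G" "h \<in> carrier G"
proof -
  have c: "corners (v g) (z (\<theta> g))" "corners (v (\<theta> h)) (z h)"
    using component_v_z[OF that(1)] component_z[OF that(2)] by (simp_all add: component_def)
  show "v g \<odot> z h = 0" by (rule corners_orthogonal(1)[OF c])
  show "z h \<odot> v g = 0" by (rule corners_orthogonal(2)[OF c(2,1)])
qed

lemma bounded_v: "g \<in> carrier G \<Longrightarrow> bounded_op (v g)" and bounded_z: "g \<in> carrier G \<Longrightarrow> bounded_op (z g)"
  by (rule bounded_Q, erule v_mem, rule bounded_Q, erule z_mem)

definition \<Phi> :: "('a + 'a) matop \<Rightarrow> 'y matop" where "\<Phi> = DG.ext (case_sum v z)"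

lemma \<Phi>_V: "g \<in> carrier G \<Longrightarrow> \<Phi> (V g) = v g" and \<Phi>_Z: "g \<in> carrier G \<Longrightarrow> \<Phi> (Z g) = z g"
  unfolding \<Phi>_def by (simp_all only: DG_ext_V DG_ext_Z sum.case)

lemma linear_\<Phi>: "linear_on_ops A \<Phi>"
  unfolding \<Phi>_def by (rule DG.linear_ext)

lemma bounded_\<Phi>_basis: "i \<in> carrier G <+> carrier G \<Longrightarrow> bounded_op (\<Phi> (case_sum V Z i))"
  by (elim PlusE) (simp_all add: \<Phi>_V \<Phi>_Z bounded_v bounded_z)

lemma star_hom_\<Phi>: "unital_star_hom DG.E Q \<Phi>"
  unfolding \<Phi>_def
proof (rule DG.unital_star_hom_ext)
  show "matop.subspace Q" by (rule subspace_cstar[OF cstar_Q])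
  fix i assume i: "i \<in> carrier G <+> carrier G"
  show "case_sum v z i \<in> Q" using i by (auto simp: v_mem z_mem)
  show "bounded_op (case_sum v z i)" using i by (auto simp: bounded_v bounded_z)
  show "op_adj (case_sum V Z i) \<in> DG.E \<and> DG.ext (case_sum v z) (op_adj (case_sum V Z i)) = op_adj (case_sum v z i)"
    using i by (elim PlusE) (simp_all add: V_adj Z_adj DG_ext_V DG_ext_Z V_mem Z_mem v_adj z_adj)
  fix j assume j: "j \<in> carrier G <+> carrier G"
  show "case_sum V Z i \<odot> case_sum V Z j \<in> DG.E
      \<and> DG.ext (case_sum v z) (case_sum V Z i \<odot> case_sum V Z j) = case_sum v z i \<odot> case_sum v z j"
    using i j by (elim PlusE) (simp_all add: V_mult Z_mult V_Z_mult Z_V_mult DG_ext_V DG_ext_Z V_mem Z_mem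
        v_mult z_mult v_z_mult z_v_mult DG.ext_zero matop.subspace_0[OF DG.subspace_E])
next
  show "DG.ext (case_sum v z) (unit_of DG.E) = unit_of Q"
    by (simp add: unit_of_eqI[OF is_unit_DG] unit_of_eqI[OF pq_unit] DG.ext_add DG_ext_V DG_ext_Z v_one z_one)
qed

text \<open>On generators the formula can be read off from the coaction identity by comparing
  coefficients, as \<open>\<theta>\<close> moves the generators; it extends to the group by multiplicativity.\<close>

lemma \<Gamma>_v_z:
  assumes "g \<in> carrier G"
  shows "\<Gamma> (v g) = v g \<otimes>\<^sub>o v g + z (\<theta> g) \<otimes>\<^sub>o z g \<and> \<Gamma> (z g) = v (\<theta> g) \<otimes>\<^sub>o z g + z g \<otimes>\<^sub>o v g"
  using assms
proof (induction rule: generator_induct)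
  case (gen s)
  obtain T1 T2 where T: "tensor_map CG.E Q \<beta> id T1" "tensor_map CG.E Q id (\<lambda>q. op_flip (\<Gamma> q)) T2"
    "\<And>a. a \<in> CG.E \<Longrightarrow> T1 (\<beta> a) = op_assoc (T2 (\<beta> a))"
    using action unfolding orientation_preserving_action_def cqg_action_def Cred_eq by blast
  have flip: "op_flip (\<Gamma> (v s)) = v s \<otimes>\<^sub>o v s + z s \<otimes>\<^sub>o z (\<theta> s)
      \<and> op_flip (\<Gamma> (z (\<theta> s))) = z (\<theta> s) \<otimes>\<^sub>o v s + v (\<theta> s) \<otimes>\<^sub>o z (\<theta> s)" if s: "s \<in> S" for s
  proof -
    have c: "s \<in> carrier G" "\<theta> s \<in> carrier G" using S_carrier[OF s] by auto
    have "T1 (\<beta> (L s)) = (L s \<otimes>\<^sub>o v s + L (\<theta> s) \<otimes>\<^sub>o z (\<theta> s)) \<otimes>\<^sub>o v s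
        + (L (\<theta> s) \<otimes>\<^sub>o v (\<theta> s) + L s \<otimes>\<^sub>o z s) \<otimes>\<^sub>o z (\<theta> s)"
      using c by (simp add: \<beta>_lreg \<theta>_invol tensor_map_add[OF T(1) cstar_algebra_CG cstar_Q]
          CG.basis_mem v_mem z_mem)
    also have "\<dots> = op_assoc (L s \<otimes>\<^sub>o (v s \<otimes>\<^sub>o v s + z s \<otimes>\<^sub>o z (\<theta> s))
        + L (\<theta> s) \<otimes>\<^sub>o (z (\<theta> s) \<otimes>\<^sub>o v s + v (\<theta> s) \<otimes>\<^sub>o z (\<theta> s)))"
      by (simp add: op_tensor_add_left op_tensor_add_right op_assoc_add op_assoc_tensor add_ac)
    finally have "T2 (\<beta> (L s)) = L s \<otimes>\<^sub>o (v s \<otimes>\<^sub>o v s + z s \<otimes>\<^sub>o z (\<theta> s))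
        + L (\<theta> s) \<otimes>\<^sub>o (z (\<theta> s) \<otimes>\<^sub>o v s + v (\<theta> s) \<otimes>\<^sub>o z (\<theta> s))"
      using T(3)[OF CG.basis_mem[OF c(1)]] by (simp only: op_assoc_inject)
    moreover have "T2 (\<beta> (L s)) = L s \<otimes>\<^sub>o op_flip (\<Gamma> (v s)) + L (\<theta> s) \<otimes>\<^sub>o op_flip (\<Gamma> (z (\<theta> s)))"
      using c by (simp add: \<beta>_lreg tensor_map_add[OF T(2) cstar_algebra_CG cstar_Q] CG.basis_mem v_mem z_mem)
    ultimately have eq: "L s \<otimes>\<^sub>o op_flip (\<Gamma> (v s)) + L (\<theta> s) \<otimes>\<^sub>o op_flip (\<Gamma> (z (\<theta> s)))
        = L s \<otimes>\<^sub>o (v s \<otimes>\<^sub>o v s + z s \<otimes>\<^sub>o z (\<theta> s))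
        + L (\<theta> s) \<otimes>\<^sub>o (z (\<theta> s) \<otimes>\<^sub>o v s + v (\<theta> s) \<otimes>\<^sub>o z (\<theta> s))" by simp
    have ne: "s \<noteq> \<theta> s" "\<theta> s \<noteq> s" using \<theta>_moves[OF s] by auto
    show ?thesis
      using arg_cong[OF eq, of "CG.slice s"] arg_cong[OF eq, of "CG.slice (\<theta> s)"] c ne
      by (simp only: CG.slice_add CG.slice_basis_tensor if_True if_False add_0_right add_0_left simp_thms)
  qed
  have "\<Gamma> (v s) = op_flip (v s \<otimes>\<^sub>o v s + z s \<otimes>\<^sub>o z (\<theta> s))"
    "\<Gamma> (z s) = op_flip (z s \<otimes>\<^sub>o v (\<theta> s) + v s \<otimes>\<^sub>o z s)"
    using flip[OF gen] flip[OF \<theta>_S[OF gen]] \<theta>_invol[OF S_carrier[OF gen]] op_flip_flip by metis+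
  then show ?case by (simp add: op_flip_add op_flip_tensor add.commute)
next
  case (mult g h)
  have \<Gamma>_mult: "\<Gamma> (a \<odot> b) = \<Gamma> a \<odot> \<Gamma> b" if "a \<in> Q" "b \<in> Q" for a b
    using \<Gamma>_hom that by (simp add: unital_star_hom_def)
  have "\<Gamma> (v (g \<otimes> h)) = (v g \<otimes>\<^sub>o v g + z (\<theta> g) \<otimes>\<^sub>o z g) \<odot> (v h \<otimes>\<^sub>o v h + z (\<theta> h) \<otimes>\<^sub>o z h)"
    unfolding mult.IH[THEN conjunct1, symmetric] v_mult[OF mult.hyps, symmetric]
    by (rule \<Gamma>_mult[OF v_mem[OF mult.hyps(1)] v_mem[OF mult.hyps(2)]])
  also have "\<dots> = v (g \<otimes> h) \<otimes>\<^sub>o v (g \<otimes> h) + z (\<theta> (g \<otimes> h)) \<otimes>\<^sub>o z (g \<otimes> h)"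
    using mult.hyps by (simp add: mult_simps bounded_v bounded_z v_mult z_mult v_z_mult z_v_mult \<theta>_mult)
  finally have "\<Gamma> (v (g \<otimes> h)) = v (g \<otimes> h) \<otimes>\<^sub>o v (g \<otimes> h) + z (\<theta> (g \<otimes> h)) \<otimes>\<^sub>o z (g \<otimes> h)" .
  moreover have "\<Gamma> (z (g \<otimes> h)) = (v (\<theta> g) \<otimes>\<^sub>o z g + z g \<otimes>\<^sub>o v g) \<odot> (v (\<theta> h) \<otimes>\<^sub>o z h + z h \<otimes>\<^sub>o v h)"
    unfolding mult.IH[THEN conjunct2, symmetric] z_mult[OF mult.hyps, symmetric]
    by (rule \<Gamma>_mult[OF z_mem[OF mult.hyps(1)] z_mem[OF mult.hyps(2)]])
  moreover have "\<dots> = v (\<theta> (g \<otimes> h)) \<otimes>\<^sub>o z (g \<otimes> h) + z (g \<otimes> h) \<otimes>\<^sub>o v (g \<otimes> h)"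
    using mult.hyps by (simp add: mult_simps bounded_v bounded_z v_mult z_mult v_z_mult z_v_mult \<theta>_mult)
  ultimately show ?case by (simp only: simp_thms)
qed

lemma morphism_\<Phi>: "orientation_preserving_morphism G DG.E \<Delta> \<alpha> Q \<Gamma> \<beta> \<Phi>"
  unfolding orientation_preserving_morphism_def cqg_morphism_def Cred_eq
proof (intro conjI)
  show "unital_star_hom DG.E Q \<Phi>" by (rule star_hom_\<Phi>)
  obtain T where T: "tensor_map DG.E DG.E \<Phi> \<Phi> T"
    using DD.tensor_map_pair[OF linear_\<Phi> bounded_\<Phi>_basis linear_\<Phi> bounded_\<Phi>_basis] by auto
  have "T (\<Delta> a) = \<Gamma> (\<Phi> a)" if "a \<in> DG.E" for a
  proof (rule DG.linear_eqI[OF _ _ _ that])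
    have "linear_on_ops (min_tensor DG.E DG.E) T" "linear_on_ops Q \<Gamma>"
      using T \<Gamma>_hom by (simp_all add: tensor_map_def unital_star_hom_def)
    moreover have "\<Phi> a \<in> Q" if "a \<in> DG.E" for a using star_hom_\<Phi> that by (simp add: unital_star_hom_def)
    ultimately show "linear_on_ops DG.E (\<lambda>a. T (\<Delta> a))" "linear_on_ops DG.E (\<lambda>a. \<Gamma> (\<Phi> a))"
      using linear_on_ops_comp[OF linear_\<Delta> \<Delta>_mem] linear_on_ops_comp[OF linear_\<Phi>, of _ Q \<Gamma>] by simp_all
    show "T (\<Delta> (case_sum V Z i)) = \<Gamma> (\<Phi> (case_sum V Z i))" if "i \<in> carrier G <+> carrier G" for i
      using that
      by (elim PlusE) (simp_all add: \<Delta>_V \<Delta>_Z \<Phi>_V \<Phi>_Z V_mem Z_mem \<Gamma>_v_z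
          tensor_map_add[OF T cstar_algebra_DG cstar_algebra_DG])
  qed
  then show "\<exists>T. tensor_map DG.E DG.E \<Phi> \<Phi> T \<and> (\<forall>a\<in>DG.E. T (\<Delta> a) = \<Gamma> (\<Phi> a))" using T by blast
  have id: "linear_on_ops CG.E id" by (simp add: linear_on_ops_def)
  obtain T' where T': "tensor_map CG.E DG.E id \<Phi> T'"
    using CD.tensor_map_pair[OF id _ linear_\<Phi> bounded_\<Phi>_basis] by auto
  have "T' (\<alpha> a) = \<beta> a" if "a \<in> CG.E" for a
  proof (rule CG.linear_eqI[OF _ linear_\<beta> _ that])
    have lin: "linear_on_ops (min_tensor CG.E DG.E) T'" using T' by (simp add: tensor_map_def)
    show "linear_on_ops CG.E (\<lambda>a. T' (\<alpha> a))"
      by (rule linear_on_ops_comp[OF linear_\<alpha> \<alpha>_mem lin])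
    show "T' (\<alpha> (L g)) = \<beta> (L g)" if "g \<in> carrier G" for g
      using that by (simp add: \<alpha>_lreg \<beta>_lreg \<Phi>_V \<Phi>_Z V_mem Z_mem CG.basis_mem
          tensor_map_add[OF T' cstar_algebra_CG cstar_algebra_DG])
  qed
  then show "\<exists>T. tensor_map CG.E DG.E id \<Phi> T \<and> (\<forall>a\<in>CG.E. T (\<alpha> a) = \<beta> a)" using T' by blast
qed

text \<open>The coefficients of the action on a generator \<open>s\<close> are the images of \<open>V s\<close> and \<open>Z (\<theta> s)\<close> under any
  morphism; they can be separated as \<open>\<theta>\<close> moves \<open>s\<close>, and all \<open>V s\<close> and \<open>Z s\<close> together generate the doubling.\<close>

lemma morphism_unique:
  assumes "orientation_preserving_morphism G DG.E \<Delta> \<alpha> Q \<Gamma> \<beta> \<Psi>" and a: "a \<in> DG.E"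
  shows "\<Psi> a = \<Phi> a"
proof -
  have \<Psi>: "unital_star_hom DG.E Q \<Psi>"
    using assms(1) by (simp add: orientation_preserving_morphism_def cqg_morphism_def)
  obtain T where T: "tensor_map CG.E DG.E id \<Psi> T" "\<And>a. a \<in> CG.E \<Longrightarrow> T (\<alpha> a) = \<beta> a"
    using assms(1) unfolding orientation_preserving_morphism_def Cred_eq by blast
  have gen: "\<Psi> (V s) = v s \<and> \<Psi> (Z (\<theta> s)) = z (\<theta> s)" if s: "s \<in> S" for s
  proof -
    have c: "s \<in> carrier G" "\<theta> s \<in> carrier G" using S_carrier[OF s] by auto
    have ne: "s \<noteq> \<theta> s" "\<theta> s \<noteq> s" using \<theta>_moves[OF s] by auto
    have eq: "L s \<otimes>\<^sub>o \<Psi> (V s) + L (\<theta> s) \<otimes>\<^sub>o \<Psi> (Z (\<theta> s)) = L s \<otimes>\<^sub>o v s + L (\<theta> s) \<otimes>\<^sub>o z (\<theta> s)"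
      using T(2)[OF CG.basis_mem[OF c(1)]] c
      by (simp add: \<alpha>_lreg \<beta>_lreg V_mem Z_mem CG.basis_mem
          tensor_map_add[OF T(1) cstar_algebra_CG cstar_algebra_DG])
    show ?thesis
      using arg_cong[OF eq, of "CG.slice s"] arg_cong[OF eq, of "CG.slice (\<theta> s)"] c ne
      by (simp only: CG.slice_add CG.slice_basis_tensor if_True if_False add_0_right add_0_left simp_thms)
  qed
  show ?thesis
  proof (rule eq_on_DG_if_eq_on_generators[OF _ _ _ _ _ _ a])
    show "\<Psi> (V s) = \<Phi> (V s)" "\<Psi> (Z s) = \<Phi> (Z s)" if "s \<in> S" for s
      using gen[OF that] gen[OF \<theta>_S[OF that]] S_carrier[OF that] by (simp_all add: \<Phi>_V \<Phi>_Z \<theta>_invol)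
  qed (use \<Psi> star_hom_\<Phi> in \<open>auto simp: unital_star_hom_def\<close>)
qed

end

section \<open>Generators and the length grading\<close>

context generated_doubling
begin

lemma one_notin_S: "\<one> \<notin> S"
  using \<theta>_moves \<theta>_one by blast

text \<open>The generators are exactly the elements of length one, because the unit is not among them.\<close>

lemma word_length_generator_iff:
  assumes s: "s \<in> S" and g: "g \<in> carrier G"
  shows "word_length G S g = word_length G S s \<longleftrightarrow> g \<in> S"
proof -
  let ?P = "\<lambda>g n. \<exists>ws. set ws \<subseteq> S \<and> length ws = n \<and> foldr (\<otimes>) ws \<one> = g"
  have wl: "word_length G S g = (LEAST n. ?P g n)" for g by (simp add: word_length_def)
  have P1: "?P s 1" if "s \<in> S" for s using that S_carrier[OF that] by (intro exI[of _ "[s]"]) simp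
  have P0: "?P g 0 \<longleftrightarrow> g = \<one>" for g by auto
  have one: "word_length G S s = 1" if "s \<in> S" for s
    unfolding wl
  proof (rule Least_equality)
    show "?P s 1" by (rule P1[OF that])
    show "1 \<le> n" if "?P s n" for n
      using that P0[of s] one_notin_S \<open>s \<in> S\<close> by (cases n) auto
  qed
  have "g \<in> S" if wl1: "word_length G S g = 1"
  proof -
    obtain ws0 where "set ws0 \<subseteq> S" "foldr (\<otimes>) ws0 \<one> = g" using S_generates[OF g] by auto
    then have "?P g (length ws0)" by auto
    then have "\<exists>n. ?P g n" ..
    then have "?P g (word_length G S g)" unfolding wl by (rule LeastI_ex)
    then obtain ws where ws: "set ws \<subseteq> S" "length ws = 1" "foldr (\<otimes>) ws \<one> = g"
      unfolding wl1 by blast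
    then obtain x where "ws = [x]" by (cases ws) auto
    then show ?thesis using ws S_carrier by auto
  qed
  then show ?thesis using one[OF s] one by auto
qed

lemma action_on_generator:
  assumes "orientation_preserving_action G S Q \<Gamma> \<beta>" and s: "s \<in> S"
  shows "\<exists>x. (\<forall>h\<in>S. x h \<in> Q) \<and> \<beta> (L s) = (\<Sum>h\<in>S. L h \<otimes>\<^sub>o x h)"
proof -
  interpret S: coordinate_basis S L "\<lambda>g. (g, \<one>)"
    using coordinate_basis_subset[OF CG.coordinate_basis_axioms S_closed] .
  have "{L h |h. h \<in> carrier G \<and> word_length G S h = word_length G S s} = L ` S"
    using word_length_generator_iff[OF s] S_closed by auto
  moreover have "\<beta> (L s) \<in> alg_tensor
      (lin_span {L h |h. h \<in> carrier G \<and> word_length G S h = word_length G S s}) Q"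
    using assms(1) S_carrier[OF s] unfolding orientation_preserving_action_def by blast
  ultimately have mem: "\<beta> (L s) \<in> alg_tensor S.E Q" by (simp only: S.E_def)
  have Q: "matop.subspace Q"
    by (rule subspace_cstar)
      (use assms(1) in \<open>simp add: orientation_preserving_action_def compact_quantum_group_def unital_cstar_algebra_def\<close>)
  show ?thesis
    using S.alg_tensor_expansion[OF Q mem] by (intro exI[of _ "\<lambda>h. S.slice h (\<beta> (L s))"]) blast
qed

lemma trace_of_action:
  assumes "orientation_preserving_action G S Q \<Gamma> \<beta>" "g \<in> carrier G" "g \<noteq> \<one>"
  shows "CG.slice \<one> (\<beta> (L g)) = 0"
proof -
  have "gtrace_slice G (\<beta> (L g)) = gtrace G (L g) *\<^sub>o unit_of Q"
    using assms(1) CG.basis_mem[OF assms(2)] unfolding orientation_preserving_action_def Cred_eq by blast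
  moreover have "gtrace G (L g) = 0" using assms(2,3) by (simp add: gtrace_def lreg_entry_one)
  ultimately show ?thesis by (simp add: gtrace_slice_def CG.slice_def)
qed

end


section \<open>The symmetric group on three letters\<close>

abbreviation \<sigma> :: "nat \<Rightarrow> nat" where "\<sigma> \<equiv> Transposition.transpose 1 2"
abbreviation \<tau> :: "nat \<Rightarrow> nat" where "\<tau> \<equiv> Transposition.transpose 2 3"

definition swap_ends :: "(nat \<Rightarrow> nat) \<Rightarrow> (nat \<Rightarrow> nat)" where
  "swap_ends g = Transposition.transpose 1 3 \<circ> g \<circ> Transposition.transpose 1 3"

lemma transpose_13: "Transposition.transpose 1 3 = \<sigma> \<circ> \<tau> \<circ> (\<sigma> :: nat \<Rightarrow> nat)"
  by (auto simp: fun_eq_iff Transposition.transpose_def)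

lemma swap_ends_generators: "swap_ends \<sigma> = \<tau>" "swap_ends \<tau> = \<sigma>"
  by (auto simp: fun_eq_iff Transposition.transpose_def swap_ends_def)

lemma foldr_comp_Cons: "foldr (\<circ>) (f # fs) id = f \<circ> foldr (\<circ>) fs id"
  by (subst foldr_Cons) (rule comp_apply)

text \<open>Every permutation is a product of transpositions, and \<open>(1 3) = \<sigma> \<tau> \<sigma>\<close>.\<close>

lemma S3_words:
  assumes "g permutes {1..3::nat}"
  shows "\<exists>ws. set ws \<subseteq> {\<sigma>, \<tau>} \<and> foldr (\<circ>) ws id = g"
  using assms finite_atLeastAtMost
proof (induction rule: permutes_induct)
  case id
  then show ?case by (intro exI[of _ "[]"]) simp
next
  case (swap a b g)
  then obtain ws where ws: "set ws \<subseteq> {\<sigma>, \<tau>}" "foldr (\<circ>) ws id = g" by blast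
  have "a \<in> {1, 2, 3}" "b \<in> {1, 2, 3}" using swap by auto
  then consider "Transposition.transpose a b = \<sigma>" | "Transposition.transpose a b = \<tau>"
    | "Transposition.transpose a b = \<sigma> \<circ> \<tau> \<circ> \<sigma>"
    using swap(3) unfolding transpose_13[symmetric] by (auto simp: Transposition.transpose_commute)
  then show ?case
  proof cases
    case 1
    show ?thesis
      unfolding 1 ws(2)[symmetric] foldr_comp_Cons[symmetric]
      by (intro exI[of _ "\<sigma> # ws"] conjI refl) (use ws(1) in simp)
  next
    case 2
    show ?thesis
      unfolding 2 ws(2)[symmetric] foldr_comp_Cons[symmetric]
      by (intro exI[of _ "\<tau> # ws"] conjI refl) (use ws(1) in simp)
  next
    case 3
    show ?thesis
      unfolding 3 ws(2)[symmetric]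
      by (intro exI[of _ "\<sigma> # \<tau> # \<sigma> # ws"] conjI)
        (use ws(1) in simp, simp only: foldr_comp_Cons comp_assoc)
  qed
qed

interpretation S3: generated_doubling "sym_group 3" swap_ends "{\<sigma>, \<tau>}"
proof -
  interpret group "sym_group 3" by (rule sym_group_is_group)
  have c13: "Transposition.transpose 1 3 permutes {1..3::nat}"
    and c: "\<sigma> permutes {1..3::nat}" "\<tau> permutes {1..3::nat}"
    by (auto intro!: permutes_swap_id)
  have gen: "\<sigma> \<in> carrier (sym_group 3)" "\<tau> \<in> carrier (sym_group 3)"
    using c by (simp_all add: sym_group_carrier)
  have inv: "inv\<^bsub>sym_group 3\<^esub> \<sigma> = \<sigma>" "inv\<^bsub>sym_group 3\<^esub> \<tau> = \<tau>"
    using gen by (auto intro!: inv_equality simp: sym_group_mult sym_group_one)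
  show "generated_doubling (sym_group 3) swap_ends {\<sigma>, \<tau>}"
  proof unfold_locales
    show "finite (carrier (sym_group 3))"
      using finite_permutations[of "{1..3::nat}"] by (simp add: sym_group_def)
    show "swap_ends \<in> hom (sym_group 3) (sym_group 3)"
    proof (rule homI)
      show "swap_ends g \<in> carrier (sym_group 3)" if "g \<in> carrier (sym_group 3)" for g
        using that c13 unfolding swap_ends_def sym_group_carrier by (intro permutes_compose)
      show "swap_ends (g \<otimes>\<^bsub>sym_group 3\<^esub> h) = swap_ends g \<otimes>\<^bsub>sym_group 3\<^esub> swap_ends h" for g h
        by (simp add: swap_ends_def sym_group_mult fun_eq_iff)
    qed
    show "swap_ends (swap_ends g) = g" for g
      by (simp add: swap_ends_def fun_eq_iff)
    show "\<exists>ws. set ws \<subseteq> {\<sigma>, \<tau>} \<and> foldr (\<otimes>\<^bsub>sym_group 3\<^esub>) ws \<one>\<^bsub>sym_group 3\<^esub> = g"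
      if "g \<in> carrier (sym_group 3)" for g
      using S3_words that by (simp add: sym_group_carrier sym_group_mult sym_group_one)
    have "\<sigma> \<noteq> (\<tau> :: nat \<Rightarrow> nat)"
      by (rule notI, drule fun_cong[of _ _ 1]) (simp add: Transposition.transpose_def)
    then show "swap_ends s \<noteq> s" if "s \<in> {\<sigma>, \<tau>}" for s
      using that swap_ends_generators by auto
  qed (use gen inv swap_ends_generators in auto)
qed

text \<open>Both terms of \<open>A C = (A\<^sup>2 + B\<^sup>2) A C\<close> vanish, since \<open>A (A C) = A (A C + B D) = 0\<close> and \<open>B A = 0\<close>.\<close>

lemma product_zero:
  assumes Q: "cstar_algebra Q" and mem: "A \<in> Q" "B \<in> Q" "C \<in> Q" "D \<in> Q" and unit: "is_unit Q u"
    and AB: "A \<odot> B = 0" "B \<odot> A = 0" and sq: "A \<odot> A + B \<odot> B = u"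
    and tr: "A \<odot> C + B \<odot> D = 0"
  shows "A \<odot> C = 0" "B \<odot> D = 0"
proof -
  note bd = mem[THEN cstar_algebra_bounded[OF Q]]
  note cl = cstar_algebra_mult[OF Q]
  have "A \<odot> (A \<odot> C + B \<odot> D) = A \<odot> (A \<odot> C)"
    using bd AB by (simp only: op_mult_add_right bounded_op_mult op_mult_assoc[symmetric, of A B D]) simp
  then have A: "A \<odot> (A \<odot> C) = 0" using tr by simp
  have B: "B \<odot> (A \<odot> C) = 0" using bd AB by (simp only: op_mult_assoc[symmetric]) simp
  have "A \<odot> C = (A \<odot> A + B \<odot> B) \<odot> (A \<odot> C)"
    using unit cl[OF mem(1,3)] sq by (simp add: is_unit_def)
  also have "\<dots> = A \<odot> (A \<odot> (A \<odot> C)) + B \<odot> (B \<odot> (A \<odot> C))"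
    using bd by (simp only: op_mult_add_left bounded_op_mult op_mult_assoc)
  also have "\<dots> = 0" by (simp add: A B)
  finally show "A \<odot> C = 0" .
  then show "B \<odot> D = 0" using tr by simp
qed

text \<open>The four products of the generators are \<open>1\<close>, \<open>\<sigma> \<tau>\<close>, \<open>\<tau> \<sigma>\<close> and again \<open>1\<close>, and the first three are
  distinct; so the coefficients of a product of two images of generators can be read off.\<close>

lemma S3_product_slices:
  assumes "bounded_op a" "bounded_op b" "bounded_op c" "bounded_op d"
  defines "u \<equiv> (lreg S3 \<sigma> \<otimes>\<^sub>o a + lreg S3 \<tau> \<otimes>\<^sub>o b) \<odot> (lreg S3 \<sigma> \<otimes>\<^sub>o c + lreg S3 \<tau> \<otimes>\<^sub>o d)"
  shows "S3.CG.slice id u = a \<odot> c + b \<odot> d" "S3.CG.slice (\<sigma> \<circ> \<tau>) u = a \<odot> d" "S3.CG.slice (\<tau> \<circ> \<sigma>) u = b \<odot> c"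
proof -
  have mem: "\<sigma> \<in> carrier S3" "\<tau> \<in> carrier S3" "id \<in> carrier S3" "\<sigma> \<circ> \<tau> \<in> carrier S3" "\<tau> \<circ> \<sigma> \<in> carrier S3"
    using S3.S_carrier[of \<sigma>] S3.S_carrier[of \<tau>] S3.one_closed S3.m_closed[of \<sigma> \<tau>] S3.m_closed[of \<tau> \<sigma>]
    by (simp_all add: sym_group_mult sym_group_one)
  have ne: "\<sigma> \<circ> \<tau> \<noteq> id" "\<tau> \<circ> \<sigma> \<noteq> id" "\<sigma> \<circ> \<tau> \<noteq> (\<tau> \<circ> \<sigma> :: nat \<Rightarrow> nat)"
    by (auto dest!: fun_cong[of _ _ 1] simp: Transposition.transpose_def)
  have "u = lreg S3 id \<otimes>\<^sub>o (a \<odot> c) + lreg S3 id \<otimes>\<^sub>o (b \<odot> d)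
      + lreg S3 (\<sigma> \<circ> \<tau>) \<otimes>\<^sub>o (a \<odot> d) + lreg S3 (\<tau> \<circ> \<sigma>) \<otimes>\<^sub>o (b \<odot> c)"
    using assms(1-4) S3.lreg_mult[OF mem(1,1)] S3.lreg_mult[OF mem(1,2)] S3.lreg_mult[OF mem(2,1)] S3.lreg_mult[OF mem(2,2)]
    unfolding u_def sym_group_mult
    by (simp add: op_mult_add_left op_mult_add_right op_tensor_mult bounded_op_tensor bounded_op_add add_ac)
  then show "S3.CG.slice id u = a \<odot> c + b \<odot> d" "S3.CG.slice (\<sigma> \<circ> \<tau>) u = a \<odot> d" "S3.CG.slice (\<tau> \<circ> \<sigma>) u = b \<odot> c"
    using ne ne[symmetric] mem
    by (simp_all only: S3.CG.slice_add S3.CG.slice_basis_tensor if_True if_False simp_thms add_0_left add_0_right)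
qed

text \<open>Preservation of the length yields coefficients \<open>A, B, C, D\<close> with
  \<open>\<beta> (\<lambda>\<^sub>\<sigma>) = \<lambda>\<^sub>\<sigma> \<otimes> A + \<lambda>\<^sub>\<tau> \<otimes> B\<close> and \<open>\<beta> (\<lambda>\<^sub>\<tau>) = \<lambda>\<^sub>\<sigma> \<otimes> C + \<lambda>\<^sub>\<tau> \<otimes> D\<close>, which are self-adjoint since
  \<open>\<sigma>\<close> and \<open>\<tau>\<close> are involutions.  Their squares give \<open>A\<^sup>2 + B\<^sup>2 = 1 = C\<^sup>2 + D\<^sup>2\<close> and
  \<open>A B = B A = C D = D C = 0\<close>, and preservation of the trace for \<open>\<sigma> \<tau>\<close> and \<open>\<tau> \<sigma>\<close> gives
  \<open>A C + B D = 0 = C A + D B\<close>.  Hence \<open>A\<close> and \<open>D\<close> are both orthogonal to \<open>B\<close> and \<open>C\<close>, and the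
  projections are \<open>p = A\<^sup>2 = D\<^sup>2\<close> and \<open>q = B\<^sup>2 = C\<^sup>2\<close>.\<close>

lemma S3_splitting:
  fixes Q :: "'y matop set"
  assumes act: "orientation_preserving_action S3 {\<sigma>, \<tau>} Q \<Gamma> \<beta>"
  shows "\<exists>p q. splitting S3 swap_ends {\<sigma>, \<tau>} Q \<Gamma> \<beta> p q"
proof -
  let ?L = "lreg S3"
  have Q: "unital_cstar_algebra Q" and hom: "unital_star_hom S3.CG.E (min_tensor S3.CG.E Q) \<beta>"
    using act by (simp_all add: orientation_preserving_action_def compact_quantum_group_def cqg_action_def S3.Cred_eq)
  have Q': "cstar_algebra Q" using Q by (simp add: unital_cstar_algebra_def)
  define u where "u = unit_of Q"
  have u: "is_unit Q u" unfolding u_def by (rule is_unit_unit_of[OF Q])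
  have gen: "\<sigma> \<in> carrier S3" "\<tau> \<in> carrier S3" using S3.S_carrier by simp_all
  have ne: "\<sigma> \<noteq> \<tau>" "\<tau> \<noteq> \<sigma>" using S3.\<theta>_moves[of \<sigma>] swap_ends_generators by auto
  have "\<exists>a b. a \<in> Q \<and> b \<in> Q \<and> \<beta> (?L g) = ?L \<sigma> \<otimes>\<^sub>o a + ?L \<tau> \<otimes>\<^sub>o b" if "g \<in> {\<sigma>, \<tau>}" for g
    using S3.action_on_generator[OF act that] ne by auto
  then obtain A B C D where mem: "A \<in> Q" "B \<in> Q" "C \<in> Q" "D \<in> Q"
    and \<beta>_s: "\<beta> (?L \<sigma>) = ?L \<sigma> \<otimes>\<^sub>o A + ?L \<tau> \<otimes>\<^sub>o B" and \<beta>_t: "\<beta> (?L \<tau>) = ?L \<sigma> \<otimes>\<^sub>o C + ?L \<tau> \<otimes>\<^sub>o D"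
    by (metis insertI1 insertI2)
  note bd = mem[THEN cstar_algebra_bounded[OF Q']]
  note cl = cstar_algebra_mult[OF Q']
  have mult: "\<beta> (?L (g \<circ> h)) = \<beta> (?L g) \<odot> \<beta> (?L h)" if "g \<in> carrier S3" "h \<in> carrier S3" for g h
  proof -
    have "\<beta> (?L g \<odot> ?L h) = \<beta> (?L g) \<odot> \<beta> (?L h)"
      using hom S3.CG.basis_mem[OF that(1)] S3.CG.basis_mem[OF that(2)] by (simp add: unital_star_hom_def)
    then show ?thesis by (simp only: S3.lreg_mult[OF that] sym_group_mult)
  qed
  have self_adj: "op_adj a = a \<and> op_adj b = b"
    if g: "g \<in> {\<sigma>, \<tau>}" and eq: "\<beta> (?L g) = ?L \<sigma> \<otimes>\<^sub>o a + ?L \<tau> \<otimes>\<^sub>o b" for g a b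
  proof -
    have inv: "inv\<^bsub>S3\<^esub> h = h" if "h \<in> {\<sigma>, \<tau>}" for h
      using that S3.S_carrier[OF that] by (intro S3.inv_equality) (auto simp: sym_group_mult sym_group_one)
    have adj: "op_adj (?L h) = ?L h" if "h \<in> {\<sigma>, \<tau>}" for h
      using S3.lreg_adj[OF S3.S_carrier[OF that]] inv[OF that] by simp
    have "\<beta> (op_adj (?L g)) = op_adj (\<beta> (?L g))"
      using hom S3.CG.basis_mem[OF S3.S_carrier[OF g]] by (simp add: unital_star_hom_def)
    then have "?L \<sigma> \<otimes>\<^sub>o a + ?L \<tau> \<otimes>\<^sub>o b = ?L \<sigma> \<otimes>\<^sub>o op_adj a + ?L \<tau> \<otimes>\<^sub>o op_adj b"
      using adj[OF g] adj[of \<sigma>] adj[of \<tau>] by (simp only: eq op_adj_add op_tensor_adj insertI1 insertI2 simp_thms)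
    from arg_cong[OF this, of "S3.CG.slice \<sigma>"] arg_cong[OF this, of "S3.CG.slice \<tau>"]
    show ?thesis
      using gen ne by (simp only: S3.CG.slice_add S3.CG.slice_basis_tensor if_True if_False simp_thms add_0_left add_0_right)
  qed
  have adj: "op_adj A = A" "op_adj B = B" "op_adj C = C" "op_adj D = D"
    using self_adj[OF _ \<beta>_s] self_adj[OF _ \<beta>_t] by auto
  have id: "id \<in> carrier S3" "\<sigma> \<circ> \<tau> \<in> carrier S3" "\<tau> \<circ> \<sigma> \<in> carrier S3"
    using S3.one_closed S3.m_closed[OF gen] S3.m_closed[OF gen(2,1)] by (simp_all add: sym_group_mult sym_group_one)
  have ne3: "\<sigma> \<circ> \<tau> \<noteq> id" "\<tau> \<circ> \<sigma> \<noteq> (id :: nat \<Rightarrow> nat)"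
    by (auto dest!: fun_cong[of _ _ 1] simp: Transposition.transpose_def)
  have "is_unit (min_tensor S3.CG.E Q) (?L \<one>\<^bsub>S3\<^esub> \<otimes>\<^sub>o u)"
    by (rule S3.CG.is_unit_min_tensor[OF Q' S3.cstar_algebra_CG S3.is_unit_CG u])
  then have \<beta>_id: "\<beta> (?L id) = ?L id \<otimes>\<^sub>o u"
    using hom unit_of_eqI[OF S3.is_unit_CG] by (simp add: unit_of_eqI unital_star_hom_def sym_group_one)
  have sq: "a \<odot> a + b \<odot> b = u \<and> a \<odot> b = 0 \<and> b \<odot> a = 0"
    if g: "g \<in> {\<sigma>, \<tau>}" and eq: "\<beta> (?L g) = ?L \<sigma> \<otimes>\<^sub>o a + ?L \<tau> \<otimes>\<^sub>o b" and ab: "a \<in> Q" "b \<in> Q" for g a b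
  proof -
    note bd = ab[THEN cstar_algebra_bounded[OF Q']]
    have "g \<circ> g = id" using g by auto
    then have "?L id \<otimes>\<^sub>o u = (?L \<sigma> \<otimes>\<^sub>o a + ?L \<tau> \<otimes>\<^sub>o b) \<odot> (?L \<sigma> \<otimes>\<^sub>o a + ?L \<tau> \<otimes>\<^sub>o b)"
      using mult[OF S3.S_carrier[OF g] S3.S_carrier[OF g]] \<beta>_id eq by (simp only:)
    from S3_product_slices[OF bd bd, folded this]
    show ?thesis using id ne3
      by (simp only: S3.CG.slice_basis_tensor if_True if_False simp_thms)
  qed
  have AB: "A \<odot> A + B \<odot> B = u" "A \<odot> B = 0" "B \<odot> A = 0"
    and CD: "C \<odot> C + D \<odot> D = u" "C \<odot> D = 0" "D \<odot> C = 0"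
    using sq[OF _ \<beta>_s mem(1,2)] sq[OF _ \<beta>_t mem(3,4)] by auto
  have one: "\<one>\<^bsub>S3\<^esub> = id" by (rule sym_group_one)
  have tr: "A \<odot> C + B \<odot> D = 0" "C \<odot> A + D \<odot> B = 0"
    using S3_product_slices(1)[OF bd] S3_product_slices(1)[OF bd(3,4,1,2)]
      S3.trace_of_action[OF act id(2)] S3.trace_of_action[OF act id(3)] mult[OF gen] mult[OF gen(2,1)] ne3
    unfolding one \<beta>_s \<beta>_t by simp_all
  have AC: "A \<odot> C = 0" "B \<odot> D = 0"
    by (rule product_zero[OF Q' mem u AB(2,3,1) tr(1)])+
  have CA: "C \<odot> A = 0" "D \<odot> B = 0"
    by (rule product_zero[OF Q' mem(3,4,1,2) u CD(2,3,1) tr(2)])+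
  have unit: "u \<odot> x = x" "x \<odot> u = x" if "x \<in> Q" for x using u that by (auto simp: is_unit_def)
  have kill: "(x \<odot> x) \<odot> y = 0" "y \<odot> (x \<odot> x) = 0" if "x \<odot> y = 0" "y \<odot> x = 0" "x \<in> Q" "y \<in> Q" for x y
    using that op_mult_assoc[of x x y] op_mult_assoc[of y x x] cstar_algebra_bounded[OF Q'] by simp_all
  note bd2 = bounded_op_mult[OF bd(1,1)] bounded_op_mult[OF bd(2,2)] bounded_op_mult[OF bd(3,3)] bounded_op_mult[OF bd(4,4)]
  note kills = kill[OF AB(2,3) mem(1,2)] kill[OF AB(3,2) mem(2,1)] kill[OF CD(2,3) mem(3,4)] kill[OF CD(3,2) mem(4,3)]
    kill[OF AC(1) CA(1) mem(1,3)] kill[OF CA(1) AC(1) mem(3,1)] kill[OF AC(2) CA(2) mem(2,4)] kill[OF CA(2) AC(2) mem(4,2)]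
  have cross: "(A \<odot> A) \<odot> (C \<odot> C) = 0" "(B \<odot> B) \<odot> (D \<odot> D) = 0" "(A \<odot> A) \<odot> (B \<odot> B) = 0" "(B \<odot> B) \<odot> (A \<odot> A) = 0"
    using op_mult_assoc[OF bd2(1) bd(3,3)] op_mult_assoc[OF bd2(2) bd(4,4)]
      op_mult_assoc[OF bd2(1) bd(2,2)] op_mult_assoc[OF bd2(2) bd(1,1)] by (simp_all add: kills)
  \<comment> \<open>Both sides agree with \<open>A\<^sup>2 D\<^sup>2\<close>, as \<open>A\<^sup>2 C\<^sup>2 = 0\<close> and \<open>B\<^sup>2 D\<^sup>2 = 0\<close>.\<close>
  have "A \<odot> A = (A \<odot> A) \<odot> (C \<odot> C + D \<odot> D)" using unit cl mem CD by simp
  also have "\<dots> = (A \<odot> A + B \<odot> B) \<odot> (D \<odot> D)"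
    using bd2 cross by (simp only: op_mult_add_left op_mult_add_right add_0_left add_0_right)
  also have "\<dots> = D \<odot> D" using unit cl mem AB by simp
  finally have p_eq: "A \<odot> A = D \<odot> D" .
  then have q_eq: "B \<odot> B = C \<odot> C" using AB(1) CD(1) by (metis add.commute add_left_imp_eq)
  \<comment> \<open>\<open>A = (A\<^sup>2 + B\<^sup>2) A = A\<^sup>2 A\<close>, and likewise for the others.\<close>
  have cube: "(A \<odot> A) \<odot> A = A" "A \<odot> (A \<odot> A) = A" "(B \<odot> B) \<odot> B = B" "B \<odot> (B \<odot> B) = B"
    "(C \<odot> C) \<odot> C = C" "C \<odot> (C \<odot> C) = C" "(D \<odot> D) \<odot> D = D" "D \<odot> (D \<odot> D) = D"
    using unit[OF mem(1)] unit[OF mem(2)] unit[OF mem(3)] unit[OF mem(4)] bd bd2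
    unfolding AB(1)[symmetric]
    by (simp_all add: op_mult_add_left op_mult_add_right kills q_eq p_eq[symmetric])
  have "splitting S3 swap_ends {\<sigma>, \<tau>} Q \<Gamma> \<beta> (A \<odot> A) (B \<odot> B)"
  proof
    show "orientation_preserving_action S3 {\<sigma>, \<tau>} Q \<Gamma> \<beta>" by (rule act)
    show "A \<odot> A \<in> Q" "B \<odot> B \<in> Q" using cl mem by auto
    show "is_unit Q (A \<odot> A + B \<odot> B)" using u AB(1) by simp
    show "(A \<odot> A) \<odot> (B \<odot> B) = 0" "(B \<odot> B) \<odot> (A \<odot> A) = 0" by (rule cross)+
    show "op_adj (A \<odot> A) = A \<odot> A" "op_adj (B \<odot> B) = B \<odot> B" by (simp_all add: op_adj_mult adj)
    fix g assume "g \<in> {\<sigma>, \<tau>}"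
    then consider "g = \<sigma>" | "g = \<tau>" by auto
    then show "\<exists>v w. v \<in> Q \<and> w \<in> Q \<and> (A \<odot> A) \<odot> v = v \<and> v \<odot> (A \<odot> A) = v \<and> (B \<odot> B) \<odot> w = w \<and> w \<odot> (B \<odot> B) = w
        \<and> \<beta> (?L g) = ?L g \<otimes>\<^sub>o v + ?L (swap_ends g) \<otimes>\<^sub>o w"
    proof cases
      case 1
      then show ?thesis using mem cube \<beta>_s swap_ends_generators by (intro exI[of _ A] exI[of _ B]) simp
    next
      case 2
      have "\<beta> (?L \<tau>) = ?L \<tau> \<otimes>\<^sub>o D + ?L \<sigma> \<otimes>\<^sub>o C" unfolding \<beta>_t by (rule add.commute)
      then show ?thesis using 2 mem cube p_eq q_eq swap_ends_generators by (intro exI[of _ D] exI[of _ C]) simp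
    qed
  qed
  then show ?thesis by blast
qed

theorem theorem4p2:
  fixes s t :: "nat \<Rightarrow> nat"
    and A B C D :: "((nat \<Rightarrow> nat) + (nat \<Rightarrow> nat)) matop"
    and Q :: "((nat \<Rightarrow> nat) + (nat \<Rightarrow> nat)) matop set"
    and U :: "nat \<Rightarrow> nat \<Rightarrow> ((nat \<Rightarrow> nat) + (nat \<Rightarrow> nat)) matop"
  assumes "s = Transposition.transpose 1 2"
    and "t = Transposition.transpose 2 3"
    and "Q = cstar_dsum CS3 CS3"
    and "A = lreg S3 s \<oplus>\<^sub>o 0" and "B = 0 \<oplus>\<^sub>o lreg S3 t"
    and "C = 0 \<oplus>\<^sub>o lreg S3 s" and "D = lreg S3 t \<oplus>\<^sub>o 0"
    and "U = (\<lambda>i j. [[A, B], [C, D]] ! i ! j)"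
  shows "\<exists>\<Delta> \<alpha>.
      is_QISO TYPE('y) S3 {s, t} Q \<Delta> \<alpha>
    \<and> \<alpha> (lreg S3 s) = lreg S3 s \<otimes>\<^sub>o A + lreg S3 t \<otimes>\<^sub>o B
    \<and> \<alpha> (lreg S3 t) = lreg S3 s \<otimes>\<^sub>o C + lreg S3 t \<otimes>\<^sub>o D
    \<and> fundamental_corepresentation 2 Q \<Delta> U
    \<and> (\<forall>\<alpha>'. unital_star_hom CS3 (min_tensor CS3 Q) \<alpha>'
          \<and> \<alpha>' (lreg S3 s) = lreg S3 s \<otimes>\<^sub>o A + lreg S3 t \<otimes>\<^sub>o B
          \<and> \<alpha>' (lreg S3 t) = lreg S3 s \<otimes>\<^sub>o C + lreg S3 t \<otimes>\<^sub>o D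
          \<longrightarrow> (\<forall>a\<in>CS3. \<alpha>' a = \<alpha> a))
    \<and> (\<forall>\<Delta>'. unital_star_hom Q (min_tensor Q Q) \<Delta>'
          \<and> fundamental_corepresentation 2 Q \<Delta>' U
          \<longrightarrow> (\<forall>q\<in>Q. \<Delta>' q = \<Delta> q))"
proof -
  have s: "s = \<sigma>" and t: "t = \<tau>" by fact+
  have Q: "Q = S3.DG.E" using assms(3) S3.DG_eq by simp
  have ABCD: "A = S3.V \<sigma>" "B = S3.Z \<tau>" "C = S3.Z \<sigma>" "D = S3.V \<tau>"
    unfolding assms(1,2,4-7) S3.V_def S3.Z_def by (rule refl)+
  have U: "U 0 0 = A" "U 0 (Suc 0) = B" "U (Suc 0) 0 = C" "U (Suc 0) (Suc 0) = D"
    by (simp_all add: assms(8))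
  have lt2: "i < 2 \<longleftrightarrow> i = 0 \<or> i = Suc 0" for i :: nat by auto
  have sum2: "(\<Sum>k<2. f k) = f 0 + f (Suc 0)" for f :: "nat \<Rightarrow> 'b::comm_monoid_add"
    by (simp add: numeral_2_eq_2)
  have gen: "\<sigma> \<in> carrier S3" "\<tau> \<in> carrier S3" using S3.S_carrier by simp_all
  have sq: "\<sigma> \<otimes>\<^bsub>S3\<^esub> \<sigma> = \<one>\<^bsub>S3\<^esub>" "\<tau> \<otimes>\<^bsub>S3\<^esub> \<tau> = \<one>\<^bsub>S3\<^esub>"
    by (simp_all add: sym_group_mult sym_group_one)
  have inv: "inv\<^bsub>S3\<^esub> \<sigma> = \<sigma>" "inv\<^bsub>S3\<^esub> \<tau> = \<tau>" using gen sq by (auto intro!: S3.inv_equality)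
  have \<alpha>: "S3.\<alpha> (lreg S3 s) = lreg S3 s \<otimes>\<^sub>o A + lreg S3 t \<otimes>\<^sub>o B"
    "S3.\<alpha> (lreg S3 t) = lreg S3 s \<otimes>\<^sub>o C + lreg S3 t \<otimes>\<^sub>o D"
    unfolding s t ABCD S3.\<alpha>_lreg[OF gen(1)] S3.\<alpha>_lreg[OF gen(2)] swap_ends_generators
    by (rule refl, rule add.commute)
  have \<Delta>: "S3.\<Delta> A = A \<otimes>\<^sub>o A + B \<otimes>\<^sub>o C" "S3.\<Delta> B = A \<otimes>\<^sub>o B + B \<otimes>\<^sub>o D"
    "S3.\<Delta> C = C \<otimes>\<^sub>o A + D \<otimes>\<^sub>o C" "S3.\<Delta> D = C \<otimes>\<^sub>o B + D \<otimes>\<^sub>o D"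
    unfolding ABCD S3.\<Delta>_V[OF gen(1)] S3.\<Delta>_V[OF gen(2)] S3.\<Delta>_Z[OF gen(1)] S3.\<Delta>_Z[OF gen(2)] swap_ends_generators
    by (rule refl, rule refl, rule add.commute, rule add.commute)
  have QISO: "is_QISO TYPE('y) S3 {s, t} Q S3.\<Delta> S3.\<alpha>"
    unfolding is_QISO_def s t Q
  proof (intro conjI allI impI)
    show "orientation_preserving_action S3 {\<sigma>, \<tau>} S3.DG.E S3.\<Delta> S3.\<alpha>"
      by (rule S3.orientation_preserving_doubling[OF S3.S_closed]) (use S3.\<theta>_S in auto)
    fix Q' :: "'y matop set" and \<Delta>' \<alpha>'
    assume "orientation_preserving_action S3 {\<sigma>, \<tau>} Q' \<Delta>' \<alpha>'"
    from S3_splitting[OF this] obtain p q where "splitting S3 swap_ends {\<sigma>, \<tau>} Q' \<Delta>' \<alpha>' p q" by blast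
    then interpret splitting S3 swap_ends "{\<sigma>, \<tau>}" Q' \<Delta>' \<alpha>' p q .
    show "\<exists>\<Phi>. orientation_preserving_morphism S3 S3.DG.E S3.\<Delta> S3.\<alpha> Q' \<Delta>' \<alpha>' \<Phi> \<and>
        (\<forall>\<Psi>. orientation_preserving_morphism S3 S3.DG.E S3.\<Delta> S3.\<alpha> Q' \<Delta>' \<alpha>' \<Psi> \<longrightarrow> (\<forall>a\<in>S3.DG.E. \<Psi> a = \<Phi> a))"
      using morphism_\<Phi> morphism_unique by blast
  qed
  have mem: "A \<in> S3.DG.E" "B \<in> S3.DG.E" "C \<in> S3.DG.E" "D \<in> S3.DG.E"
    unfolding ABCD by (rule S3.V_mem S3.Z_mem, rule gen)+
  have adj: "op_adj A = A" "op_adj B = B" "op_adj C = C" "op_adj D = D"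
    unfolding ABCD S3.V_adj[OF gen(1)] S3.V_adj[OF gen(2)] S3.Z_adj[OF gen(1)] S3.Z_adj[OF gen(2)] inv
    by (rule refl)+
  have prod: "A \<odot> A = S3.V \<one>\<^bsub>S3\<^esub>" "D \<odot> D = S3.V \<one>\<^bsub>S3\<^esub>" "B \<odot> B = S3.Z \<one>\<^bsub>S3\<^esub>" "C \<odot> C = S3.Z \<one>\<^bsub>S3\<^esub>"
    unfolding ABCD S3.V_mult[OF gen(1,1)] S3.V_mult[OF gen(2,2)] S3.Z_mult[OF gen(1,1)] S3.Z_mult[OF gen(2,2)] sq
    by (rule refl)+
  have zero: "A \<odot> B = 0" "A \<odot> C = 0" "D \<odot> B = 0" "D \<odot> C = 0" "B \<odot> A = 0" "B \<odot> D = 0" "C \<odot> A = 0" "C \<odot> D = 0"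
    unfolding ABCD by (rule S3.V_Z_mult S3.Z_V_mult)+
  have fund: "fundamental_corepresentation 2 Q S3.\<Delta> U"
    unfolding fundamental_corepresentation_def
  proof (intro conjI)
    show "corepresentation 2 Q S3.\<Delta> U"
      unfolding corepresentation_def sum2 lt2 Q
      by (auto simp: U \<Delta> mem)
    show "unitary_matrix 2 Q U"
      unfolding unitary_matrix_def sum2 lt2 Q unit_of_eqI[OF S3.is_unit_DG]
      by (auto simp: U adj prod zero add.commute)
    have "{U i j |i j. i < 2 \<and> j < 2} = {A, B, C, D}"
      unfolding lt2 U[symmetric] by blast
    also have "\<dots> = S3.V ` {\<sigma>, \<tau>} \<union> S3.Z ` {\<sigma>, \<tau>}"
      unfolding ABCD by blast
    finally show "cstar_generated {U i j |i j. i < 2 \<and> j < 2} = Q"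
      using S3.cstar_generated_DG Q by simp
  qed
  have \<alpha>_unique: "\<alpha>' a = S3.\<alpha> a"
    if "unital_star_hom CS3 (min_tensor CS3 Q) \<alpha>'" "\<alpha>' (lreg S3 s) = lreg S3 s \<otimes>\<^sub>o A + lreg S3 t \<otimes>\<^sub>o B"
      "\<alpha>' (lreg S3 t) = lreg S3 s \<otimes>\<^sub>o C + lreg S3 t \<otimes>\<^sub>o D" "a \<in> CS3" for \<alpha>' a
  proof (rule S3.eq_on_CG_if_eq_on_generators[where f = \<alpha>' and f' = S3.\<alpha> and a = a])
    show "\<alpha>' (lreg S3 g) = S3.\<alpha> (lreg S3 g)" if "g \<in> {\<sigma>, \<tau>}" for g
      using that \<open>\<alpha>' (lreg S3 s) = _\<close> \<open>\<alpha>' (lreg S3 t) = _\<close> \<alpha> unfolding s t by auto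
  qed (use that S3.star_hom_\<alpha> in \<open>auto simp: unital_star_hom_def S3.Cred_eq\<close>)
  have \<Delta>_unique: "\<Delta>' q = S3.\<Delta> q"
    if "unital_star_hom Q (min_tensor Q Q) \<Delta>'" "fundamental_corepresentation 2 Q \<Delta>' U" "q \<in> Q" for \<Delta>' q
  proof (rule S3.eq_on_DG_if_eq_on_generators[where f = \<Delta>' and f' = S3.\<Delta> and a = q])
    have eq: "\<Delta>' (U i j) = S3.\<Delta> (U i j)" if "i < 2" "j < 2" for i j
      using that \<open>fundamental_corepresentation 2 Q \<Delta>' U\<close> fund
      unfolding fundamental_corepresentation_def corepresentation_def by simp
    have "\<Delta>' A = S3.\<Delta> A" "\<Delta>' B = S3.\<Delta> B" "\<Delta>' C = S3.\<Delta> C" "\<Delta>' D = S3.\<Delta> D"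
      using eq[of 0 0] eq[of 0 "Suc 0"] eq[of "Suc 0" 0] eq[of "Suc 0" "Suc 0"] by (simp_all only: U lt2 simp_thms)
    then show "\<Delta>' (S3.V g) = S3.\<Delta> (S3.V g)" "\<Delta>' (S3.Z g) = S3.\<Delta> (S3.Z g)" if "g \<in> {\<sigma>, \<tau>}" for g
      using that unfolding ABCD by auto
  qed (use that S3.star_hom_\<Delta> in \<open>auto simp: unital_star_hom_def Q\<close>)
  show ?thesis
  proof (rule exI[of _ S3.\<Delta>], rule exI[of _ S3.\<alpha>], intro conjI)
    show "\<forall>\<alpha>'. unital_star_hom CS3 (min_tensor CS3 Q) \<alpha>'
          \<and> \<alpha>' (lreg S3 s) = lreg S3 s \<otimes>\<^sub>o A + lreg S3 t \<otimes>\<^sub>o B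
          \<and> \<alpha>' (lreg S3 t) = lreg S3 s \<otimes>\<^sub>o C + lreg S3 t \<otimes>\<^sub>o D
          \<longrightarrow> (\<forall>a\<in>CS3. \<alpha>' a = S3.\<alpha> a)"
      using \<alpha>_unique by blast
    show "\<forall>\<Delta>'. unital_star_hom Q (min_tensor Q Q) \<Delta>'
          \<and> fundamental_corepresentation 2 Q \<Delta>' U
          \<longrightarrow> (\<forall>q\<in>Q. \<Delta>' q = S3.\<Delta> q)"
      using \<Delta>_unique by blast
  qed (fact QISO, fact \<alpha>(1), fact \<alpha>(2), fact fund)
qed

end
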